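(* Let $k$ be a finite field of cardinality $q$, let $l$ be a prime number, and let $\mathbf{G}$ be an étale $l$-divisible group over $k$ with $q$-power Frobenius automorphism $\mathrm{F}_q$. Let $\chi\in\mathbf{Z}_l[t]$ be the characteristic polynomial of $\mathrm{F}_q$ on the Tate module of $\mathbf{G}$; then $t$ is invertible in $\mathbf{Z}_l[t]/(\chi)$, and $\mathbf{Z}_l[t]/(\chi)$ acts on $\mathbf{G}$ with $t$ acting as $\mathrm{F}_q$. Let $n$ be a non-negative integer, let $a$ be a positive integer such that $t^a=1$ in $(\mathbf{Z}_l[t]/(l^n,\chi))^\times$, let $h_a$ be the unique element of $\mathbf{Z}_l[t]/(\chi)$ such that $t^a-1=l^nh_a$ in $\mathbf{Z}_l[t]/(\chi)$, and let $k_a$ be an extension of $k$ of degree $a$. Then $\mathrm{F}_q^a-1=l^nh_a(\mathrm{F}_q)$ on $\mathbf{G}$, all points of $\mathbf{G}[l^n]$ are $k_a$-rational, and the Kummer map of order $l^n$ on $\mathbf{G}$ over $k_a$ is the isomorphism $$K_{l^n}^{\mathbf{G}/k_a}\colon\mathbf{G}(k_a)/l^n\mathbf{G}(k_a)\overset{\sim}{\longrightarrow}\mathbf{G}[l^n](k_a),\qquad x\longmapsto h_a(\mathrm{F}_q)(x).$$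
   Context: Let $k_1$ be a finite field of cardinality $q_1$ and $\mathbf{G}$ an étale $l$-divisible group over $k_1$, and let $n$ be a non-negative integer such that all points of $\mathbf{G}[l^n]$ are $k_1$-rational. The Kummer map of order $l^n$ on $\mathbf{G}$ over $k_1$ is the isomorphism $K_{l^n}^{\mathbf{G}/k_1}\colon\mathbf{G}(k_1)/l^n\mathbf{G}(k_1)\overset{\sim}{\longrightarrow}\mathbf{G}[l^n](k_1)$, $x\mapsto\mathrm{F}_{q_1}(y)-y$, where $\mathrm{F}_{q_1}$ is the $q_1$-power Frobenius automorphism of $\mathbf{G}$ and $y$ is any point of $\mathbf{G}$ over an algebraic closure of $k_1$ such that $l^ny$ is a lift of $x$ to $\mathbf{G}(k_1)$. For $k_1=k_a$ an extension of degree $a$ of a field $k$ with $q$ elements, $\mathrm{F}_{q_1}=\mathrm{F}_q^a$.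
   Formalization: The Kummer map is shown to be a well-defined injective homomorphism given by h_a(F_q) in general, but an isomorphism only if n = 0 or G(k_a) is finite; otherwise this fails, e.g. for the constant group Q_l/Z_l with a = 1, n ≥ 1, where G(k)/l^n = 0 but G[l^n](k) = Z/l^n. *)

theory Defs
  imports
    "HOL-Algebra.Algebra"
    "HOL-Algebra.Algebraic_Closure_Type"
    "Jordan_Normal_Form.Char_Poly"
    "Berlekamp_Zassenhaus.Finite_Field"
begin

section \<open>The ring of l-adic integers\<close>

text \<open>
  The prime is \<open>l = CARD('l)\<close>. An l-adic integer is a coherent sequence of residues: its
  \<open>n\<close>-th entry is the representative of the class modulo \<open>l ^ n\<close> in \<open>{0..<l ^ n}\<close>.
\<close>

typedef (overloaded) ('l::prime_card) padic =
  "{f :: nat \<Rightarrow> int. \<forall>n. f n = f (Suc n) mod int CARD('l) ^ n}"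
  morphisms residue Abs_padic
  by (rule exI[of _ "\<lambda>_. 0"]) simp

setup_lifting type_definition_padic

lemma coherent_ops:
  fixes f g :: "nat \<Rightarrow> int" and p :: int
  assumes f: "\<And>n. f n = f (Suc n) mod p ^ n" and g: "\<And>n. g n = g (Suc n) mod p ^ n"
  shows "(f n + g n) mod p ^ n = (f (Suc n) + g (Suc n)) mod p ^ Suc n mod p ^ n"
    and "(f n - g n) mod p ^ n = (f (Suc n) - g (Suc n)) mod p ^ Suc n mod p ^ n"
    and "(f n * g n) mod p ^ n = (f (Suc n) * g (Suc n)) mod p ^ Suc n mod p ^ n"
    and "(- f n) mod p ^ n = (- f (Suc n)) mod p ^ Suc n mod p ^ n"
proof -
  have *: "k mod p ^ Suc n mod p ^ n = k mod p ^ n" for k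
    by (rule mod_mod_cancel) simp
  show "(f n + g n) mod p ^ n = (f (Suc n) + g (Suc n)) mod p ^ Suc n mod p ^ n"
    unfolding * f[of n] g[of n] by (rule mod_add_eq)
  show "(f n - g n) mod p ^ n = (f (Suc n) - g (Suc n)) mod p ^ Suc n mod p ^ n"
    unfolding * f[of n] g[of n] by (rule mod_diff_eq)
  show "(f n * g n) mod p ^ n = (f (Suc n) * g (Suc n)) mod p ^ Suc n mod p ^ n"
    unfolding * f[of n] g[of n] by (rule mod_mult_eq)
  show "(- f n) mod p ^ n = (- f (Suc n)) mod p ^ Suc n mod p ^ n"
    unfolding * f[of n] by (rule mod_minus_eq)
qed

lemma residue_mod: "residue (x :: 'l::prime_card padic) n mod int CARD('l) ^ n = residue x n"
proof -
  have "residue x n = residue x (Suc n) mod int CARD('l) ^ n"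
    using residue[of x] by blast
  then show ?thesis
    by (metis mod_mod_trivial)
qed

instantiation padic :: (prime_card) comm_ring_1
begin

lift_definition zero_padic :: "'a padic" is "\<lambda>_. 0" by simp

lift_definition one_padic :: "'a padic" is "\<lambda>n. 1 mod int CARD('a) ^ n"
  by (rule mod_mod_cancel[symmetric]) simp

lift_definition plus_padic :: "'a padic \<Rightarrow> 'a padic \<Rightarrow> 'a padic"
  is "\<lambda>f g n. (f n + g n) mod int CARD('a) ^ n"
  subgoal for f g n by (rule coherent_ops(1)[where f = f and g = g])
  done

lift_definition uminus_padic :: "'a padic \<Rightarrow> 'a padic"
  is "\<lambda>f n. (- f n) mod int CARD('a) ^ n"
  subgoal for f n by (rule coherent_ops(4)[where f = f and g = f])
  done

lift_definition minus_padic :: "'a padic \<Rightarrow> 'a padic \<Rightarrow> 'a padic"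
  is "\<lambda>f g n. (f n - g n) mod int CARD('a) ^ n"
  subgoal for f g n by (rule coherent_ops(2)[where f = f and g = g])
  done

lift_definition times_padic :: "'a padic \<Rightarrow> 'a padic \<Rightarrow> 'a padic"
  is "\<lambda>f g n. (f n * g n) mod int CARD('a) ^ n"
  subgoal for f g n by (rule coherent_ops(3)[where f = f and g = g])
  done

lemma residue_simps:
  "residue (0 :: 'a padic) n = 0"
  "residue (1 :: 'a padic) n = 1 mod int CARD('a) ^ n"
  "residue (x + y :: 'a padic) n = (residue x n + residue y n) mod int CARD('a) ^ n"
  "residue (- x :: 'a padic) n = (- residue x n) mod int CARD('a) ^ n"
  "residue (x - y :: 'a padic) n = (residue x n - residue y n) mod int CARD('a) ^ n"
  "residue (x * y :: 'a padic) n = (residue x n * residue y n) mod int CARD('a) ^ n"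
  by (simp_all only: zero_padic.rep_eq one_padic.rep_eq plus_padic.rep_eq uminus_padic.rep_eq
      minus_padic.rep_eq times_padic.rep_eq)

instance
proof
  fix a b c :: "'a padic"
  note ext = residue_inject[THEN iffD1, OF ext]
  show "a + b + c = a + (b + c)"
    by (rule ext) (simp add: residue_simps mod_simps add.assoc)
  show "a + b = b + a"
    by (rule ext) (simp add: residue_simps add.commute)
  show "0 + a = a"
    by (rule ext) (simp add: residue_simps residue_mod)
  show "- a + a = 0"
    by (rule ext) (simp add: residue_simps mod_simps)
  show "a - b = a + - b"
    by (rule ext) (simp add: residue_simps mod_simps)
  show "a * b * c = a * (b * c)"
    by (rule ext) (simp add: residue_simps mod_simps mult.assoc)
  show "a * b = b * a"
    by (rule ext) (simp add: residue_simps mult.commute)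
  show "1 * a = a"
    by (rule ext) (simp add: residue_simps mod_simps residue_mod)
  show "(a + b) * c = a * c + b * c"
    by (rule ext) (simp add: residue_simps mod_simps distrib_right)
  have "int CARD('a) > 1"
    using prime_card[where ?'a = 'a] prime_gt_1_nat by force
  then have "residue (0 :: 'a padic) 1 \<noteq> residue 1 1"
    by (simp add: residue_simps)
  then show "(0 :: 'a padic) \<noteq> 1"
    by metis
qed

end

abbreviation Zl_poly :: "'l::prime_card padic poly ring" where
  "Zl_poly \<equiv> ring_of_type_algebra"


section \<open>Finite commutative group schemes over a field\<close>

text \<open>
  A finite commutative group scheme over \<open>k\<close> is the spectrum of a finite-dimensional commutative
  and cocommutative Hopf algebra \<open>A\<close> over \<open>k\<close>. Such an \<open>A\<close> is given here by structure constants
  with respect to a basis \<open>e\<^sub>0, \<dots>, e\<^sub>d\<^sub>-\<^sub>1\<close>, \<open>d = rk\<close>: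
  \<open>e\<^sub>i e\<^sub>j = \<Sum>m. mul i j m e\<^sub>m\<close> and \<open>1 = \<Sum>m. unt m e\<^sub>m\<close>,
  \<open>\<Delta> e\<^sub>m = \<Sum>i j. comul m i j (e\<^sub>i \<otimes> e\<^sub>j)\<close>, \<open>\<epsilon> e\<^sub>m = counit m\<close>, \<open>S e\<^sub>m = \<Sum>i. antipode m i e\<^sub>i\<close>.
\<close>

record 'k hopf =
  rk :: nat
  mul :: "nat \<Rightarrow> nat \<Rightarrow> nat \<Rightarrow> 'k"
  unt :: "nat \<Rightarrow> 'k"
  comul :: "nat \<Rightarrow> nat \<Rightarrow> nat \<Rightarrow> 'k"
  counit :: "nat \<Rightarrow> 'k"
  antipode :: "nat \<Rightarrow> nat \<Rightarrow> 'k"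

definition comm_algebra :: "'k::field hopf \<Rightarrow> bool" where
  "comm_algebra A \<longleftrightarrow> (let d = rk A; c = mul A; u = unt A in
     (\<forall>i<d. \<forall>j<d. \<forall>m<d. c i j m = c j i m) \<and>
     (\<forall>i<d. \<forall>j<d. \<forall>r<d. \<forall>m<d. (\<Sum>p<d. c i j p * c p r m) = (\<Sum>p<d. c j r p * c i p m)) \<and>
     (\<forall>j<d. \<forall>m<d. (\<Sum>i<d. u i * c i j m) = (if j = m then 1 else 0)))"

definition cocomm_coalgebra :: "'k::field hopf \<Rightarrow> bool" where
  "cocomm_coalgebra A \<longleftrightarrow> (let d = rk A; \<delta> = comul A; \<epsilon> = counit A in
     (\<forall>m<d. \<forall>i<d. \<forall>j<d. \<delta> m i j = \<delta> m j i) \<and>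
     (\<forall>m<d. \<forall>i<d. \<forall>j<d. \<forall>r<d. (\<Sum>p<d. \<delta> m p r * \<delta> p i j) = (\<Sum>p<d. \<delta> m i p * \<delta> p j r)) \<and>
     (\<forall>m<d. \<forall>j<d. (\<Sum>i<d. \<epsilon> i * \<delta> m i j) = (if m = j then 1 else 0)))"

text \<open>
  The first four conditions say that \<open>\<Delta>\<close> and \<open>\<epsilon>\<close> are homomorphisms of unital algebras, the last
  one is the antipode identity \<open>\<mu> \<circ> (S \<otimes> id) \<circ> \<Delta> = 1 \<circ> \<epsilon>\<close>.
\<close>

definition comm_hopf_algebra :: "'k::field hopf \<Rightarrow> bool" where
  "comm_hopf_algebra A \<longleftrightarrow> comm_algebra A \<and> cocomm_coalgebra A \<and>
     (let d = rk A; c = mul A; u = unt A; \<delta> = comul A; \<epsilon> = counit A; S = antipode A in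
       (\<forall>i<d. \<forall>j<d. \<forall>p<d. \<forall>r<d. (\<Sum>m<d. c i j m * \<delta> m p r) =
          (\<Sum>s<d. \<Sum>t<d. \<Sum>s'<d. \<Sum>t'<d. \<delta> i s t * \<delta> j s' t' * c s s' p * c t t' r)) \<and>
       (\<forall>i<d. \<forall>j<d. (\<Sum>m<d. u m * \<delta> m i j) = u i * u j) \<and>
       (\<forall>i<d. \<forall>j<d. (\<Sum>m<d. c i j m * \<epsilon> m) = \<epsilon> i * \<epsilon> j) \<and>
       (\<Sum>m<d. u m * \<epsilon> m) = 1 \<and>
       (\<forall>m<d. \<forall>r<d. (\<Sum>i<d. \<Sum>j<d. \<Sum>p<d. \<delta> m i j * S i p * c p j r) = \<epsilon> m * u r))"

text \<open>
  A point of \<open>Spec A\<close> over the algebraic closure, i.e. a homomorphism of \<open>k\<close>-algebras \<open>x\<close> from \<open>A\<close>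
  to the closure, is identified with the vector of its values \<open>x $ i = x e\<^sub>i\<close>.
\<close>

definition points :: "'k::field hopf \<Rightarrow> 'k alg_closure vec set" where
  "points A = {x \<in> carrier_vec (rk A).
     (\<forall>i<rk A. \<forall>j<rk A. x $ i * x $ j = (\<Sum>m<rk A. to_ac (mul A i j m) * x $ m)) \<and>
     (\<Sum>m<rk A. to_ac (unt A m) * x $ m) = 1}"

text \<open>The product of two points \<open>x\<close>, \<open>y\<close> is \<open>(x \<otimes> y) \<circ> \<Delta>\<close>.\<close>

definition point_group :: "'k::field hopf \<Rightarrow> 'k alg_closure vec monoid" where
  "point_group A = \<lparr>carrier = points A,
     monoid.mult = (\<lambda>x y. vec (rk A)
       (\<lambda>m. \<Sum>i<rk A. \<Sum>j<rk A. to_ac (comul A m i j) * (x $ i * y $ j))),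
     one = vec (rk A) (\<lambda>m. to_ac (counit A m))\<rparr>"

text \<open>
  \<open>A\<close> is etale if \<open>A\<close> becomes isomorphic, as an algebra, to a power of the algebraic closure
  after base change to it; \<open>P\<close> is the matrix of such an isomorphism.
\<close>

definition etale :: "'k::field hopf \<Rightarrow> bool" where
  "etale A \<longleftrightarrow> (\<exists>P \<in> carrier_mat (rk A) (rk A).
     invertible_mat P \<and> (\<forall>s<rk A. row P s \<in> points A))"

text \<open>
  A homomorphism of group schemes \<open>Spec B \<rightarrow> Spec A\<close> is a homomorphism of bialgebras
  \<open>A \<rightarrow> B\<close>, \<open>e\<^sub>i \<mapsto> \<Sum>j. M i j e\<^sub>j\<close> (compatibility with counit and antipode is automatic). On points
  it is multiplication by \<open>M\<close>.
\<close>

definition hopf_hom :: "'k::field hopf \<Rightarrow> 'k hopf \<Rightarrow> 'k mat \<Rightarrow> bool" where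
  "hopf_hom A B M \<longleftrightarrow> M \<in> carrier_mat (rk A) (rk B) \<and>
     (\<forall>i<rk A. \<forall>j<rk A. \<forall>p<rk B. (\<Sum>m<rk A. mul A i j m * M $$ (m, p)) =
        (\<Sum>s<rk B. \<Sum>t<rk B. M $$ (i, s) * M $$ (j, t) * mul B s t p)) \<and>
     (\<forall>p<rk B. (\<Sum>m<rk A. unt A m * M $$ (m, p)) = unt B p) \<and>
     (\<forall>m<rk A. \<forall>s<rk B. \<forall>t<rk B. (\<Sum>p<rk B. M $$ (m, p) * comul B p s t) =
        (\<Sum>i<rk A. \<Sum>j<rk A. comul A m i j * M $$ (i, s) * M $$ (j, t)))"

definition on_points :: "'k::field mat \<Rightarrow> 'k alg_closure vec \<Rightarrow> 'k alg_closure vec" where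
  "on_points M x = map_mat to_ac M *\<^sub>v x"


section \<open>Etale l-divisible groups\<close>

text \<open>
  An inductive system \<open>G\<^sub>0 \<rightarrow> G\<^sub>1 \<rightarrow> \<dots>\<close> of finite group schemes; \<open>inc \<nu>\<close> is the matrix of the
  algebra homomorphism belonging to \<open>G\<^sub>\<nu> \<rightarrow> G\<^sub>\<nu>\<^sub>+\<^sub>1\<close>.
\<close>

record 'k ind_group =
  height :: nat
  level :: "nat \<Rightarrow> 'k hopf"
  inc :: "nat \<Rightarrow> 'k mat"

text \<open>
  \<open>G\<^sub>\<nu>\<close> has order \<open>l\<close> to the power \<open>\<nu> height\<close>, and \<open>0 \<rightarrow> G\<^sub>\<nu> \<rightarrow> G\<^sub>\<nu>\<^sub>+\<^sub>1 \<rightarrow> G\<^sub>\<nu>\<^sub>+\<^sub>1\<close>, with second map the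
  multiplication by \<open>l ^ \<nu>\<close>, is exact. All \<open>G\<^sub>\<nu>\<close> are etale, so that exactness is exactness on
  points over the algebraic closure.
\<close>

definition etale_l_divisible :: "nat \<Rightarrow> 'k::field ind_group \<Rightarrow> bool" where
  "etale_l_divisible l G \<longleftrightarrow> (\<forall>\<nu>.
     comm_hopf_algebra (level G \<nu>) \<and> etale (level G \<nu>) \<and>
     rk (level G \<nu>) = l ^ (\<nu> * height G) \<and>
     hopf_hom (level G (Suc \<nu>)) (level G \<nu>) (inc G \<nu>) \<and>
     inj_on (on_points (inc G \<nu>)) (points (level G \<nu>)) \<and>
     on_points (inc G \<nu>) ` points (level G \<nu>) =
       {x \<in> points (level G (Suc \<nu>)).
          x [^]\<^bsub>point_group (level G (Suc \<nu>))\<^esub> (l ^ \<nu>) = \<one>\<^bsub>point_group (level G (Suc \<nu>))\<^esub>})"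

text \<open>
  The points of \<open>G\<close> form the colimit of the points of the \<open>G\<^sub>\<nu>\<close>. Its elements are equivalence
  classes \<open>germ G \<nu> x\<close> of pairs \<open>(\<nu>, x)\<close> with \<open>x\<close> a point of \<open>G\<^sub>\<nu>\<close>.
\<close>

type_synonym 'k gpoint = "(nat \<times> 'k alg_closure vec) set"

fun transition :: "'k::field ind_group \<Rightarrow> nat \<Rightarrow> nat \<Rightarrow> 'k alg_closure vec \<Rightarrow> 'k alg_closure vec"
where
  "transition G \<nu> 0 x = x"
| "transition G \<nu> (Suc d) x = on_points (inc G (\<nu> + d)) (transition G \<nu> d x)"

definition germ :: "'k::field ind_group \<Rightarrow> nat \<Rightarrow> 'k alg_closure vec \<Rightarrow> 'k gpoint" where
  "germ G \<nu> x = {(\<mu>, y). y \<in> points (level G \<mu>) \<and>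
     (\<exists>d e. \<nu> + d = \<mu> + e \<and> transition G \<nu> d x = transition G \<mu> e y)}"

text \<open>\<open>G(K)\<close> for a subfield \<open>K\<close> of the algebraic closure.\<close>

definition pts :: "'k::field ind_group \<Rightarrow> 'k alg_closure set \<Rightarrow> 'k gpoint set" where
  "pts G K = {germ G \<nu> x | \<nu> x. x \<in> points (level G \<nu>) \<and> (\<forall>i<rk (level G \<nu>). x $ i \<in> K)}"

text \<open>The group \<open>G(K)\<close>. It is written multiplicatively, so \<open>\<xi> [^] m\<close> is the multiple \<open>m \<xi>\<close>.\<close>

definition pt_group :: "'k::field ind_group \<Rightarrow> 'k alg_closure set \<Rightarrow> 'k gpoint monoid" where
  "pt_group G K = \<lparr>carrier = pts G K,
     monoid.mult = (\<lambda>\<xi> \<eta>. \<Union> {germ G \<nu> (x \<otimes>\<^bsub>point_group (level G \<nu>)\<^esub> y) | \<nu> x y.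
       (\<nu>, x) \<in> \<xi> \<and> (\<nu>, y) \<in> \<eta>}),
     one = germ G 0 \<one>\<^bsub>point_group (level G 0)\<^esub>\<rparr>"

abbreviation geom :: "'k::field ind_group \<Rightarrow> 'k gpoint monoid" where
  "geom G \<equiv> pt_group G UNIV"

definition torsion :: "'k::field ind_group \<Rightarrow> nat \<Rightarrow> 'k alg_closure set \<Rightarrow> 'k gpoint set" where
  "torsion G m K = {\<xi> \<in> pts G K. \<xi> [^]\<^bsub>geom G\<^esub> m = \<one>\<^bsub>geom G\<^esub>}"

text \<open>
  The \<open>m\<close>-power Frobenius of \<open>G\<close>, for \<open>m\<close> the cardinality of the field or of a finite extension.
  It is given by \<open>a \<mapsto> a ^ m\<close> on the algebras, so on points by the \<open>m\<close>-th power of the coordinates.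
\<close>

definition frob :: "'k::field ind_group \<Rightarrow> nat \<Rightarrow> 'k gpoint \<Rightarrow> 'k gpoint" where
  "frob G m = (\<lambda>\<xi> \<in> carrier (geom G). \<Union> {germ G \<nu> (map_vec (\<lambda>c. c ^ m) x) | \<nu> x. (\<nu>, x) \<in> \<xi>})"

text \<open>
  The ring of endomorphisms of \<open>G\<close> over \<open>k\<close>: the endomorphisms of the group of geometric points
  that are induced on every \<open>G\<^sub>\<nu>\<close> by a homomorphism of group schemes over \<open>k\<close>.
\<close>

definition End :: "'k::field ind_group \<Rightarrow> ('k gpoint \<Rightarrow> 'k gpoint) ring" where
  "End G = \<lparr>carrier = {f \<in> hom (geom G) (geom G) \<inter> extensional (carrier (geom G)).
       \<forall>\<nu>. \<exists>M. hopf_hom (level G \<nu>) (level G \<nu>) M \<and>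
         (\<forall>x \<in> points (level G \<nu>). f (germ G \<nu> x) = germ G \<nu> (on_points M x))},
     monoid.mult = compose (carrier (geom G)),
     one = (\<lambda>\<xi> \<in> carrier (geom G). \<xi>),
     ring.zero = (\<lambda>\<xi> \<in> carrier (geom G). \<one>\<^bsub>geom G\<^esub>),
     ring.add = (\<lambda>f g. \<lambda>\<xi> \<in> carrier (geom G). f \<xi> \<otimes>\<^bsub>geom G\<^esub> g \<xi>)\<rparr>"


section \<open>The Tate module and the characteristic polynomial of Frobenius\<close>

definition tate :: "nat \<Rightarrow> 'k::field ind_group \<Rightarrow> (nat \<Rightarrow> 'k gpoint) set" where
  "tate l G = {\<xi>. (\<forall>\<nu>. \<xi> \<nu> \<in> torsion G (l ^ \<nu>) UNIV) \<and> (\<forall>\<nu>. \<xi> (Suc \<nu>) [^]\<^bsub>geom G\<^esub> l = \<xi> \<nu>)}"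

text \<open>
  The linear combination \<open>\<Sum>i. c\<^sub>i B\<^sub>i\<close> in the Tate module; an l-adic integer \<open>c\<close> acts on the
  \<open>l ^ \<nu>\<close>-torsion as its residue modulo \<open>l ^ \<nu>\<close>.
\<close>

definition tate_lincomb ::
  "'k::field ind_group \<Rightarrow> (nat \<Rightarrow> nat \<Rightarrow> 'k gpoint) \<Rightarrow> 'l::prime_card padic vec \<Rightarrow> nat \<Rightarrow> 'k gpoint"
where
  "tate_lincomb G B c = (\<lambda>\<nu>. \<Otimes>\<^bsub>geom G\<^esub>i\<in>{..<height G}. (B i \<nu> [^]\<^bsub>geom G\<^esub> residue (c $ i) \<nu>))"

definition tate_basis ::
  "'l::prime_card itself \<Rightarrow> 'k::field ind_group \<Rightarrow> (nat \<Rightarrow> nat \<Rightarrow> 'k gpoint) \<Rightarrow> bool"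
where
  "tate_basis _ G B \<longleftrightarrow> (\<forall>i<height G. B i \<in> tate CARD('l) G) \<and>
     (\<forall>\<xi> \<in> tate CARD('l) G. \<exists>!c :: 'l padic vec.
        c \<in> carrier_vec (height G) \<and> \<xi> = tate_lincomb G B c)"

text \<open>
  The characteristic polynomial of the \<open>q\<close>-power Frobenius on the Tate module, \<open>q = CARD('k)\<close>,
  computed from the matrix \<open>M\<close> of Frobenius in any basis of the Tate module.
\<close>

definition frob_char_poly :: "'k::{finite,field} ind_group \<Rightarrow> 'l::prime_card padic poly" where
  "frob_char_poly G = (THE \<chi>. \<exists>B M. tate_basis TYPE('l) G B \<and>
     M \<in> carrier_mat (height G) (height G) \<and>
     (\<forall>j<height G. (\<lambda>\<nu>. frob G CARD('k) (B j \<nu>)) = tate_lincomb G B (col M j)) \<and>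
     \<chi> = char_poly M)"


section \<open>The Kummer map\<close>

definition multiples :: "'k::field ind_group \<Rightarrow> nat \<Rightarrow> 'k alg_closure set \<Rightarrow> 'k gpoint set" where
  "multiples G m K = (\<lambda>\<xi>. \<xi> [^]\<^bsub>geom G\<^esub> m) ` pts G K"

text \<open>
  The Kummer map of order \<open>m\<close> over the finite subfield \<open>K\<close>, on cosets of \<open>m G(K)\<close> in \<open>G(K)\<close>.
  It is always injective into \<open>G[m](K)\<close> when all points of \<open>G[m]\<close> are \<open>K\<close>-rational. For \<open>m\<close> a
  nontrivial power of \<open>l\<close> it is onto only if \<open>frob G (card K) - 1\<close> is onto, that is if \<open>G(K)\<close> is
  finite: for the constant l-divisible group of height 1, whose Frobenius is the identity, it is
  the zero map from a trivial group.
\<close>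

definition kummer_map ::
  "'k::field ind_group \<Rightarrow> nat \<Rightarrow> 'k alg_closure set \<Rightarrow> 'k gpoint set \<Rightarrow> 'k gpoint"
where
  "kummer_map G m K C = (THE \<zeta>. \<exists>\<xi> \<in> C. \<exists>\<eta> \<in> carrier (geom G).
     \<eta> [^]\<^bsub>geom G\<^esub> m = \<xi> \<and> \<zeta> = frob G (card K) \<eta> \<otimes>\<^bsub>geom G\<^esub> inv\<^bsub>geom G\<^esub> \<eta>)"


section \<open>Field extensions\<close>

text \<open>Extensions of \<open>k\<close> of degree \<open>a\<close>, taken inside the algebraic closure.\<close>

definition extension_of_degree :: "nat \<Rightarrow> 'k::field alg_closure set \<Rightarrow> bool" where
  "extension_of_degree a K \<longleftrightarrow>
     subfield K (ring_of_type_algebra :: 'k alg_closure ring) \<and>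
     range (to_ac :: 'k \<Rightarrow> 'k alg_closure) \<subseteq> K \<and>
     ring.dimension (ring_of_type_algebra :: 'k alg_closure ring) a (range to_ac) K"

end

theory Submission
  imports Defs
begin

text \<open>
  The group \<open>A\<close> of geometric points is \<open>l\<close>-power torsion with \<open>|A[l ^ \<nu>]| = l ^ (\<nu> h)\<close>, and the
  l-adic polynomials act on it with \<open>X\<close> acting as Frobenius. Counting gives divisibility and a basis
  of the Tate module; multiplying \<open>X - M\<close> by its adjugate shows that \<open>\<chi>\<close> kills the Tate module, hence
  \<open>A\<close>. So \<open>l ^ n h\<^sub>a(F) = F ^ a - 1\<close> on \<open>A\<close>, and if \<open>l ^ n y = x\<close>, then
  \<open>F ^ a y - y = h\<^sub>a(F) (l ^ n y) = h\<^sub>a(F) x\<close>. Etale group schemes enter only through their points: over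
  a finite field, homomorphisms are the homomorphisms on geometric points that commute with Frobenius,
  so the endomorphism ring of \<open>G\<close> is the centralizer of Frobenius in the endomorphism ring of \<open>A\<close>.
\<close>

text \<open>An endomorphism of \<open>G\<close> must have a matrix over \<open>k\<close> on every
  level, and an l-adic polynomial in Frobenius comes with none; this is why equivariant maps have to
  be descended before \<open>Z_l[t]/(\<chi>)\<close> can act at all. About the Kummer map only the
  relation \<open>F^a - 1 = l^n r\<close> in the endomorphism ring matters. It says that
  \<open>x\<close> is rational iff \<open>r (l^n x) = 0\<close>, and this gives rationality of the
  torsion, independence of all choices, and injectivity, because a point can be divided by
  \<open>l^n\<close> before the criterion is applied. Surjectivity is not formal: it comes from
  comparing cardinalities, hence the restriction to finite \<open>G(K)\<close> or
  \<open>n = 0\<close>. Two properties of \<open>\<chi>\<close> are behind the algebraic claims. Its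
  constant coefficient is \<open>det (- M)\<close>, a unit because \<open>F\<close> has an inverse
  on \<open>A\<close>, so \<open>t\<close> is invertible. It is monic, so \<open>l^n\<close> remains
  a nonzerodivisor modulo \<open>\<chi>\<close> and \<open>h_a\<close> is unique. As
  \<open>frob_char_poly\<close> is a definite description, existence of a Tate basis and invariance
  under change of basis have to be proved before anything can be said about it.\<close>

no_notation fps_nth (infixl \<open>$\<close> 75)
no_notation fls_nth (infixl \<open>$$\<close> 75)

section \<open>l-adic integers, polynomials and finite fields\<close>

lemma residue_mod_le:
  fixes x :: "'l::prime_card padic"
  assumes "m \<le> n"
  shows "residue x n mod int CARD('l) ^ m = residue x m"
  using assms
proof (induction n rule: dec_induct)
  case base
  show ?case by (rule residue_mod)
next
  case (step n)
  have "residue x (Suc n) mod int CARD('l) ^ m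
      = residue x (Suc n) mod int CARD('l) ^ n mod int CARD('l) ^ m"
    using step.hyps by (simp add: mod_mod_cancel le_imp_power_dvd)
  also have "residue x (Suc n) mod int CARD('l) ^ n = residue x n"
    using residue[of x] by (metis (mono_tags, lifting) mem_Collect_eq)
  finally show ?case using step.IH by simp
qed

lemma padic_eqI: "(\<And>n. residue x n = residue y n) \<Longrightarrow> x = y"
  by (simp add: residue_inject[symmetric] ext)

lemma padic_of_coherent:
  assumes "\<And>n. f n = f (Suc n) mod int CARD('l::prime_card) ^ n"
  obtains x :: "'l::prime_card padic" where "\<And>n. residue x n = f n"
proof
  have "f \<in> {f. \<forall>n. f n = f (Suc n) mod int CARD('l) ^ n}" using assms by blast
  then show "residue (Abs_padic f :: 'l padic) n = f n" for n
    by (rule fun_cong[OF Abs_padic_inverse])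
qed

section \<open>Torsion-freeness of \<open>Z_l\<close> and of its quotients by monic
  polynomials\<close>

lemma residue_of_nat: "residue (of_nat k :: 'l::prime_card padic) n = int k mod int CARD('l) ^ n"
  by (induction k) (simp_all add: residue_simps mod_simps add.commute)

text \<open>Multiplication by \<open>l ^ n\<close> costs \<open>n\<close> digits: that
  \<open>x\<close> vanishes modulo \<open>l ^ m\<close> is read off from the product at level
  \<open>n + m\<close>.\<close>

lemma padic_torsion_free:
  fixes x :: "'l::prime_card padic"
  assumes "of_nat (CARD('l) ^ n) * x = 0"
  shows "x = 0"
proof (rule padic_eqI)
  fix m
  let ?L = "int CARD('l)"
  have L: "?L \<noteq> 0" by simp
  have "residue (of_nat (CARD('l) ^ n) * x) (n + m) = 0"
    using assms by (simp only: residue_simps)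
  then have "?L ^ n * residue x (n + m) mod ?L ^ (n + m) = 0"
    unfolding residue_simps residue_of_nat mod_mult_left_eq by simp
  then have "?L ^ m dvd residue x (n + m)"
    using L by (simp add: power_add mod_eq_0_iff_dvd)
  then have "residue x m = 0"
    using residue_mod_le[of m "n + m" x] by (simp add: mod_eq_0_iff_dvd[symmetric])
  then show "residue x m = residue 0 m" by (simp add: residue_simps)
qed

text \<open>Descending induction on \<open>i\<close>: as \<open>\<chi>\<close> is monic, the
  coefficient of \<open>\<chi> * g\<close> at \<open>degree \<chi> + i\<close> is
  \<open>coeff g i\<close> plus multiples of coefficients of \<open>g\<close> of index above
  \<open>i\<close>.\<close>

lemma dvd_coeff_of_dvd_coeff_monic_mult:
  fixes \<chi> g :: "'a::comm_ring_1 poly"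
  assumes monic: "lead_coeff \<chi> = 1" and dvd: "\<And>i. m dvd coeff (\<chi> * g) i"
  shows "m dvd coeff g i"
\<comment> \<open>Subtraction is truncated, so every \<open>i \<ge> degree g\<close> has measure 0;
  there all coefficients of higher index vanish and the induction hypothesis is not called.\<close>
proof (induction "degree g - i" arbitrary: i rule: less_induct)
  case less
  let ?d = "degree \<chi>"
  have "coeff (\<chi> * g) (?d + i) = (\<Sum>j\<le>?d + i. coeff \<chi> j * coeff g (?d + i - j))"
    by (rule coeff_mult)
  also have "\<dots> = coeff g i + (\<Sum>j\<in>{..?d + i} - {?d}. coeff \<chi> j * coeff g (?d + i - j))"
    using monic by (subst sum.remove[of _ ?d]) auto
  finally have eq: "coeff g i = coeff (\<chi> * g) (?d + i)
      - (\<Sum>j\<in>{..?d + i} - {?d}. coeff \<chi> j * coeff g (?d + i - j))" by simp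
  have "m dvd coeff \<chi> j * coeff g (?d + i - j)" if "j \<in> {..?d + i} - {?d}" for j
  proof (cases "j < ?d")
    case True
    show ?thesis
    proof (cases "?d + i - j \<le> degree g")
      case True
      with \<open>j < ?d\<close> have "degree g - (?d + i - j) < degree g - i" by linarith
      from less[OF this] show ?thesis by (rule dvd_mult)
    qed (simp add: coeff_eq_0)
  next
    case False
    with that show ?thesis by (simp add: coeff_eq_0)
  qed
  then show ?case unfolding eq by (intro dvd_diff dvd dvd_sum)
qed

lemma const_dvd_of_dvd_coeff:
  fixes g :: "'a::comm_ring_1 poly"
  assumes "\<And>i. m dvd coeff g i"
  shows "[:m:] dvd g"
  using assms
proof (induction g)
  case (pCons a g)
  have "m dvd coeff g i" for i using pCons.prems[of "Suc i"] by simp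
  then obtain g' where "g = [:m:] * g'" using pCons.IH by blast
  moreover obtain b where "a = m * b" using pCons.prems[of 0] by auto
  ultimately have "pCons a g = [:m:] * pCons b g'" by simp
  then show ?case by (rule dvdI)
qed simp

text \<open>From \<open>m p = \<chi> g\<close> it follows that \<open>m\<close> divides
  \<open>g\<close>, and then \<open>m\<close> is cancelled coefficientwise. In other words,
  \<open>m\<close> stays a nonzerodivisor in the quotient by \<open>\<chi>\<close>.\<close>

lemma monic_dvd_of_dvd_const_mult:
  fixes \<chi> p :: "'a::comm_ring_1 poly" and m :: 'a
  assumes monic: "lead_coeff \<chi> = 1" and reg: "\<And>c. m * c = 0 \<Longrightarrow> c = 0"
    and dvd: "\<chi> dvd [:m:] * p"
  shows "\<chi> dvd p"
proof -
  obtain g where g: "[:m:] * p = \<chi> * g" using dvd by blast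
  have "m dvd coeff g i" for i
  proof (rule dvd_coeff_of_dvd_coeff_monic_mult[OF monic])
    show "m dvd coeff (\<chi> * g) i" for i by (simp flip: g)
  qed
  then have "[:m:] dvd g" by (rule const_dvd_of_dvd_coeff)
  then obtain g' where "g = [:m:] * g'" by (rule dvdE)
  then have "[:m:] * (p - \<chi> * g') = 0" using g by (simp add: algebra_simps)
  then have "smult m (p - \<chi> * g') = 0" by simp
  then have "m * coeff (p - \<chi> * g') i = 0" for i
    by (metis coeff_0 coeff_smult)
  then have "p - \<chi> * g' = 0"
    by (intro poly_eqI) (metis reg coeff_0)
  then show ?thesis by simp
qed

section \<open>Finite subfields as fixed fields of a power map\<close>

text \<open>Multiplication by a nonzero \<open>c\<close> permutes the nonzero elements of
  \<open>S\<close>; comparing their product with its image gives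
  \<open>c ^ (card S - 1) = 1\<close>.\<close>

lemma finite_subfield_power_card:
  fixes S :: "'a::field set" and c :: 'a
  assumes "finite S" "0 \<in> S" "\<And>x y. x \<in> S \<Longrightarrow> y \<in> S \<Longrightarrow> x * y \<in> S" "c \<in> S"
  shows "c ^ card S = c"
proof (cases "c = 0")
  case True
  then show ?thesis using assms by (metis card_gt_0_iff empty_iff zero_power)
next
  case False
  let ?T = "S - {0}"
  have inj: "inj_on ((*) c) ?T" using False by (auto intro: inj_onI)
  have "(*) c ` ?T \<subseteq> ?T" using assms False by auto
  then have "(*) c ` ?T = ?T"
    by (rule endo_inj_surj[OF _ _ inj, rotated]) (use assms in auto)
  then have "prod id ?T = (\<Prod>x\<in>?T. c * x)"
    using prod.reindex[OF inj, of id] by (simp add: comp_def)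
  also have "\<dots> = c ^ card ?T * prod id ?T" by (simp add: prod.distrib)
  finally have "c ^ card ?T = 1" using assms(1) by simp
  moreover have "card S = Suc (card ?T)" using assms by (metis card.remove)
  ultimately show ?thesis by simp
qed

text \<open>\<open>X ^ card S - X\<close> has at most \<open>card S\<close> roots, and the elements
  of \<open>S\<close> already account for that many.\<close>

lemma finite_subfield_eq_power_fixed:
  fixes S :: "'a::field set"
  assumes "finite S" "0 \<in> S" "1 \<in> S" "\<And>x y. x \<in> S \<Longrightarrow> y \<in> S \<Longrightarrow> x * y \<in> S"
  shows "{c. c ^ card S = c} = S"
proof -
  have "card {0, 1 :: 'a} \<le> card S" using assms by (intro card_mono) auto
  then have c: "card S > 1" by simp
  let ?p = "monom 1 (card S) - monom 1 1 :: 'a poly"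
  have "coeff ?p (card S) = 1" using c by simp
  then have p0: "?p \<noteq> 0" by (metis coeff_0 zero_neq_one)
  have roots: "{c. poly ?p c = 0} = {c. c ^ card S = c}" by (simp add: poly_monom)
  have "degree ?p \<le> card S" using c by (intro degree_diff_le) (auto simp: degree_monom_eq)
  then have "card {c :: 'a. c ^ card S = c} \<le> card S"
    by (rule order_trans[OF card_poly_roots_bound[OF p0, unfolded roots]])
  moreover have "S \<subseteq> {c. c ^ card S = c}" using finite_subfield_power_card[of S] assms by auto
  moreover have "finite {c :: 'a. c ^ card S = c}" using poly_roots_finite[OF p0] unfolding roots .
  ultimately show ?thesis by (metis card_seteq)
qed

text \<open>\<open>(X + 1) ^ q - X ^ q - 1\<close> has degree less than \<open>q\<close> and vanishes on \<open>S\<close>, so it is zero.\<close>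

lemma finite_subfield_freshmans_dream:
  fixes S :: "'a::field set" and x y :: 'a
  assumes "finite S" "0 \<in> S" "1 \<in> S" "\<And>x y. x \<in> S \<Longrightarrow> y \<in> S \<Longrightarrow> x * y \<in> S"
    "\<And>x y. x \<in> S \<Longrightarrow> y \<in> S \<Longrightarrow> x + y \<in> S"
  shows "(x + y) ^ card S = x ^ card S + y ^ card S"
proof -
  let ?q = "card S"
  have q0: "?q > 0" using assms by (auto simp: card_gt_0_iff)
  let ?p = "[:1, 1:] ^ ?q - monom 1 ?q - 1 :: 'a poly"
  have ev: "poly ?p c = (c + 1) ^ ?q - c ^ ?q - 1" for c by (simp add: poly_monom add.commute)
  have sub: "S \<subseteq> {c. poly ?p c = 0}"
    using finite_subfield_power_card[of S] assms unfolding ev by auto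
  have deg: "degree ([:1, 1:] ^ ?q :: 'a poly) = ?q" by (simp add: degree_power_eq)
  have "?p = 0"
  proof (rule ccontr)
    assume p0: "?p \<noteq> 0"
    have "degree ?p \<le> ?q" using deg by (intro degree_diff_le) (auto simp: degree_monom_eq)
    moreover have "coeff ?p ?q = 0"
    proof -
      have "lead_coeff ([:1, 1:] ^ ?q :: 'a poly) = 1" by (rule monic_power) simp
      then show ?thesis using q0 by (simp add: deg)
    qed
    ultimately have "degree ?p < ?q" using p0 by (metis le_neq_implies_less leading_coeff_0_iff)
    moreover have "?q \<le> card {c. poly ?p c = 0}"
      using sub poly_roots_finite[OF p0] by (intro card_mono)
    ultimately show False using card_poly_roots_bound[OF p0] by linarith
  qed
  then have *: "(c + 1) ^ ?q = c ^ ?q + 1" for c :: 'a using ev[of c] by (simp add: algebra_simps)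
  show ?thesis
  proof (cases "y = 0")
    case True
    then show ?thesis using q0 by (simp add: zero_power)
  next
    case False
    \<comment> \<open>The polynomial settles only the case \<open>y = 1\<close>; the general case is
      its homogenization at \<open>c = x / y\<close>.\<close>
    then have "(x + y) ^ ?q = (y * (x / y + 1)) ^ ?q" by (simp add: distrib_left)
    also have "\<dots> = y ^ ?q * ((x / y) ^ ?q + 1)" by (simp only: power_mult_distrib *)
    also have "\<dots> = x ^ ?q + y ^ ?q" using False by (simp add: field_simps power_divide)
    finally show ?thesis .
  qed
qed

lemma card_range_to_ac: "card (range (to_ac :: 'k::{finite,field} \<Rightarrow> 'k alg_closure)) = CARD('k)"
  by (simp add: card_image inj_on_def)

lemma power_card_eq_self_iff:
  fixes c :: "'k::{finite,field} alg_closure"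
  shows "c ^ CARD('k) = c \<longleftrightarrow> c \<in> range to_ac"
proof -
  have "{c. c ^ card (range (to_ac :: 'k \<Rightarrow> _)) = c} = range (to_ac :: 'k \<Rightarrow> _)"
    by (rule finite_subfield_eq_power_fixed)
      (auto intro: range_eqI[of _ _ 0] range_eqI[of _ _ 1] range_eqI[of _ _ "_ * _"])
  then show ?thesis unfolding card_range_to_ac by blast
qed

lemma to_ac_power_card: "to_ac c ^ (CARD('k) ^ a) = to_ac (c :: 'k::{finite,field})"
proof (induction a)
  case (Suc a)
  then show ?case using power_card_eq_self_iff[of "to_ac c"] by (simp add: power_mult)
qed simp

lemma ac_freshmans_dream:
  fixes x y :: "'k::{finite,field} alg_closure"
  shows "(x + y) ^ (CARD('k) ^ a) = x ^ (CARD('k) ^ a) + y ^ (CARD('k) ^ a)"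
proof (induction a)
  case (Suc a)
  have "(x + y) ^ card (range (to_ac :: 'k \<Rightarrow> _)) = x ^ card (range (to_ac :: 'k \<Rightarrow> _)) +
    y ^ card (range (to_ac :: 'k \<Rightarrow> _))" for x y :: "'k alg_closure"
    by (rule finite_subfield_freshmans_dream)
      (auto intro: range_eqI[of _ _ 0] range_eqI[of _ _ 1] range_eqI[of _ _ "_ * _"] range_eqI[of _ _ "_ + _"])
  then show ?case using Suc by (simp add: power_mult card_range_to_ac mult.commute[of "CARD('k)"])
qed simp

lemma ac_power_sum:
  fixes f :: "'i \<Rightarrow> 'k::{finite,field} alg_closure"
  shows "(\<Sum>i\<in>A. f i) ^ (CARD('k) ^ a) = (\<Sum>i\<in>A. f i ^ (CARD('k) ^ a))"
  by (induction A rule: infinite_finite_induct) (simp_all add: ac_freshmans_dream zero_power)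

lemma ac_power_inject:
  fixes x y :: "'k::{finite,field} alg_closure"
  shows "x ^ (CARD('k) ^ a) = y ^ (CARD('k) ^ a) \<longleftrightarrow> x = y"
proof
  assume "x ^ (CARD('k) ^ a) = y ^ (CARD('k) ^ a)"
  then have "(x - y) ^ (CARD('k) ^ a) = 0"
    using ac_freshmans_dream[of "x - y" y a] by simp
  then show "x = y" by simp
qed simp

text \<open>The dimension predicate is inductive: each step replaces \<open>E\<close> by the set of
  all \<open>c v + e\<close> with \<open>v\<close> outside \<open>E\<close>, which multiplies the
  cardinality by \<open>q\<close>.\<close>

lemma extension_card:
  fixes K :: "'k::{finite,field} alg_closure set"
  assumes "extension_of_degree a K"
  shows "card K = CARD('k) ^ a" and "{c. c ^ (CARD('k) ^ a) = c} = K"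
proof -
  let ?R = "ring_of_type_algebra :: 'k alg_closure ring" and ?k = "range to_ac :: 'k alg_closure set"
  interpret R: field ?R by (rule field_from_type_algebra)
  have ops: "carrier ?R = UNIV" "x \<otimes>\<^bsub>?R\<^esub> y = x * y" "x \<oplus>\<^bsub>?R\<^esub> y = x + y"
    "\<zero>\<^bsub>?R\<^esub> = 0" "\<one>\<^bsub>?R\<^esub> = 1" for x y
    by (simp_all add: ring_of_type_algebra_def)
  have sub: "subfield K ?R" and dim: "R.dimension a ?k K"
    using assms by (auto simp: extension_of_degree_def)
  have E: "finite E \<and> card E = CARD('k) ^ m" if "R.dimension m ?k E" for m E
  proof -
    \<comment> \<open>Closure of \<open>E\<close> under addition and scalars from \<open>k\<close>
      is carried along; it makes the pair \<open>(c, e)\<close> recoverable from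
      \<open>c v + e\<close>.\<close>
    have "finite E \<and> card E = CARD('k) ^ m \<and> (\<forall>x\<in>E. \<forall>y\<in>E. \<forall>c\<in>?k. c * x \<in> E \<and> x + y \<in> E)"
      using that
    proof (induction m ?k E rule: R.dimension.induct)
      case zero_dim
      then show ?case by (simp add: ops)
    next
      case (Suc_dim v E n)
      define f where "f = (\<lambda>(c :: 'k, e). to_ac c * v + e)"
      have le: "R.line_extension ?k v E = f ` (UNIV \<times> E)"
        unfolding set_eq_iff R.line_extension_mem_iff ops f_def by (auto simp: image_iff)
      have "inj_on f (UNIV \<times> E)"
      proof (intro inj_onI, clarsimp simp: f_def)
        fix c e c' e' assume e: "e \<in> E" "e' \<in> E" and eq: "to_ac c * v + e = to_ac c' * v + e'"
        have "c = c'"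
        proof (rule ccontr)
          assume "c \<noteq> c'"
          \<comment> \<open>With an invertible \<open>c - c'\<close> one could solve for
            \<open>v\<close> inside \<open>E\<close>, against the choice of
            \<open>v\<close>.\<close>
          then have nz: "to_ac (c - c') \<noteq> 0" by simp
          have me: "- e \<in> E" using Suc_dim e(1) to_ac_1 to_ac_minus
            by (metis mult_minus1 rangeI)
          have "to_ac (c - c') * v = e' + - e" using eq by (simp add: algebra_simps)
          then have "v = to_ac (inverse (c - c')) * (e' + - e)"
            using nz by (simp add: field_simps)
          moreover have "e' + - e \<in> E" using Suc_dim e me by blast
          ultimately show False using Suc_dim by (metis rangeI)
        qed
        with eq show "c = c' \<and> e = e'" by simp
      qed
      then have "card (f ` (UNIV \<times> E)) = CARD('k) ^ Suc n"
        using Suc_dim by (simp add: card_image card_cartesian_product)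
      moreover have "c * x \<in> f ` (UNIV \<times> E)" if cx: "c \<in> ?k" "x \<in> f ` (UNIV \<times> E)" for c x
      proof -
        obtain c' d e where "c = to_ac c'" "x = to_ac d * v + e" "e \<in> E" using cx by (auto simp: f_def)
        then have "c * x = f (c' * d, c * e)" "c * e \<in> E"
          using Suc_dim cx(1) by (auto simp: f_def algebra_simps)
        then show ?thesis by blast
      qed
      moreover have "x + y \<in> f ` (UNIV \<times> E)" if xy: "x \<in> f ` (UNIV \<times> E)" "y \<in> f ` (UNIV \<times> E)" for x y
      proof -
        obtain c d e e' where "x = to_ac c * v + e" "y = to_ac d * v + e'" "e \<in> E" "e' \<in> E"
          using xy by (auto simp: f_def)
        then have "x + y = f (c + d, e + e')" "e + e' \<in> E"
          using Suc_dim by (auto simp: f_def algebra_simps)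
        then show ?thesis by blast
      qed
      ultimately show ?case unfolding le using Suc_dim by simp
    qed
    then show ?thesis by blast
  qed
  show card: "card K = CARD('k) ^ a" using E[OF dim] by simp
  have "{c. c ^ card K = c} = K"
  proof (rule finite_subfield_eq_power_fixed)
    show "finite K" using E[OF dim] by simp
    show "0 \<in> K" "1 \<in> K" using subringE(2,3)[OF subfieldE(1)[OF sub]] by (simp_all add: ops)
    show "x * y \<in> K" if "x \<in> K" "y \<in> K" for x y
      using subringE(6)[OF subfieldE(1)[OF sub]] that by (simp add: ops)
  qed
  then show "{c. c ^ (CARD('k) ^ a) = c} = K" by (simp add: card)
qed

section \<open>Abelian groups acted on by a ring\<close>

context comm_group
begin

lemma finprod_hom:
  assumes "f \<in> hom G G" "\<And>i. i \<in> S \<Longrightarrow> b i \<in> carrier G"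
  shows "f (finprod G b S) = finprod G (\<lambda>i. f (b i)) S"
  using assms(2)
proof (induction S rule: infinite_finite_induct)
  \<comment> \<open>Over an infinite index set \<open>finprod\<close> is \<open>\<one>\<close> by
    convention, so both sides are \<open>\<one>\<close>.\<close>
  case (infinite A)
  then show ?case using hom_one[OF assms(1)] is_group by simp
next
  case empty
  then show ?case using hom_one[OF assms(1)] is_group by simp
next
  case (insert i F)
  moreover have "f x \<in> carrier G" if "x \<in> carrier G" for x
    using assms(1) that by (auto simp: hom_def)
  ultimately show ?case using assms(1) by (simp add: hom_mult Pi_def)
qed

lemma finprod_swap:
  assumes "finite S" "finite T" "\<And>i j. i \<in> S \<Longrightarrow> j \<in> T \<Longrightarrow> f i j \<in> carrier G"
  shows "(\<Otimes>i\<in>S. \<Otimes>j\<in>T. f i j) = (\<Otimes>j\<in>T. \<Otimes>i\<in>S. f i j)"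
  using assms(1,3)
proof (induction S rule: finite_induct)
  case empty
  then show ?case by simp
next
  case (insert i F)
  then have "(\<Otimes>j\<in>T. \<Otimes>i\<in>insert i F. f i j) = (\<Otimes>j\<in>T. f i j \<otimes> (\<Otimes>i\<in>F. f i j))"
    by (intro finprod_cong') (auto simp: Pi_def)
  also have "\<dots> = (\<Otimes>j\<in>T. f i j) \<otimes> (\<Otimes>j\<in>T. \<Otimes>i\<in>F. f i j)"
    using insert by (intro finprod_multf) (auto simp: Pi_def)
  finally show ?case using insert by (simp add: Pi_def)
qed

text \<open>The associativity behind products of matrices. It is used with \<open>Z_l\<close>
  acting, for changes of basis, and with \<open>Z_l[t]\<close> acting, for the adjugate
  argument.\<close>

lemma ring_action_finprod_matrix:
  fixes \<phi> :: "'r::comm_ring_1 \<Rightarrow> 'a \<Rightarrow> 'a" and m h :: nat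
  assumes hom: "\<And>r. \<phi> r \<in> hom G G"
    and add: "\<And>r s x. x \<in> carrier G \<Longrightarrow> \<phi> (r + s) x = \<phi> r x \<otimes> \<phi> s x"
    and mult: "\<And>r s x. x \<in> carrier G \<Longrightarrow> \<phi> (r * s) x = \<phi> r (\<phi> s x)"
    and b: "\<And>i. i < h \<Longrightarrow> b i \<in> carrier G"
  shows "(\<Otimes>j\<in>{..<m}. \<phi> (c j) (\<Otimes>i\<in>{..<h}. \<phi> (P i j) (b i)))
    = (\<Otimes>i\<in>{..<h}. \<phi> (\<Sum>j<m. P i j * c j) (b i))"
proof -
  have cl: "\<phi> r x \<in> carrier G" if "x \<in> carrier G" for r x
    using hom[of r] that by (auto simp: hom_def)
  have zero: "\<phi> 0 x = \<one>" if "x \<in> carrier G" for x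
    using add[OF that, of 0 0] cl[OF that, of 0] by (metis add_0 r_cancel_one)
  have sum: "\<phi> (\<Sum>j\<in>S. d j) x = (\<Otimes>j\<in>S. \<phi> (d j) x)" if "x \<in> carrier G" "finite S" for S d x
    using that(2) by (induction S rule: finite_induct) (simp_all add: zero add cl that(1) Pi_def)
  have "(\<Otimes>j\<in>{..<m}. \<phi> (c j) (\<Otimes>i\<in>{..<h}. \<phi> (P i j) (b i)))
      = (\<Otimes>j\<in>{..<m}. \<Otimes>i\<in>{..<h}. \<phi> (P i j * c j) (b i))"
  proof (rule finprod_cong')
    fix j
    have "\<phi> (c j) (\<Otimes>i\<in>{..<h}. \<phi> (P i j) (b i)) = (\<Otimes>i\<in>{..<h}. \<phi> (c j) (\<phi> (P i j) (b i)))"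
      by (rule finprod_hom[OF hom]) (simp add: cl b)
    also have "\<dots> = (\<Otimes>i\<in>{..<h}. \<phi> (P i j * c j) (b i))"
      by (rule finprod_cong') (auto simp: cl b mult[symmetric] mult.commute)
    finally show "\<phi> (c j) (\<Otimes>i\<in>{..<h}. \<phi> (P i j) (b i)) = (\<Otimes>i\<in>{..<h}. \<phi> (P i j * c j) (b i))" .
  qed (auto simp: cl b)
  also have "\<dots> = (\<Otimes>i\<in>{..<h}. \<Otimes>j\<in>{..<m}. \<phi> (P i j * c j) (b i))"
    by (rule finprod_swap) (auto intro: cl b)
  also have "\<dots> = (\<Otimes>i\<in>{..<h}. \<phi> (\<Sum>j<m. P i j * c j) (b i))"
    by (intro finprod_cong') (auto simp: sum b intro!: cl b)
  finally show ?thesis .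
qed

lemma int_pow_eq_of_mod_eq:
  assumes "x \<in> carrier G" "x [^] (m::nat) = \<one>" "i mod int m = j mod int m"
  shows "x [^] i = x [^] j"
proof -
  have "x [^] i = x [^] (i mod int m)" for i
  proof -
    have "x [^] i = x [^] (int m * (i div int m) + i mod int m)" by simp
    also have "\<dots> = (x [^] int m) [^] (i div int m) \<otimes> x [^] (i mod int m)"
      using assms(1) by (simp only: int_pow_mult[OF assms(1)] int_pow_pow[OF assms(1)])
    finally show ?thesis using assms by (simp add: int_pow_int)
  qed
  then show ?thesis using assms(3) by metis
qed

lemma int_pow_commute: "x \<in> carrier G \<Longrightarrow> (x [^] (i::int)) [^] (j::int) = (x [^] j) [^] i"
  by (simp add: int_pow_pow mult.commute)

lemma nat_pow_commute: "x \<in> carrier G \<Longrightarrow> (x [^] (i::nat)) [^] (j::nat) = (x [^] j) [^] i"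
  by (simp add: nat_pow_pow mult.commute)

lemma nat_pow_hom: "(\<lambda>x. x [^] (m::nat)) \<in> hom G G"
  by (auto simp: hom_def nat_pow_distrib)

lemma int_pow_hom: "(\<lambda>x. x [^] (m::int)) \<in> hom G G"
  by (auto simp: hom_def int_pow_distrib)

lemma nat_pow_inv_eq: "x \<in> carrier G \<Longrightarrow> inv x [^] (m::nat) = inv (x [^] m)"
  by (simp add: nat_pow_inv)

text \<open>Each nonempty fibre is a translate of the kernel by an element of \<open>H\<close>. Two
  surjectivity statements rest on this count: multiplication by \<open>l\<close> between torsion
  groups, and the Kummer map for finite \<open>G(K)\<close>.\<close>

lemma card_eq_card_kernel_times_card_image:
  assumes H: "subgroup H G" "finite H" and f: "f \<in> hom G G"
  shows "card H = card {x \<in> H. f x = \<one>} * card (f ` H)"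
proof -
  have HG: "x \<in> carrier G" if "x \<in> H" for x using that subgroup.mem_carrier[OF H(1)] by blast
  interpret f: group_hom G G f using f by unfold_locales
  have fib: "card {x \<in> H. f x = \<zeta>} = card {x \<in> H. f x = \<one>}" if \<zeta>: "\<zeta> \<in> f ` H" for \<zeta>
  proof -
    obtain y where y: "y \<in> H" "\<zeta> = f y" using \<zeta> by blast
    have "bij_betw (\<lambda>x. x \<otimes> inv y) {x \<in> H. f x = \<zeta>} {x \<in> H. f x = \<one>}"
      by (rule bij_betw_byWitness[where f' = "\<lambda>x. x \<otimes> y"])
        (auto simp: y HG m_assoc subgroup.m_closed[OF H(1)] subgroup.m_inv_closed[OF H(1)])
    then show ?thesis by (rule bij_betw_same_card)
  qed
  have "H = (\<Union>\<zeta>\<in>f ` H. {x \<in> H. f x = \<zeta>})" by blast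
  then have "card H = (\<Sum>\<zeta>\<in>f ` H. card {x \<in> H. f x = \<zeta>})"
    using H(2) by (subst card_UN_disjoint[symmetric]) auto
  also have "\<dots> = (\<Sum>\<zeta>\<in>f ` H. card {x \<in> H. f x = \<one>})" by (rule sum.cong) (use fib in auto)
  finally show ?thesis by simp
qed

lemma Collect_nat_pow_eq_one_subgroup: "subgroup {x \<in> carrier G. x [^] (m::nat) = \<one>} G"
  by (rule subgroupI) (auto simp: nat_pow_distrib nat_pow_inv_eq intro: exI[of _ \<one>])

end

section \<open>The action of l-adic integers on l-power torsion\<close>

locale l_torsion_group = comm_group A for A (structure) +
  fixes L :: "'l::prime_card itself"
  assumes l_torsion: "x \<in> carrier A \<Longrightarrow> \<exists>n. x [^] (CARD('l) ^ n) = \<one>"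
begin

text \<open>The least level makes this a function of \<open>x\<close> alone; by
  \<open>zact_eq\<close>, any level at which \<open>x\<close> is torsion gives the same
  value.\<close>

definition zact :: "'l padic \<Rightarrow> 'a \<Rightarrow> 'a" where
  "zact c x = x [^] residue c (LEAST n. x [^] (CARD('l) ^ n) = \<one>)"

definition tors :: "nat \<Rightarrow> 'a set" where
  "tors n = {x \<in> carrier A. x [^] (CARD('l) ^ n) = \<one>}"

lemma carrier_tors:
  assumes "x \<in> carrier A"
  obtains n where "x \<in> tors n"
  using l_torsion[OF assms] assms by (auto simp: tors_def)

lemma tors_carrier: "x \<in> tors n \<Longrightarrow> x \<in> carrier A"
  by (simp add: tors_def)

lemma tors_subgroup: "subgroup (tors n) A"
  unfolding tors_def by (rule Collect_nat_pow_eq_one_subgroup)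

lemma tors_mono: "m \<le> n \<Longrightarrow> x \<in> tors m \<Longrightarrow> x \<in> tors n"
  unfolding tors_def by (auto simp: le_iff_add power_add nat_pow_pow[symmetric])

text \<open>The least level \<open>m\<close> satisfies \<open>m \<le> n\<close>, and the residue at
  level \<open>n\<close> reduces modulo \<open>l ^ m\<close> to the one at level
  \<open>m\<close>.\<close>

lemma zact_eq:
  assumes "x \<in> tors n"
  shows "zact c x = x [^] residue c n"
proof -
  let ?m = "LEAST n. x [^] (CARD('l) ^ n) = \<one>"
  have "?m \<le> n" "x [^] (CARD('l) ^ ?m) = \<one>"
    using assms by (auto simp: tors_def intro: Least_le LeastI)
  moreover from this have "residue c ?m mod int (CARD('l) ^ ?m) = residue c n mod int (CARD('l) ^ ?m)"
    by (simp add: residue_mod residue_mod_le)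
  ultimately show ?thesis
    unfolding zact_def by (intro int_pow_eq_of_mod_eq) (use assms in \<open>auto simp: tors_def\<close>)
qed

lemma zact_closed: "x \<in> tors n \<Longrightarrow> zact c x \<in> tors n"
  using group.int_pow_closed[OF subgroup.subgroup_is_group[OF tors_subgroup is_group], of x n "residue c n"]
  by (simp add: zact_eq int_pow_consistent[OF tors_subgroup, symmetric])

lemma zact_carrier: "x \<in> carrier A \<Longrightarrow> zact c x \<in> carrier A"
  by (simp add: zact_def)

lemma zact_zero: "zact 0 x = \<one>"
  by (simp add: zact_def residue_simps)

lemma int_pow_mod_tors: "x \<in> tors n \<Longrightarrow> x [^] (i mod int CARD('l) ^ n) = x [^] i"
  by (rule int_pow_eq_of_mod_eq[of _ "CARD('l) ^ n"]) (auto simp: tors_def)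

lemma zact_one: "x \<in> carrier A \<Longrightarrow> zact 1 x = x"
  by (erule carrier_tors) (simp add: zact_eq residue_simps int_pow_mod_tors tors_carrier)

lemma zact_add: "x \<in> carrier A \<Longrightarrow> zact (c + d) x = zact c x \<otimes> zact d x"
  by (erule carrier_tors) (simp add: zact_eq residue_simps int_pow_mod_tors tors_carrier int_pow_mult)

lemma zact_mult:
  assumes "x \<in> carrier A" shows "zact (c * d) x = zact c (zact d x)"
proof -
  obtain n where "x \<in> tors n" by (rule carrier_tors[OF assms])
  moreover from this have "x [^] residue d n \<in> tors n" using zact_closed[of x n d] zact_eq by simp
  ultimately show ?thesis
    by (simp add: zact_eq residue_simps int_pow_mod_tors tors_carrier int_pow_pow mult.commute)
qed

lemma hom_tors: "f \<in> hom A A \<Longrightarrow> x \<in> tors n \<Longrightarrow> f x \<in> tors n"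
  using hom_nat_pow[of f A A x "CARD('l) ^ n"] hom_one[of f A A] is_group
  by (auto simp: tors_def hom_def Pi_def)

lemma zact_commute_hom:
  assumes "f \<in> hom A A" "x \<in> carrier A"
  shows "f (zact c x) = zact c (f x)"
proof -
  obtain n where "x \<in> tors n" by (rule carrier_tors[OF assms(2)])
  moreover from this have "f x \<in> tors n" by (rule hom_tors[OF assms(1)])
  ultimately show ?thesis
    using hom_int_pow[OF assms is_group is_group] by (simp add: zact_eq)
qed

lemma zact_distrib:
  assumes "x \<in> carrier A" "y \<in> carrier A"
  shows "zact c (x \<otimes> y) = zact c x \<otimes> zact c y"
proof -
  obtain m n where *: "x \<in> tors m" "y \<in> tors n" using assms carrier_tors by metis
  then have "x \<in> tors (max m n)" "y \<in> tors (max m n)" by (auto elim: tors_mono[rotated])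
  moreover from this have "x \<otimes> y \<in> tors (max m n)" by (rule subgroup.m_closed[OF tors_subgroup])
  ultimately show ?thesis by (simp add: zact_eq assms int_pow_distrib)
qed

lemma zact_hom: "zact c \<in> hom A A"
  by (auto simp: hom_def zact_carrier zact_distrib)

end

locale l_torsion_aut = l_torsion_group A L
  for A :: "('a, 'b) monoid_scheme" (structure) and L :: "'l::prime_card itself" +
  fixes F :: "'a \<Rightarrow> 'a"
  assumes F_hom: "F \<in> hom A A" and F_bij: "bij_betw F (carrier A) (carrier A)"
begin

text \<open>Horner's scheme for the sum of all \<open>c_i F^i x\<close>, with \<open>c_i\<close> the
  coefficients of \<open>p\<close>: polynomials act through evaluation at \<open>F\<close>.\<close>

definition pact :: "'l padic poly \<Rightarrow> 'a \<Rightarrow> 'a" where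
  "pact p x = fold_coeffs (\<lambda>c y. zact c x \<otimes> F y) p \<one>"

lemma F_one: "F \<one> = \<one>" using hom_one[OF F_hom] is_group by simp

lemma F_closed: "x \<in> carrier A \<Longrightarrow> F x \<in> carrier A" using F_hom by (auto simp: hom_def)

lemma F_mult: "x \<in> carrier A \<Longrightarrow> y \<in> carrier A \<Longrightarrow> F (x \<otimes> y) = F x \<otimes> F y"
  using F_hom by (rule hom_mult)

lemma pact_0 [simp]: "pact 0 x = \<one>" by (simp add: pact_def)

lemma pact_pCons: "pact (pCons c p) x = zact c x \<otimes> F (pact p x)"
proof (cases "c = 0 \<and> p = 0")
  \<comment> \<open>\<open>pCons 0 0\<close> has an empty coefficient list, so the recursion does
    not unfold; both sides are \<open>\<one>\<close>.\<close>
  case True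
  then show ?thesis by (simp add: zact_zero F_one)
next
  case False
  then have "coeffs (pCons c p) = c # coeffs p"
    by (auto simp: coeffs_pCons_eq_cCons cCons_def)
  then show ?thesis by (simp add: pact_def fold_coeffs_def)
qed

lemma pact_closed: "x \<in> carrier A \<Longrightarrow> pact p x \<in> carrier A"
  by (induction p) (simp_all add: pact_pCons zact_carrier F_closed)

lemma pact_distrib:
  assumes "x \<in> carrier A" "y \<in> carrier A"
  shows "pact p (x \<otimes> y) = pact p x \<otimes> pact p y"
  by (induction p)
    (simp_all add: assms pact_pCons zact_distrib zact_carrier F_mult F_closed pact_closed m_ac)

lemma pact_hom: "pact p \<in> hom A A" by (auto simp: hom_def pact_closed pact_distrib)

lemma pact_add: "x \<in> carrier A \<Longrightarrow> pact (p + q) x = pact p x \<otimes> pact q x"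
  by (induction p q rule: poly_induct2)
    (simp_all add: pact_pCons zact_add zact_carrier F_mult F_closed pact_closed m_ac)

lemma pact_smult: "x \<in> carrier A \<Longrightarrow> pact (smult c p) x = zact c (pact p x)"
proof (induction p)
  case 0
  then show ?case using hom_one[OF zact_hom] is_group by simp
next
  case (pCons a p)
  then show ?case
    by (simp add: pact_pCons zact_distrib zact_mult zact_carrier F_closed pact_closed
        zact_commute_hom[OF F_hom])
qed

lemma pact_mult: "x \<in> carrier A \<Longrightarrow> pact (p * q) x = pact p (pact q x)"
  by (induction p)
    (simp_all add: pact_pCons pact_add pact_smult zact_zero F_closed pact_closed)

lemma pact_const: "x \<in> carrier A \<Longrightarrow> pact [:c:] x = zact c x"
  by (simp add: pact_pCons F_one zact_carrier)

lemma pact_X: "x \<in> carrier A \<Longrightarrow> pact [:0, 1:] x = F x"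
  by (simp add: pact_pCons F_one zact_carrier zact_zero zact_one F_closed)

lemma pact_one: "x \<in> carrier A \<Longrightarrow> pact 1 x = x"
  by (simp add: one_pCons pact_const zact_one)

lemma pact_commute_hom:
  assumes "f \<in> hom A A" "\<And>x. x \<in> carrier A \<Longrightarrow> f (F x) = F (f x)" "x \<in> carrier A"
  shows "f (pact p x) = pact p (f x)"
proof (induction p)
  case 0
  then show ?case using hom_one[OF assms(1)] is_group by simp
next
  case (pCons a p)
  then show ?case using assms
    by (simp add: pact_pCons hom_mult[OF assms(1)] zact_carrier F_closed pact_closed
        zact_commute_hom[OF assms(1)])
qed

text \<open>This lets the action descend to the quotient by \<open>\<chi>\<close>.\<close>

lemma pact_kernel_dvd:
  assumes "\<And>x. x \<in> carrier A \<Longrightarrow> pact \<chi> x = \<one>" "\<chi> dvd p" "x \<in> carrier A"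
  shows "pact p x = \<one>"
  using assms by (auto simp: pact_mult mult.commute[of \<chi>] dvd_def) (metis hom_one is_group pact_hom)

text \<open>The assumption on \<open>F (b j)\<close> says that each column of \<open>X - M\<close>,
  with \<open>X\<close> acting as \<open>F\<close>, annihilates the family \<open>b\<close>. The
  adjugate turns \<open>X - M\<close> into \<open>char_poly M\<close> times the identity matrix,
  whose columns isolate the single \<open>b k\<close>.\<close>

lemma cayley_hamilton_action:
  assumes M: "M \<in> carrier_mat h h" and b: "\<And>j. j < h \<Longrightarrow> b j \<in> carrier A"
    and F: "\<And>j. j < h \<Longrightarrow> F (b j) = (\<Otimes>i\<in>{..<h}. zact (M $$ (i, j)) (b i))"
    and k: "k < h"
  shows "pact (char_poly M) (b k) = \<one>"
proof -
  let ?X = "char_poly_matrix M" and ?Y = "adj_mat (char_poly_matrix M)"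
  have X: "?X \<in> carrier_mat h h" using M by simp
  note Y = adj_mat[OF X]
  have Xij: "?X $$ (i, j) = (if i = j then [:0, 1:] else 0) + [:- M $$ (i, j):]" if "i < h" "j < h" for i j
    using that M by (auto simp: char_poly_matrix_def)
  have Xb: "(\<Otimes>i\<in>{..<h}. pact (?X $$ (i, j)) (b i)) = \<one>" if j: "j < h" for j
  proof -
    have "(\<Otimes>i\<in>{..<h}. pact (?X $$ (i, j)) (b i))
        = (\<Otimes>i\<in>{..<h}. (if j = i then F (b i) else \<one>) \<otimes> zact (- M $$ (i, j)) (b i))"
      by (intro finprod_cong')
        (auto simp: Xij j b pact_add pact_X pact_const F_closed zact_carrier)
    also have "\<dots> = (\<Otimes>i\<in>{..<h}. if j = i then F (b i) else \<one>) \<otimes> (\<Otimes>i\<in>{..<h}. zact (- M $$ (i, j)) (b i))"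
      by (rule finprod_multf) (auto simp: b F_closed zact_carrier)
    also have "(\<Otimes>i\<in>{..<h}. if j = i then F (b i) else \<one>) = F (b j)"
      using j b by (intro finprod_singleton) (auto simp: F_closed)
    also have "\<dots> = (\<Otimes>i\<in>{..<h}. zact (M $$ (i, j)) (b i))" by (rule F[OF j])
    also have "\<dots> \<otimes> (\<Otimes>i\<in>{..<h}. zact (- M $$ (i, j)) (b i))
        = (\<Otimes>i\<in>{..<h}. zact (M $$ (i, j)) (b i) \<otimes> zact (- M $$ (i, j)) (b i))"
      by (rule finprod_multf[symmetric]) (auto simp: b zact_carrier)
    also have "\<dots> = \<one>"
      by (rule finprod_one_eqI) (simp add: b zact_add[symmetric] zact_zero)
    finally show ?thesis .
  qed
  \<comment> \<open>The trivial combinations are themselves combined, with column \<open>k\<close>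
    of the adjugate as coefficients; regrouping produces column \<open>k\<close> of the product
    matrix.\<close>
  have "\<one> = (\<Otimes>j\<in>{..<h}. pact (?Y $$ (j, k)) (\<Otimes>i\<in>{..<h}. pact (?X $$ (i, j)) (b i)))"
    by (rule finprod_one_eqI[symmetric]) (simp add: Xb hom_one[OF pact_hom] is_group)
  also have "\<dots> = (\<Otimes>i\<in>{..<h}. pact (\<Sum>j<h. ?X $$ (i, j) * ?Y $$ (j, k)) (b i))"
    by (rule ring_action_finprod_matrix) (auto simp: pact_hom pact_add pact_mult b)
  also have "\<dots> = (\<Otimes>i\<in>{..<h}. if k = i then pact (char_poly M) (b i) else \<one>)"
  proof (intro finprod_cong' refl)
    fix i assume "i \<in> {..<h}"
    then have i: "i < h" by simp
    have "(\<Sum>j<h. ?X $$ (i, j) * ?Y $$ (j, k)) = (?X * ?Y) $$ (i, k)"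
      using X Y(1) i k by (simp add: scalar_prod_def atLeast0LessThan)
    also have "\<dots> = (if k = i then char_poly M else 0)"
      unfolding Y(2) using i k by (simp add: char_poly_def)
    finally show "pact (\<Sum>j<h. ?X $$ (i, j) * ?Y $$ (j, k)) (b i)
      = (if k = i then pact (char_poly M) (b i) else \<one>)" by simp
  qed (auto simp: b pact_closed)
  also have "\<dots> = pact (char_poly M) (b k)"
    using k b by (intro finprod_singleton) (auto simp: pact_closed)
  finally show ?thesis by simp
qed

end

section \<open>The Tate module\<close>

locale l_divisible_module = l_torsion_group A L
  for A :: "('a, 'b) monoid_scheme" (structure) and L :: "'l::prime_card itself" +
  fixes h :: nat
  assumes card_tors: "card (tors n) = CARD('l) ^ (n * h)"
begin

lemma prime_l: "Factorial_Ring.prime CARD('l)" by (rule prime_card)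

lemma l_pos: "CARD('l) > 0" using prime_l by (rule prime_gt_0_nat)

lemma finite_tors: "finite (tors n)"
  using card_tors[of n] l_pos by (metis card.infinite less_irrefl zero_less_power)

lemma finite_of_finite_tors: "S \<subseteq> tors n \<Longrightarrow> finite S"
  using finite_tors finite_subset by blast

lemma tors_pow: "\<xi> \<in> tors (m + n) \<Longrightarrow> \<xi> [^] (CARD('l) ^ n) \<in> tors m"
  by (auto simp: tors_def nat_pow_pow power_add mult.commute)

lemma tors_pow_Suc: "\<xi> \<in> tors (Suc n) \<Longrightarrow> \<xi> [^] CARD('l) \<in> tors n"
  using tors_pow[of \<xi> n 1] by simp

text \<open>Multiplication by \<open>l\<close> from \<open>A[l ^ (n + 1)]\<close> to \<open>A[l ^ n]\<close> is onto because its kernel has order \<open>l ^ h\<close>.\<close>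

lemma l_divisible:
  assumes "\<xi> \<in> carrier A"
  obtains \<eta> where "\<eta> \<in> carrier A" "\<eta> [^] CARD('l) = \<xi>"
proof -
  obtain n where n: "\<xi> \<in> tors n" by (rule carrier_tors[OF assms])
  let ?f = "\<lambda>\<xi>. \<xi> [^] CARD('l)"
  have "{\<xi> \<in> tors (Suc n). \<xi> [^] CARD('l) = \<one>} = tors 1"
    using tors_mono[of 1 "Suc n"] by (auto simp: tors_def)
  then have "CARD('l) ^ (Suc n * h) = CARD('l) ^ h * card (?f ` tors (Suc n))"
    using card_eq_card_kernel_times_card_image[OF tors_subgroup finite_tors nat_pow_hom[of "CARD('l)"], of "Suc n"]
      card_tors[of 1] card_tors[of "Suc n"] by simp
  then have "card (?f ` tors (Suc n)) = card (tors n)"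
    using l_pos by (simp add: card_tors power_add)
  moreover have "?f ` tors (Suc n) \<subseteq> tors n" using tors_pow_Suc by blast
  ultimately have "?f ` tors (Suc n) = tors n" using finite_tors by (metis card_subset_eq)
  then have "\<xi> \<in> ?f ` tors (Suc n)" using n by blast
  then show ?thesis using that tors_carrier by blast
qed

lemma l_power_divisible:
  assumes "\<xi> \<in> carrier A"
  shows "\<exists>\<eta>\<in>carrier A. \<eta> [^] (CARD('l) ^ k) = \<xi>"
proof (induction k)
  case 0
  then show ?case using assms by auto
next
  case (Suc k)
  then obtain \<eta> where "\<eta> \<in> carrier A" "\<eta> [^] (CARD('l) ^ k) = \<xi>" by blast
  moreover obtain \<zeta> where "\<zeta> \<in> carrier A" "\<zeta> [^] CARD('l) = \<eta>" by (rule l_divisible[OF \<open>\<eta> \<in> carrier A\<close>])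
  ultimately show ?case by (auto simp: nat_pow_pow intro!: bexI[of _ \<zeta>])
qed

definition T :: "(nat \<Rightarrow> 'a) set" where
  "T = {x. (\<forall>n. x n \<in> tors n) \<and> (\<forall>n. x (Suc n) [^] CARD('l) = x n)}"

lemma T_tors: "x \<in> T \<Longrightarrow> x n \<in> tors n" by (simp add: T_def)

lemma T_carrier: "x \<in> T \<Longrightarrow> x n \<in> carrier A" using T_tors tors_carrier by blast

lemma T_Suc: "x \<in> T \<Longrightarrow> x (Suc n) [^] CARD('l) = x n" by (simp add: T_def)

lemma T_add: "x \<in> T \<Longrightarrow> x (n + d) [^] (CARD('l) ^ d) = x n"
proof (induction d)
  case (Suc d)
  have "x (n + Suc d) [^] (CARD('l) ^ Suc d) = (x (Suc (n + d)) [^] CARD('l)) [^] (CARD('l) ^ d)"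
    using Suc.prems by (simp add: nat_pow_pow T_carrier)
  then show ?case using Suc T_Suc by simp
qed (simp add: T_carrier)

text \<open>Repeated division by \<open>l\<close> gives \<open>s k\<close> with
  \<open>l ^ k s k = \<xi>\<close>. The sequence \<open>x k = l ^ n s k\<close> has
  \<open>\<xi>\<close> at place \<open>n\<close>, and \<open>x k\<close> is killed by
  \<open>l ^ k\<close> because \<open>\<xi>\<close> is killed by \<open>l ^ n\<close>.\<close>

lemma T_surj:
  assumes "\<xi> \<in> tors n"
  obtains x where "x \<in> T" "x n = \<xi>"
proof -
  have \<xi>: "\<xi> \<in> carrier A" using assms tors_carrier by blast
  have "\<exists>s. \<forall>k. (s k \<in> carrier A \<and> (k = 0 \<longrightarrow> s k = \<xi>)) \<and> s (Suc k) [^] CARD('l) = s k"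
  proof (rule dependent_nat_choice)
    show "\<exists>y. y \<in> carrier A \<and> (0 = (0::nat) \<longrightarrow> y = \<xi>)" using \<xi> by blast
    show "\<exists>z. (z \<in> carrier A \<and> (Suc k = 0 \<longrightarrow> z = \<xi>)) \<and> z [^] CARD('l) = y"
      if "y \<in> carrier A \<and> (k = 0 \<longrightarrow> y = \<xi>)" for y k
      using that l_divisible[of y] by (metis nat.distinct(2))
  qed
  then obtain s where s: "\<And>k. s k \<in> carrier A" "s 0 = \<xi>" "\<And>k. s (Suc k) [^] CARD('l) = s k" by blast
  have pow: "s k [^] (CARD('l) ^ k) = \<xi>" for k
  proof (induction k)
    case (Suc k)
    have "s (Suc k) [^] (CARD('l) ^ Suc k) = (s (Suc k) [^] CARD('l)) [^] (CARD('l) ^ k)" by (simp add: nat_pow_pow s(1))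
    then show ?case using Suc s by simp
  qed (simp add: s \<xi>)
  have \<xi>1: "\<xi> [^] (CARD('l) ^ n) = \<one>" using assms by (simp add: tors_def)
  define x where "x = (\<lambda>k. s k [^] (CARD('l) ^ n))"
  have "x k [^] (CARD('l) ^ k) = \<one>" for k
    using nat_pow_commute[OF s(1), of k "CARD('l) ^ n" "CARD('l) ^ k"] by (simp add: x_def pow \<xi>1)
  moreover have "x (Suc k) [^] CARD('l) = x k" for k
    using nat_pow_commute[OF s(1), of "Suc k" "CARD('l) ^ n" "CARD('l)"] by (simp add: x_def s)
  ultimately have "x \<in> T" by (auto simp: T_def tors_def x_def s(1))
  moreover have "x n = \<xi>" by (simp add: x_def pow)
  ultimately show ?thesis by (rule that)
qed

section \<open>Generators of the torsion groups\<close>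

text \<open>Integer coefficients are enough on a single torsion level; l-adic coordinates are
  assembled later from coherent integer ones.\<close>

definition int_span :: "(nat \<Rightarrow> 'a) \<Rightarrow> nat \<Rightarrow> 'a set" where
  "int_span b k = {(\<Otimes>i\<in>{..<k}. b i [^] (c i :: int)) | c. True}"

lemma int_span_subgroup:
  assumes "\<And>i. i < k \<Longrightarrow> b i \<in> carrier A"
  shows "subgroup (int_span b k) A"
proof (rule subgroupI)
  show "int_span b k \<subseteq> carrier A" using assms by (auto simp: int_span_def)
  show "int_span b k \<noteq> {}" by (auto simp: int_span_def)
  show m: "\<xi> \<otimes> \<eta> \<in> int_span b k" if st: "\<xi> \<in> int_span b k" "\<eta> \<in> int_span b k" for \<xi> \<eta>
  proof -
    obtain c d where cd: "\<xi> = (\<Otimes>i\<in>{..<k}. b i [^] (c i :: int))" "\<eta> = (\<Otimes>i\<in>{..<k}. b i [^] (d i :: int))"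
      using st by (auto simp: int_span_def)
    have "\<xi> \<otimes> \<eta> = (\<Otimes>i\<in>{..<k}. b i [^] c i \<otimes> b i [^] d i)"
      unfolding cd by (rule finprod_multf[symmetric]) (auto simp: assms)
    also have "\<dots> = (\<Otimes>i\<in>{..<k}. b i [^] (c i + d i))"
      by (rule finprod_cong') (auto simp: assms int_pow_mult)
    finally show ?thesis unfolding int_span_def by (intro CollectI exI[of _ "\<lambda>i. c i + d i"]) simp
  qed
  show "inv \<xi> \<in> int_span b k" if st: "\<xi> \<in> int_span b k" for \<xi>
  proof -
    obtain c where c: "\<xi> = (\<Otimes>i\<in>{..<k}. b i [^] (c i :: int))" using st by (auto simp: int_span_def)
    have "inv \<xi> = \<xi> [^] (-1 :: int)"
      using assms by (simp add: c int_pow_neg)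
    also have "\<dots> = (\<Otimes>i\<in>{..<k}. (b i [^] c i) [^] (-1 :: int))"
      unfolding c by (rule finprod_hom[OF int_pow_hom]) (simp add: assms)
    also have "\<dots> = (\<Otimes>i\<in>{..<k}. b i [^] (- c i))"
      by (rule finprod_cong') (auto simp: assms int_pow_pow)
    finally show ?thesis unfolding int_span_def by (intro CollectI exI[of _ "\<lambda>i. - c i"]) simp
  qed
qed

lemma int_span_tors:
  assumes "\<And>i. i < k \<Longrightarrow> b i \<in> tors n"
  shows "int_span b k \<subseteq> tors n"
proof -
  have b: "b i \<in> carrier A" if "i < k" for i using assms that tors_carrier by blast
  have "(\<Otimes>i\<in>{..<k}. b i [^] c i) [^] (CARD('l) ^ n) = \<one>" for c :: "nat \<Rightarrow> int"
  proof -
    have "(\<Otimes>i\<in>{..<k}. b i [^] c i) [^] (CARD('l) ^ n) = (\<Otimes>i\<in>{..<k}. (b i [^] c i) [^] (CARD('l) ^ n))"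
      by (rule finprod_hom[OF nat_pow_hom]) (simp add: b)
    also have "\<dots> = \<one>"
    proof (rule finprod_one_eqI)
      fix i assume "i \<in> {..<k}"
      then have "b i \<in> carrier A" "b i [^] (CARD('l) ^ n) = \<one>" using assms b by (auto simp: tors_def)
      then show "(b i [^] c i) [^] (CARD('l) ^ n) = \<one>"
        using int_pow_commute[of "b i" "c i" "int (CARD('l) ^ n)"] by (simp only: int_pow_int int_pow_one)
    qed
    finally show ?thesis .
  qed
  then show ?thesis using b by (auto simp: int_span_def tors_def)
qed

lemma subgroup_nat_pow_closed: "subgroup S A \<Longrightarrow> \<xi> \<in> S \<Longrightarrow> \<xi> [^] (n::nat) \<in> S"
  by (induction n) (simp_all add: subgroup.one_closed subgroup.m_closed)

text \<open>Greedy choice of generators of the \<open>F_l\<close>-vector space \<open>A[l]\<close>: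
  as long as the span is proper, a vector outside it enlarges the span by a factor of at least
  \<open>l\<close>. The bound is on sizes because \<open>|A[l]| = l ^ h\<close> is what is
  known.\<close>

lemma tors_1_generated_aux:
  assumes "k \<le> h"
  shows "\<exists>b. (\<forall>i. b i \<in> tors 1) \<and> CARD('l) ^ k \<le> card (int_span b k)"
  using assms
proof (induction k)
  case 0
  have "int_span (\<lambda>_. \<one>) 0 = {\<one>}" by (auto simp: int_span_def)
  then show ?case by (intro exI[of _ "\<lambda>_. \<one>"]) (auto simp: tors_def)
next
  case (Suc k)
  then obtain b where b: "\<And>i. b i \<in> tors 1" and card: "CARD('l) ^ k \<le> card (int_span b k)" by auto
  have bc: "b i \<in> carrier A" for i using b tors_carrier by blast
  have sub: "subgroup (int_span b k) A" by (rule int_span_subgroup) (rule bc)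
  have span_Suc: "int_span b' (Suc k) = {s \<otimes> b' k [^] (m :: int) | s m. s \<in> int_span b' k}"
    if "\<And>i. b' i \<in> carrier A" for b' :: "nat \<Rightarrow> 'a"
  proof -
    have "(\<Otimes>i\<in>{..<Suc k}. b' i [^] c i) = (\<Otimes>i\<in>{..<k}. b' i [^] c i) \<otimes> b' k [^] c k" for c :: "nat \<Rightarrow> int"
      using that by (simp add: lessThan_Suc m_comm)
    moreover have "\<exists>c' :: nat \<Rightarrow> int. (\<Otimes>i\<in>{..<k}. b' i [^] c i) \<otimes> b' k [^] m
        = (\<Otimes>i\<in>{..<k}. b' i [^] c' i) \<otimes> b' k [^] c' k" for c :: "nat \<Rightarrow> int" and m :: int
    proof -
      have "(\<Otimes>i\<in>{..<k}. b' i [^] c i) = (\<Otimes>i\<in>{..<k}. b' i [^] (c(k := m)) i)"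
        by (rule finprod_cong') (auto simp: that)
      then have "(\<Otimes>i\<in>{..<k}. b' i [^] c i) \<otimes> b' k [^] m
          = (\<Otimes>i\<in>{..<k}. b' i [^] (c(k := m)) i) \<otimes> b' k [^] (c(k := m)) k"
        unfolding fun_upd_same by (rule arg_cong)
      then show ?thesis by (rule exI[of _ "c(k := m)"])
    qed
    ultimately show ?thesis unfolding int_span_def by auto
  qed
  show ?case
  proof (cases "int_span b k = tors 1")
    \<comment> \<open>The span is already all of \<open>A[l]\<close>, of order
      \<open>l ^ h \<ge> l ^ (k + 1)\<close>, so the old \<open>b\<close> will do.\<close>
    case True
    have "tors 1 \<subseteq> int_span b (Suc k)"
    proof
      fix s assume "s \<in> tors 1"
      then have "s \<in> int_span b k" "s \<in> carrier A" using True tors_carrier by auto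
      then show "s \<in> int_span b (Suc k)"
        unfolding span_Suc[OF bc] by (intro CollectI exI[of _ s] exI[of _ "0 :: int"]) simp
    qed
    moreover have "finite (int_span b (Suc k))"
      by (rule finite_of_finite_tors[OF int_span_tors]) (rule b)
    ultimately have "CARD('l) ^ h \<le> card (int_span b (Suc k))"
      using card_mono[of "int_span b (Suc k)" "tors 1"] card_tors[of 1] by simp
    moreover have "CARD('l) ^ Suc k \<le> CARD('l) ^ h" using Suc.prems l_pos by (intro power_increasing) auto
    ultimately show ?thesis using b by (intro exI[of _ b]) (auto intro: order_trans)
  next
    case False
    then obtain v where v: "v \<in> tors 1" "v \<notin> int_span b k"
      using int_span_tors[of k b 1] b by blast
    have vc: "v \<in> carrier A" using v tors_carrier by blast
    define b' where "b' = b(k := v)"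
    have b': "b' i \<in> tors 1" "b' i \<in> carrier A" for i using b v vc bc by (auto simp: b'_def)
    have span': "int_span b' k = int_span b k"
    proof -
      have "(\<Otimes>i\<in>{..<k}. b' i [^] c i) = (\<Otimes>i\<in>{..<k}. b i [^] c i)" for c :: "nat \<Rightarrow> int"
        by (rule finprod_cong') (auto simp: b'_def bc)
      then show ?thesis by (simp add: int_span_def)
    qed
    \<comment> \<open>If translates of the span by distinct multiples \<open>i v\<close> and
      \<open>j v\<close> met, then \<open>(i - j) v\<close> would lie in the span with
      \<open>i - j\<close> prime to \<open>l\<close>, and a Bezout relation would put
      \<open>v\<close> there as well.\<close>
    have key: "i = j" if ij: "i < CARD('l)" "j < CARD('l)" "s \<in> int_span b k" "s' \<in> int_span b k"
      "s \<otimes> v [^] int i = s' \<otimes> v [^] int j" for i j s s'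
    proof (rule ccontr)
      assume "i \<noteq> j"
      define d where "d = int i - int j"
      have "\<not> int CARD('l) dvd d"
        using \<open>i \<noteq> j\<close> ij(1,2) dvd_imp_le_int[of d "int CARD('l)"] by (auto simp: d_def)
      then have "coprime d (int CARD('l))" using prime_l by (metis coprime_commute prime_imp_coprime prime_nat_int_transfer)
      then obtain u w where uw: "u * d + w * int CARD('l) = 1" by (metis bezout_int coprime_iff_gcd_eq_1)
      have sc: "s \<in> carrier A" "s' \<in> carrier A" using ij sub subgroup.mem_carrier by metis+
      have "v [^] d = inv s \<otimes> s'"
      proof -
        have "v [^] d = v [^] int i \<otimes> inv (v [^] int j)" by (simp only: d_def int_pow_diff[OF vc])
        also have "v [^] int i = inv s \<otimes> (s' \<otimes> v [^] int j)"
          using ij(5) sc vc by (metis inv_solve_left int_pow_closed m_closed)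
        finally show ?thesis using sc vc by (simp add: m_assoc)
      qed
      also have "\<dots> \<in> int_span b k"
        using ij sub by (metis subgroup.m_closed subgroup.m_inv_closed)
      finally have "v [^] d \<in> int_span b k" .
      then have "(v [^] d) [^] u \<in> int_span b k"
        using group.int_pow_closed[OF subgroup.subgroup_is_group[OF sub is_group]]
        by (simp add: int_pow_consistent[OF sub])
      moreover have "(v [^] d) [^] u = v"
      proof -
        have "v = v [^] (u * d + w * int CARD('l))" using uw vc by simp
        also have "\<dots> = v [^] (d * u) \<otimes> v [^] (int CARD('l) * w)"
          by (simp only: int_pow_mult[OF vc] mult.commute)
        also have "v [^] (int CARD('l) * w) = (v [^] int CARD('l)) [^] w" using vc by (simp add: int_pow_pow)
        also have "v [^] int CARD('l) = \<one>" using v(1) by (simp add: int_pow_int tors_def)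
        finally show ?thesis using vc by (simp add: int_pow_pow)
      qed
      ultimately show False using v by simp
    qed
    define g where "g = (\<lambda>(s, i). s \<otimes> v [^] int i)"
    have "inj_on g (int_span b k \<times> {..<CARD('l)})"
    proof (rule inj_onI, clarsimp simp: g_def)
      fix s i s' j assume *: "s \<in> int_span b k" "s' \<in> int_span b k" "i < CARD('l)" "j < CARD('l)"
        "s \<otimes> v [^] int i = s' \<otimes> v [^] int j"
      then have "i = j" by (intro key)
      then show "s = s' \<and> i = j" using * sub subgroup.mem_carrier vc
        by (metis int_pow_closed r_cancel)
    qed
    then have "card (g ` (int_span b k \<times> {..<CARD('l)})) = card (int_span b k) * CARD('l)"
      by (simp add: card_image card_cartesian_product)
    moreover have "g ` (int_span b k \<times> {..<CARD('l)}) \<subseteq> int_span b' (Suc k)"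
      unfolding span_Suc[OF b'(2)] span' by (auto simp: g_def b'_def)
    moreover have "finite (int_span b' (Suc k))"
      by (rule finite_of_finite_tors[OF int_span_tors]) (rule b')
    ultimately have "card (int_span b k) * CARD('l) \<le> card (int_span b' (Suc k))" by (metis card_mono)
    moreover have "CARD('l) ^ Suc k \<le> card (int_span b k) * CARD('l)" using card by simp
    ultimately have "CARD('l) ^ Suc k \<le> card (int_span b' (Suc k))" by (rule order_trans[rotated])
    then show ?thesis using b' by blast
  qed
qed

lemma tors_1_generated:
  obtains b where "\<And>i. b i \<in> tors 1" "int_span b h = tors 1"
proof -
  obtain b where b: "\<And>i. b i \<in> tors 1" "CARD('l) ^ h \<le> card (int_span b h)"
    using tors_1_generated_aux[of h] by auto
  moreover have "int_span b h = tors 1"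
    using b card_tors[of 1] by (intro card_seteq finite_tors int_span_tors) auto
  ultimately show ?thesis by (intro that)
qed

lemma T_finprod_shift:
  assumes "\<And>i. i < h \<Longrightarrow> B i \<in> T"
  shows "(\<Otimes>i\<in>{..<h}. B i (n + d) [^] (c i :: int)) [^] (CARD('l) ^ d) = (\<Otimes>i\<in>{..<h}. B i n [^] c i)"
proof -
  have "(\<Otimes>i\<in>{..<h}. B i (n + d) [^] c i) [^] (CARD('l) ^ d) = (\<Otimes>i\<in>{..<h}. (B i (n + d) [^] c i) [^] (CARD('l) ^ d))"
    by (rule finprod_hom[OF nat_pow_hom]) (simp add: assms T_carrier)
  also have "\<dots> = (\<Otimes>i\<in>{..<h}. B i n [^] c i)"
  proof (rule finprod_cong')
    fix i assume "i \<in> {..<h}"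
    then have "B i \<in> T" using assms by simp
    then show "(B i (n + d) [^] c i) [^] (CARD('l) ^ d) = B i n [^] c i"
      using int_pow_commute[of "B i (n + d)" "c i" "int (CARD('l) ^ d)"]
      by (simp only: int_pow_int T_carrier T_add)
  qed (auto simp: assms T_carrier)
  finally show ?thesis .
qed

text \<open>Induction on \<open>n\<close> in the style of Nakayama. The coordinates of
  \<open>l ^ n \<xi>\<close> at level 1 are reused at level \<open>n + 1\<close> to form
  \<open>\<eta>\<close>. Then \<open>\<xi> - \<eta>\<close> lies in \<open>A[l ^ n]\<close>, and a
  combination at level \<open>n\<close> is \<open>l\<close> times the one with the same coefficients
  at level \<open>n + 1\<close>.\<close>

lemma tors_generated:
  assumes B: "\<And>i. i < h \<Longrightarrow> B i \<in> T" and gen: "int_span (\<lambda>i. B i 1) h = tors 1"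
  shows "int_span (\<lambda>i. B i n) h = tors n"
proof
  show "int_span (\<lambda>i. B i n) h \<subseteq> tors n" by (rule int_span_tors) (simp add: B T_tors)
  show "tors n \<subseteq> int_span (\<lambda>i. B i n) h"
  proof (induction n)
    case 0
    have "tors 0 = {\<one>}" by (auto simp: tors_def)
    then show ?case using subgroup.one_closed[OF int_span_subgroup[of h "\<lambda>i. B i 0"]] B T_carrier by simp
  next
    case (Suc n)
    have sub: "subgroup (int_span (\<lambda>i. B i (Suc n)) h) A"
      by (rule int_span_subgroup) (simp add: B T_carrier)
    show ?case
    proof
      fix \<xi> assume \<xi>: "\<xi> \<in> tors (Suc n)"
      then have "\<xi> [^] (CARD('l) ^ n) \<in> tors 1" using tors_pow[of \<xi> 1 n] by simp
      then obtain c where c: "\<xi> [^] (CARD('l) ^ n) = (\<Otimes>i\<in>{..<h}. B i 1 [^] (c i :: int))"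
        unfolding gen[symmetric] by (auto simp: int_span_def)
      define \<eta> where "\<eta> = (\<Otimes>i\<in>{..<h}. B i (Suc n) [^] c i)"
      have \<eta>: "\<eta> \<in> int_span (\<lambda>i. B i (Suc n)) h" by (auto simp: \<eta>_def int_span_def)
      have cl: "\<xi> \<in> carrier A" "\<eta> \<in> carrier A" using \<xi> \<eta> subgroup.mem_carrier[OF sub] tors_carrier by auto
      have "\<eta> [^] (CARD('l) ^ n) = \<xi> [^] (CARD('l) ^ n)"
        using T_finprod_shift[of B 1 n c] B by (simp add: c \<eta>_def)
      then have "\<xi> \<otimes> inv \<eta> \<in> tors n"
        using cl by (simp add: tors_def nat_pow_distrib nat_pow_inv_eq)
      then obtain d where d: "\<xi> \<otimes> inv \<eta> = (\<Otimes>i\<in>{..<h}. B i n [^] (d i :: int))"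
        using Suc by (auto simp: int_span_def)
      define \<zeta> where "\<zeta> = (\<Otimes>i\<in>{..<h}. B i (Suc n) [^] d i)"
      have \<zeta>: "\<zeta> \<in> int_span (\<lambda>i. B i (Suc n)) h" by (auto simp: \<zeta>_def int_span_def)
      have "\<xi> \<otimes> inv \<eta> = \<zeta> [^] CARD('l)"
        using T_finprod_shift[of B n 1 d] B by (simp add: d \<zeta>_def)
      then have "\<xi> = \<zeta> [^] CARD('l) \<otimes> \<eta>" using cl by (metis inv_solve_right' inv_closed m_closed m_assoc l_inv r_one)
      moreover have "\<zeta> [^] CARD('l) \<in> int_span (\<lambda>i. B i (Suc n)) h"
        using \<zeta> by (rule subgroup_nat_pow_closed[OF sub])
      ultimately show "\<xi> \<in> int_span (\<lambda>i. B i (Suc n)) h"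
        using \<eta> subgroup.m_closed[OF sub] by simp
    qed
  qed
qed

section \<open>Bases of the Tate module\<close>

definition lincomb :: "(nat \<Rightarrow> nat \<Rightarrow> 'a) \<Rightarrow> 'l padic vec \<Rightarrow> nat \<Rightarrow> 'a" where
  "lincomb B c = (\<lambda>n. \<Otimes>i\<in>{..<h}. B i n [^] residue (c $ i) n)"

definition basis :: "(nat \<Rightarrow> nat \<Rightarrow> 'a) \<Rightarrow> bool" where
  "basis B \<longleftrightarrow> (\<forall>i<h. B i \<in> T) \<and>
     (\<forall>x\<in>T. \<exists>!c. c \<in> carrier_vec h \<and> x = lincomb B c)"

lemma lincomb_zact:
  assumes "\<And>i. i < h \<Longrightarrow> B i \<in> T"
  shows "lincomb B c n = (\<Otimes>i\<in>{..<h}. zact (c $ i) (B i n))"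
  unfolding lincomb_def
  by (rule finprod_cong') (auto simp: zact_eq[OF T_tors[OF assms]] assms T_carrier)

text \<open>Pigeonhole: there are \<open>l ^ (n h)\<close> families of reduced coefficients, they
  reach all of \<open>A[l ^ n]\<close>, and this group has exactly that many elements.\<close>

lemma reduced_coeffs_inj:
  assumes B: "\<And>i. i < h \<Longrightarrow> B i \<in> T" and gen: "int_span (\<lambda>i. B i n) h = tors n"
    and eq: "(\<Otimes>i\<in>{..<h}. B i n [^] (c i :: int)) = (\<Otimes>i\<in>{..<h}. B i n [^] d i)" and i: "i < h"
  shows "c i mod int CARD('l) ^ n = d i mod int CARD('l) ^ n"
proof -
  let ?N = "int CARD('l) ^ n"
  have N: "?N > 0" using l_pos by simp
  \<comment> \<open>Extensional functions are fixed outside the index set, so that coefficient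
    families can be counted.\<close>
  let ?C = "{..<h} \<rightarrow>\<^sub>E {0..<?N}"
  let ?f = "\<lambda>c. \<Otimes>i\<in>{..<h}. B i n [^] (c i :: int)"
  let ?r = "\<lambda>c. \<lambda>i\<in>{..<h}. c i mod ?N"
  have red: "?f (?r c) = ?f c" for c
    by (rule finprod_cong') (auto simp: B T_carrier int_pow_mod_tors[OF T_tors[OF B]])
  have rC: "?r c \<in> ?C" for c using N by auto
  have "?f ` ?C = tors n"
  proof
    show "?f ` ?C \<subseteq> tors n" unfolding gen[symmetric] by (auto simp: int_span_def)
    show "tors n \<subseteq> ?f ` ?C"
    proof
      fix \<xi> assume "\<xi> \<in> tors n"
      then obtain c where "\<xi> = ?f c" unfolding gen[symmetric] by (auto simp: int_span_def)
      then have "\<xi> = ?f (?r c)" by (simp only: red)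
      then show "\<xi> \<in> ?f ` ?C" using rC by (rule image_eqI)
    qed
  qed
  moreover have "card ?C = card (tors n)"
    by (simp add: card_PiE card_tors nat_power_eq power_mult)
  moreover have "finite ?C" by (intro finite_PiE) auto
  ultimately have "inj_on ?f ?C" by (intro eq_card_imp_inj_on) simp_all
  moreover have "?f (?r c) = ?f (?r d)" by (simp only: red eq)
  ultimately have "?r c = ?r d" by (rule inj_onD[OF _ _ rC rC])
  then have "?r c i = ?r d i" by (rule fun_cong)
  then show ?thesis using i by simp
qed

text \<open>Integer coordinates are chosen at each level without regard to the others; independence
  modulo \<open>l ^ n\<close> forces them to be coherent, and coherent residues form an l-adic
  integer. The same independence gives uniqueness.\<close>

lemma basis_of_generators:
  assumes B: "\<And>i. i < h \<Longrightarrow> B i \<in> T" and gen: "\<And>n. int_span (\<lambda>i. B i n) h = tors n"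
  shows "basis B"
  unfolding basis_def
proof (intro conjI ballI allI impI)
  fix x assume x: "x \<in> T"
  have "\<exists>c. x n = (\<Otimes>i\<in>{..<h}. B i n [^] (c i :: int))" for n
    using T_tors[OF x, of n] gen[of n] by (auto simp: int_span_def)
  then obtain c where c: "\<And>n. x n = (\<Otimes>i\<in>{..<h}. B i n [^] (c n i :: int))" by metis
  \<comment> \<open>Since \<open>l x (n + 1) = x n\<close>, the coefficients of level
    \<open>n + 1\<close> also express \<open>x n\<close> at level \<open>n\<close>.\<close>
  have coh: "c n i mod int CARD('l) ^ n = c (Suc n) i mod int CARD('l) ^ n" if "i < h" for n i
  proof (rule reduced_coeffs_inj[of B, OF B gen _ that])
    show "(\<Otimes>i\<in>{..<h}. B i n [^] c n i) = (\<Otimes>i\<in>{..<h}. B i n [^] c (Suc n) i)"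
      using T_finprod_shift[of B n 1 "c (Suc n)"] B T_Suc[OF x, of n] by (simp add: c)
  qed
  have "\<exists>a :: 'l padic. \<forall>n. residue a n = c n i mod int CARD('l) ^ n" if i: "i < h" for i
  proof -
    have "c k i mod int CARD('l) ^ k = (c (Suc k) i mod int CARD('l) ^ Suc k) mod int CARD('l) ^ k" for k
      using coh[OF i] by (simp add: mod_mod_cancel)
    then show ?thesis
      by (rule padic_of_coherent[where f = "\<lambda>k. c k i mod int CARD('l) ^ k"]) blast
  qed
  then obtain a :: "nat \<Rightarrow> 'l padic" where a: "\<And>i n. i < h \<Longrightarrow> residue (a i) n = c n i mod int CARD('l) ^ n"
    by metis
  have "x = lincomb B (vec h a)"
  proof
    fix n
    show "x n = lincomb B (vec h a) n"
      unfolding c lincomb_def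
      by (rule finprod_cong') (auto simp: a int_pow_mod_tors[OF T_tors[OF B]] T_carrier B)
  qed
  moreover have "d = d'" if d: "d \<in> carrier_vec h" "d' \<in> carrier_vec h" "lincomb B d = lincomb B d'" for d d'
  proof (rule eq_vecI)
    fix i assume "i < dim_vec d'"
    then have i: "i < h" using d by simp
    show "d $ i = d' $ i"
    proof (rule padic_eqI)
      fix n
      have "residue (d $ i) n mod int CARD('l) ^ n = residue (d' $ i) n mod int CARD('l) ^ n"
        by (rule reduced_coeffs_inj[of B, OF B gen _ i])
          (use d(3) in \<open>auto simp: lincomb_def dest: fun_cong[of _ _ n]\<close>)
      then show "residue (d $ i) n = residue (d' $ i) n" by (simp add: residue_mod)
    qed
  qed (use d in simp)
  ultimately show "\<exists>!c. c \<in> carrier_vec h \<and> x = lincomb B c"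
    by (intro ex1I[of _ "vec h a"]) auto
qed (simp add: B)

text \<open>Generators of \<open>A[l]\<close> are lifted to the Tate module by divisibility, and the
  lifts then generate at every level.\<close>

lemma basis_exists: obtains B where "basis B"
proof -
  obtain b where b: "\<And>i. b i \<in> tors 1" "int_span b h = tors 1" by (rule tors_1_generated) blast
  have "\<exists>x. x \<in> T \<and> x 1 = b i" for i using b(1) T_surj by metis
  then obtain B where B: "\<And>i. B i \<in> T" "\<And>i. B i 1 = b i" by metis
  have "int_span (\<lambda>i. B i n) h = tors n" for n
    by (rule tors_generated[OF B(1)]) (simp only: B(2) b(2))
  then show ?thesis using basis_of_generators[of B] B that by blast
qed

lemma basis_T: "basis B \<Longrightarrow> i < h \<Longrightarrow> B i \<in> T" by (simp add: basis_def)

lemma lincomb_T: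
  assumes B: "\<And>i. i < h \<Longrightarrow> B i \<in> T"
  shows "lincomb B c \<in> T"
proof -
  have "lincomb B c (Suc n) [^] CARD('l) = lincomb B c n" for n
  proof -
    have "lincomb B c (Suc n) [^] CARD('l) = (\<Otimes>i\<in>{..<h}. B i n [^] residue (c $ i) (Suc n))"
      using T_finprod_shift[of B n 1] B by (simp add: lincomb_def)
    also have "\<dots> = lincomb B c n" unfolding lincomb_def
    proof (rule finprod_cong')
      fix i assume "i \<in> {..<h}"
      then show "B i n [^] residue (c $ i) (Suc n) = B i n [^] residue (c $ i) n"
        using int_pow_mod_tors[OF T_tors[OF B], of i n "residue (c $ i) (Suc n)"]
        by (simp add: residue_mod_le)
    qed (auto simp: B T_carrier)
    finally show ?thesis .
  qed
  moreover have "lincomb B c n \<in> tors n" for n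
    using int_span_tors[of h "\<lambda>i. B i n" n] B T_tors by (auto simp: int_span_def lincomb_def)
  ultimately show ?thesis by (simp add: T_def)
qed

lemma lincomb_inj:
  assumes "basis B" "c \<in> carrier_vec h" "d \<in> carrier_vec h" "lincomb B c = lincomb B d"
  shows "c = d"
  using assms lincomb_T[of B c] unfolding basis_def by metis

lemma matrix_of_family:
  assumes "basis B" "\<And>j. j < h \<Longrightarrow> C j \<in> T"
  obtains P where "P \<in> carrier_mat h h" "\<And>j. j < h \<Longrightarrow> C j = lincomb B (col P j)"
proof -
  have "\<exists>c. c \<in> carrier_vec h \<and> C j = lincomb B c" if "j < h" for j
    using assms that unfolding basis_def by blast
  then obtain c where c: "\<And>j. j < h \<Longrightarrow> c j \<in> carrier_vec h \<and> C j = lincomb B (c j)" by metis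
  define P where "P = mat h h (\<lambda>(i, j). c j $ i)"
  have "col P j = c j" if "j < h" for j using c[OF that] that by (intro eq_vecI) (auto simp: P_def)
  then show ?thesis using that[of P] c by (simp add: P_def)
qed

lemma lincomb_mult_mat_vec:
  assumes B: "\<And>i. i < h \<Longrightarrow> B i \<in> T" and P: "P \<in> carrier_mat h h" and c: "c \<in> carrier_vec h"
    and C: "\<And>j. j < h \<Longrightarrow> C j = lincomb B (col P j)"
  shows "lincomb C c = lincomb B (P *\<^sub>v c)"
proof
  fix n
  have CT: "C j \<in> T" if "j < h" for j using lincomb_T[OF B] C[OF that] by simp
  have lz: "lincomb B d n = (\<Otimes>i\<in>{..<h}. zact (d $ i) (B i n))" for d
    by (rule lincomb_zact) (rule B)
  have "lincomb C c n = (\<Otimes>j\<in>{..<h}. zact (c $ j) (C j n))"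
    by (rule lincomb_zact) (rule CT)
  also have "\<dots> = (\<Otimes>j\<in>{..<h}. zact (c $ j) (\<Otimes>i\<in>{..<h}. zact (P $$ (i, j)) (B i n)))"
  proof (rule finprod_cong')
    fix j assume "j \<in> {..<h}"
    then have "C j n = (\<Otimes>i\<in>{..<h}. zact (P $$ (i, j)) (B i n))"
      using P by (simp add: C lz) (intro finprod_cong', auto simp: B T_carrier zact_carrier)
    then show "zact (c $ j) (C j n) = zact (c $ j) (\<Otimes>i\<in>{..<h}. zact (P $$ (i, j)) (B i n))" by simp
  qed (auto simp: B T_carrier intro!: zact_carrier finprod_closed)
  also have "\<dots> = (\<Otimes>i\<in>{..<h}. zact (\<Sum>j<h. P $$ (i, j) * c $ j) (B i n))"
    by (rule ring_action_finprod_matrix) (auto simp: zact_hom zact_add zact_mult B T_carrier)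
  also have "\<dots> = lincomb B (P *\<^sub>v c) n"
    unfolding lz using P c
    by (intro finprod_cong') (auto simp: B T_carrier zact_carrier scalar_prod_def atLeast0LessThan)
  finally show "lincomb C c n = lincomb B (P *\<^sub>v c) n" .
qed

lemma lincomb_unit_vec:
  assumes "\<And>i. i < h \<Longrightarrow> B i \<in> T" "j < h"
  shows "lincomb B (unit_vec h j) = B j"
proof
  fix n
  have "lincomb B (unit_vec h j) n = (\<Otimes>i\<in>{..<h}. zact (unit_vec h j $ i) (B i n))"
    by (rule lincomb_zact) (rule assms(1))
  also have "\<dots> = (\<Otimes>i\<in>{..<h}. if j = i then B i n else \<one>)"
    using assms by (intro finprod_cong') (auto simp: zact_one zact_zero T_carrier)
  also have "\<dots> = B j n" using assms by (intro finprod_singleton) (auto simp: T_carrier)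
  finally show "lincomb B (unit_vec h j) n = B j n" .
qed

lemma hom_T: "f \<in> hom A A \<Longrightarrow> x \<in> T \<Longrightarrow> (\<lambda>n. f (x n)) \<in> T"
  using hom_nat_pow[of f A A _ "CARD('l)"] is_group T_carrier[of x] by (auto simp: T_def hom_tors) metis

lemma hom_lincomb:
  assumes "f \<in> hom A A" "\<And>i. i < h \<Longrightarrow> B i \<in> T"
  shows "(\<lambda>n. f (lincomb B c n)) = lincomb (\<lambda>i n. f (B i n)) c"
proof
  fix n
  have fB: "(\<lambda>n. f (B i n)) \<in> T" if "i < h" for i using hom_T[OF assms(1) assms(2)[OF that]] .
  have "lincomb B c n = (\<Otimes>i\<in>{..<h}. zact (c $ i) (B i n))"
    by (rule lincomb_zact) (rule assms(2))
  then have "f (lincomb B c n) = (\<Otimes>i\<in>{..<h}. f (zact (c $ i) (B i n)))"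
    using finprod_hom[OF assms(1), of "{..<h}" "\<lambda>i. zact (c $ i) (B i n)"]
    by (simp add: assms T_carrier zact_carrier)
  also have "\<dots> = (\<Otimes>i\<in>{..<h}. zact (c $ i) (f (B i n)))"
    by (rule finprod_cong')
      (auto simp: zact_commute_hom[OF assms(1)] assms T_carrier T_carrier[OF fB] intro!: zact_carrier)
  also have "\<dots> = lincomb (\<lambda>i n. f (B i n)) c n"
    by (rule lincomb_zact[symmetric]) (rule fB)
  finally show "f (lincomb B c n) = lincomb (\<lambda>i n. f (B i n)) c n" .
qed

section \<open>Matrices of endomorphisms and the characteristic polynomial\<close>

text \<open>For \<open>f = F\<close> this is the condition on \<open>M\<close> in
  \<open>frob_char_poly\<close>.\<close>

definition represents :: "('a \<Rightarrow> 'a) \<Rightarrow> (nat \<Rightarrow> nat \<Rightarrow> 'a) \<Rightarrow> 'l padic mat \<Rightarrow> bool" where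
  "represents f B M \<longleftrightarrow> M \<in> carrier_mat h h \<and> (\<forall>j<h. (\<lambda>n. f (B j n)) = lincomb B (col M j))"

lemma represents_exists:
  assumes "f \<in> hom A A" "basis B"
  obtains M where "represents f B M"
  using matrix_of_family[of B "\<lambda>j n. f (B j n)"] assms hom_T basis_T
  by (metis represents_def)

lemma represents_lincomb:
  assumes f: "f \<in> hom A A" and B: "basis B" and M: "represents f B M" and c: "c \<in> carrier_vec h"
  shows "(\<lambda>n. f (lincomb B c n)) = lincomb B (M *\<^sub>v c)"
proof -
  note BT = basis_T[OF B]
  have "(\<lambda>n. f (lincomb B c n)) = lincomb (\<lambda>i n. f (B i n)) c" using f BT by (rule hom_lincomb)
  also have "\<dots> = lincomb B (M *\<^sub>v c)"
    using M by (intro lincomb_mult_mat_vec BT c) (auto simp: represents_def)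
  finally show ?thesis .
qed

lemma mat_eq_of_lincomb_col:
  assumes B: "basis B" and P: "P \<in> carrier_mat h h" "Q \<in> carrier_mat h h"
    and eq: "\<And>j. j < h \<Longrightarrow> lincomb B (col P j) = lincomb B (col Q j)"
  shows "P = Q"
proof (rule mat_col_eqI)
  fix j assume "j < dim_col Q"
  then have "j < h" using P by simp
  then show "col P j = col Q j" using P by (intro lincomb_inj[OF B] eq) auto
qed (use P in auto)

text \<open>Multiplicativity of matrices, in the one case that occurs: an inverse map makes the
  matrix of Frobenius invertible over \<open>Z_l\<close>.\<close>

lemma represents_mult:
  assumes f: "f \<in> hom A A" "g \<in> hom A A" and B: "basis B" and M: "represents f B M" "represents g B N"
    and fg: "\<And>\<xi>. \<xi> \<in> carrier A \<Longrightarrow> f (g \<xi>) = \<xi>"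
  shows "M * N = 1\<^sub>m h"
proof (rule mat_eq_of_lincomb_col[OF B])
  have mats: "M \<in> carrier_mat h h" "N \<in> carrier_mat h h" using M by (auto simp: represents_def)
  then show "M * N \<in> carrier_mat h h" by simp
  fix j assume j: "j < h"
  have "lincomb B (col (M * N) j) = lincomb B (M *\<^sub>v col N j)"
    by (simp only: col_mult2[OF mats j])
  also have "\<dots> = (\<lambda>n. f (lincomb B (col N j) n))"
    using mats j by (intro represents_lincomb[OF f(1) B M(1), symmetric]) simp
  also have "\<dots> = (\<lambda>n. f (g (B j n)))"
    using M(2) j unfolding represents_def by metis
  also have "\<dots> = B j" using fg T_carrier basis_T[OF B j] by (intro ext) simp
  also have "\<dots> = lincomb B (unit_vec h j)" using basis_T[OF B] j by (simp add: lincomb_unit_vec)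
  finally show "lincomb B (col (M * N) j) = lincomb B (col (1\<^sub>m h) j)" using j by simp
qed simp

text \<open>The two matrices of base change are mutually inverse over \<open>Z_l\<close> and
  conjugate \<open>M'\<close> into \<open>M\<close>. The definite description in
  \<open>frob_char_poly\<close> has a meaning only because of this.\<close>

lemma char_poly_unique:
  assumes f: "f \<in> hom A A" and B: "basis B" "basis B'" and M: "represents f B M" "represents f B' M'"
  shows "char_poly M = char_poly M'"
proof -
  note BT = basis_T[OF B(1)] and BT' = basis_T[OF B(2)]
  obtain P where P: "P \<in> carrier_mat h h" "\<And>j. j < h \<Longrightarrow> B' j = lincomb B (col P j)"
    using matrix_of_family[of B B'] B(1) BT' by blast
  obtain P' where P': "P' \<in> carrier_mat h h" "\<And>j. j < h \<Longrightarrow> B j = lincomb B' (col P' j)"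
    using matrix_of_family[of B' B] B(2) BT by blast
  have mats: "M \<in> carrier_mat h h" "M' \<in> carrier_mat h h" using M by (auto simp: represents_def)
  have inverse: "P * P' = 1\<^sub>m h"
    if "basis B" "basis B'" "P \<in> carrier_mat h h" "P' \<in> carrier_mat h h"
      "\<And>j. j < h \<Longrightarrow> B' j = lincomb B (col P j)" "\<And>j. j < h \<Longrightarrow> B j = lincomb B' (col P' j)"
    for B B' P P'
  proof (rule mat_eq_of_lincomb_col[OF that(1)])
    show "P * P' \<in> carrier_mat h h" using that by simp
    fix j assume j: "j < h"
    have "lincomb B (col (P * P') j) = lincomb B (P *\<^sub>v col P' j)"
      by (simp only: col_mult2[OF that(3,4) j])
    also have "\<dots> = lincomb B' (col P' j)"
      by (rule lincomb_mult_mat_vec[symmetric, OF basis_T[OF that(1)]]) (use that(3,4,5) j in auto)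
    also have "\<dots> = B j" using that(6)[OF j] by simp
    also have "\<dots> = lincomb B (unit_vec h j)" using basis_T[OF that(1)] j by (simp add: lincomb_unit_vec)
    finally show "lincomb B (col (P * P') j) = lincomb B (col (1\<^sub>m h) j)" using j by simp
  qed simp
  have PP': "P * P' = 1\<^sub>m h" using B P P' by (intro inverse)
  have P'P: "P' * P = 1\<^sub>m h" using B P P' by (intro inverse)
  have "M * P = P * M'"
  proof (rule mat_eq_of_lincomb_col[OF B(1)])
    fix j assume j: "j < h"
    have "lincomb B (col (M * P) j) = lincomb B (M *\<^sub>v col P j)"
      by (simp only: col_mult2[OF mats(1) P(1) j])
    also have "\<dots> = (\<lambda>n. f (lincomb B (col P j) n))"
      using P(1) j by (intro represents_lincomb[OF f B(1) M(1), symmetric]) simp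
    also have "\<dots> = lincomb B' (col M' j)" using P(2)[OF j, symmetric] M(2) j by (simp add: represents_def)
    also have "\<dots> = lincomb B (P *\<^sub>v col M' j)"
      using P mats j by (intro lincomb_mult_mat_vec BT) auto
    also have "\<dots> = lincomb B (col (P * M') j)" by (simp only: col_mult2[OF P(1) mats(2) j])
    finally show "lincomb B (col (M * P) j) = lincomb B (col (P * M') j)" .
  qed (use mats P in auto)
  then have "M = P * M' * P'"
    using mats P(1) P'(1) PP' by (metis assoc_mult_mat right_mult_one_mat)
  then have "similar_mat M M'"
    unfolding similar_mat_def similar_mat_wit_def Let_def
    using mats P(1) P'(1) PP' P'P by (intro exI[of _ P] exI[of _ P']) auto
  then show ?thesis by (rule char_poly_similar)
qed

end

locale l_divisible_aut = l_divisible_module A L h + l_torsion_aut A L F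
  for A :: "('a, 'b) monoid_scheme" (structure) and L :: "'l::prime_card itself" and h F
begin

text \<open>Cayley-Hamilton is applied at each level \<open>n\<close> to the elements
  \<open>B k n\<close> of \<open>A\<close>. Any \<open>\<xi>\<close> is an entry of some element of
  the Tate module, hence a \<open>Z_l\<close>-combination of these, and \<open>Z_l\<close> commutes
  with the action of polynomials.\<close>

lemma pact_char_poly:
  assumes B: "basis B" and M: "represents F B M" and \<xi>: "\<xi> \<in> carrier A"
  shows "pact (char_poly M) \<xi> = \<one>"
proof -
  note BT = basis_T[OF B]
  have mat: "M \<in> carrier_mat h h" using M by (simp add: represents_def)
  have pB: "pact (char_poly M) (B k n) = \<one>" if k: "k < h" for k n
  proof (rule cayley_hamilton_action[OF mat _ _ k])
    fix j assume j: "j < h"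
    then have "F (B j n) = lincomb B (col M j) n"
      using M fun_cong[of "\<lambda>n. F (B j n)" "lincomb B (col M j)" n] by (simp add: represents_def)
    also have "\<dots> = (\<Otimes>i\<in>{..<h}. zact (col M j $ i) (B i n))"
      by (rule lincomb_zact) (rule BT)
    also have "\<dots> = (\<Otimes>i\<in>{..<h}. zact (M $$ (i, j)) (B i n))"
      using mat j by (intro finprod_cong') (auto simp: BT T_carrier zact_carrier)
    finally show "F (B j n) = (\<Otimes>i\<in>{..<h}. zact (M $$ (i, j)) (B i n))" .
  qed (simp add: BT T_carrier)
  obtain n where "\<xi> \<in> tors n" by (rule carrier_tors[OF \<xi>])
  then obtain x where x: "x \<in> T" "x n = \<xi>" by (rule T_surj)
  then obtain c where "x = lincomb B c" using B unfolding basis_def by blast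
  then have "\<xi> = (\<Otimes>i\<in>{..<h}. zact (c $ i) (B i n))" using x lincomb_zact[of B c n] BT by simp
  then have "pact (char_poly M) \<xi> = (\<Otimes>i\<in>{..<h}. pact (char_poly M) (zact (c $ i) (B i n)))"
    using finprod_hom[OF pact_hom[of "char_poly M"], of "{..<h}" "\<lambda>i. zact (c $ i) (B i n)"]
    by (simp add: BT T_carrier zact_carrier)
  also have "\<dots> = \<one>"
    by (rule finprod_one_eqI)
      (simp add: zact_commute_hom[OF pact_hom] BT T_carrier pB hom_one[OF zact_hom] is_group)
  finally show ?thesis .
qed

text \<open>The constant coefficient is \<open>det (- M)\<close>. It is a unit because the inverse
  of \<open>F\<close> on \<open>A\<close> is again an endomorphism and so has a matrix
  \<open>N\<close>, with \<open>M * N = 1\<close>.\<close>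

lemma char_poly_const_unit:
  assumes B: "basis B" and M: "represents F B M"
  obtains w where "coeff (char_poly M) 0 * w = 1"
proof -
  define F' where "F' = inv_into (carrier A) F"
  have F': "F' \<xi> \<in> carrier A" "F (F' \<xi>) = \<xi>" if "\<xi> \<in> carrier A" for \<xi>
    using F_bij that unfolding F'_def bij_betw_def by (auto simp: inv_into_into f_inv_into_f)
  have "F' (\<xi> \<otimes> \<eta>) = F' \<xi> \<otimes> F' \<eta>" if "\<xi> \<in> carrier A" "\<eta> \<in> carrier A" for \<xi> \<eta>
  proof (rule inj_onD[OF bij_betw_imp_inj_on[OF F_bij]])
    show "F (F' (\<xi> \<otimes> \<eta>)) = F (F' \<xi> \<otimes> F' \<eta>)" using that F' by (simp add: F_mult)
  qed (use that F' in auto)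
  then have F'_hom: "F' \<in> hom A A" using F' by (auto simp: hom_def)
  obtain N where N: "represents F' B N" by (rule represents_exists[OF F'_hom B])
  have mats: "M \<in> carrier_mat h h" "N \<in> carrier_mat h h" using M N by (auto simp: represents_def)
  have "M * N = 1\<^sub>m h" by (rule represents_mult[OF F_hom F'_hom B M N F'(2)])
  then have "(- M) * (- N) = 1\<^sub>m h" using mats by simp
  then have "det (- M) * det (- N) = 1"
    using mats by (metis det_mult det_one uminus_carrier_mat)
  moreover have "coeff (char_poly M) 0 = det (- M)"
  proof -
    have "poly (char_poly M) 0 = det (- M)"
      unfolding char_poly_def
      by (rule poly_det_cong[of _ h]) (use mats in \<open>auto simp: char_poly_matrix_def\<close>)
    then show ?thesis by (simp add: poly_0_coeff_0)
  qed
  ultimately show ?thesis using that by metis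
qed

end

section \<open>Points of finite commutative group schemes\<close>

lemma sum_swap3: "(\<Sum>a\<in>A. \<Sum>p\<in>P. \<Sum>r\<in>R. f a p r) = (\<Sum>p\<in>P. \<Sum>r\<in>R. \<Sum>a\<in>A. f a p r)"
  by (subst sum.swap) (intro sum.cong refl sum.swap)

lemma sum_cong2:
  "(\<And>i j. i < n \<Longrightarrow> j < m \<Longrightarrow> f i j = g i j) \<Longrightarrow> (\<Sum>i<n. \<Sum>j<m. f i j) = (\<Sum>i<n. \<Sum>j<(m::nat). g i j)"
  for n :: nat
  by (intro sum.cong) auto

lemma sum_cong3:
  "(\<And>i j k. i < n \<Longrightarrow> j < m \<Longrightarrow> k < r \<Longrightarrow> f i j k = g i j k) \<Longrightarrow>
    (\<Sum>i<n. \<Sum>j<m. \<Sum>k<r. f i j k) = (\<Sum>i<n. \<Sum>j<(m::nat). \<Sum>k<(r::nat). g i j k)"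
  for n :: nat
  by (intro sum.cong) auto

lemmas sum_distribs = sum_distrib_left sum_distrib_right

lemma point_group_simps:
  "carrier (point_group A) = points A"
  "\<one>\<^bsub>point_group A\<^esub> = vec (rk A) (\<lambda>m. to_ac (counit A m))"
  "x \<otimes>\<^bsub>point_group A\<^esub> y = vec (rk A)
     (\<lambda>m. \<Sum>i<rk A. \<Sum>j<rk A. to_ac (comul A m i j) * (x $ i * y $ j))"
  by (simp_all add: point_group_def)

lemma points_carrier_vec: "x \<in> points A \<Longrightarrow> x \<in> carrier_vec (rk A)"
  by (simp add: points_def)

locale commutative_hopf =
  fixes A :: "'k::field hopf"
  assumes hopf: "comm_hopf_algebra A"
begin

abbreviation "d \<equiv> rk A"
abbreviation "c i j m \<equiv> to_ac (mul A i j m)"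
abbreviation "\<delta> m i j \<equiv> to_ac (comul A m i j)"
abbreviation "\<epsilon> m \<equiv> to_ac (counit A m)"
abbreviation "u m \<equiv> to_ac (unt A m)"
abbreviation pmult (infixl "\<star>" 70) where "x \<star> y \<equiv> x \<otimes>\<^bsub>point_group A\<^esub> y"

lemma cocomm: "m < d \<Longrightarrow> i < d \<Longrightarrow> j < d \<Longrightarrow> \<delta> m i j = \<delta> m j i"
  using hopf by (auto simp: comm_hopf_algebra_def cocomm_coalgebra_def Let_def)

lemma coassoc:
  assumes "m < d" "i < d" "j < d" "r < d"
  shows "(\<Sum>p<d. \<delta> m p r * \<delta> p i j) = (\<Sum>p<d. \<delta> m i p * \<delta> p j r)"
proof -
  have "\<forall>m<d. \<forall>i<d. \<forall>j<d. \<forall>r<d. (\<Sum>p<d. comul A m p r * comul A p i j) = (\<Sum>p<d. comul A m i p * comul A p j r)"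
    using hopf unfolding comm_hopf_algebra_def cocomm_coalgebra_def Let_def by (elim conjE) assumption
  then have "(\<Sum>p<d. comul A m p r * comul A p i j) = (\<Sum>p<d. comul A m i p * comul A p j r)"
    using assms by blast
  from arg_cong[OF this, of to_ac] show ?thesis by (simp add: to_ac_sum)
qed

lemma counit_comul:
  assumes "m < d" "j < d"
  shows "(\<Sum>i<d. \<epsilon> i * \<delta> m i j) = (if m = j then 1 else 0)"
proof -
  have "(\<Sum>i<d. counit A i * comul A m i j) = (if m = j then 1 else 0)"
    using hopf assms by (simp add: comm_hopf_algebra_def cocomm_coalgebra_def Let_def)
  from arg_cong[OF this, of to_ac] show ?thesis by (simp add: to_ac_sum)
qed

lemma mul_comul:
  assumes "i < d" "j < d" "p < d" "r < d"
  shows "(\<Sum>m<d. c i j m * \<delta> m p r) =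
    (\<Sum>s<d. \<Sum>t<d. \<Sum>s'<d. \<Sum>t'<d. \<delta> i s t * \<delta> j s' t' * c s s' p * c t t' r)"
proof -
  have "(\<Sum>m<d. mul A i j m * comul A m p r) =
    (\<Sum>s<d. \<Sum>t<d. \<Sum>s'<d. \<Sum>t'<d. comul A i s t * comul A j s' t' * mul A s s' p * mul A t t' r)"
    using hopf assms by (simp add: comm_hopf_algebra_def Let_def)
  from arg_cong[OF this, of to_ac] show ?thesis by (simp add: to_ac_sum)
qed

lemma unt_comul:
  assumes "i < d" "j < d"
  shows "(\<Sum>m<d. u m * \<delta> m i j) = u i * u j"
proof -
  have "(\<Sum>m<d. unt A m * comul A m i j) = unt A i * unt A j"
    using hopf assms by (simp add: comm_hopf_algebra_def Let_def)
  from arg_cong[OF this, of to_ac] show ?thesis by (simp add: to_ac_sum)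
qed

lemma mul_counit:
  assumes "i < d" "j < d"
  shows "(\<Sum>m<d. c i j m * \<epsilon> m) = \<epsilon> i * \<epsilon> j"
proof -
  have "(\<Sum>m<d. mul A i j m * counit A m) = counit A i * counit A j"
    using hopf assms by (simp add: comm_hopf_algebra_def Let_def)
  from arg_cong[OF this, of to_ac] show ?thesis by (simp add: to_ac_sum)
qed

lemma unt_counit: "(\<Sum>m<d. u m * \<epsilon> m) = 1"
proof -
  have "(\<Sum>m<d. unt A m * counit A m) = 1"
    using hopf by (simp add: comm_hopf_algebra_def Let_def)
  from arg_cong[OF this, of to_ac] show ?thesis by (simp add: to_ac_sum)
qed

lemma antipode:
  assumes "m < d" "r < d"
  shows "(\<Sum>i<d. \<Sum>j<d. \<Sum>p<d. \<delta> m i j * to_ac (antipode A i p) * c p j r) = \<epsilon> m * u r"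
proof -
  have "(\<Sum>i<d. \<Sum>j<d. \<Sum>p<d. comul A m i j * antipode A i p * mul A p j r) = counit A m * unt A r"
    using hopf assms by (simp add: comm_hopf_algebra_def Let_def)
  from arg_cong[OF this, of to_ac] show ?thesis by (simp add: to_ac_sum)
qed

lemma pmult_index:
  "m < d \<Longrightarrow> (x \<star> y) $ m = (\<Sum>i<d. \<Sum>j<d. \<delta> m i j * (x $ i * y $ j))"
  by (simp add: point_group_simps)

lemma pmult_carrier: "x \<star> y \<in> carrier_vec d"
  by (simp add: point_group_simps)

lemma pmult_comm: "x \<star> y = y \<star> x"
proof (rule eq_vecI)
  fix m assume "m < dim_vec (y \<star> x)"
  then have m: "m < d" by (simp add: point_group_simps)
  have "(x \<star> y) $ m = (\<Sum>j<d. \<Sum>i<d. \<delta> m i j * (x $ i * y $ j))"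
    unfolding pmult_index[OF m] by (rule sum.swap)
  also have "\<dots> = (y \<star> x) $ m"
    unfolding pmult_index[OF m] by (intro sum.cong refl) (use m in \<open>simp add: cocomm[of m] mult.commute\<close>)
  finally show "(x \<star> y) $ m = (y \<star> x) $ m" .
qed (simp add: point_group_simps)

lemma pmult_one: "x \<in> carrier_vec d \<Longrightarrow> \<one>\<^bsub>point_group A\<^esub> \<star> x = x"
proof (rule eq_vecI)
  assume x: "x \<in> carrier_vec d"
  fix m assume "m < dim_vec x"
  then have m: "m < d" using x by simp
  have "(\<one>\<^bsub>point_group A\<^esub> \<star> x) $ m = (\<Sum>j<d. \<Sum>i<d. \<delta> m i j * (\<epsilon> i * x $ j))"
    unfolding pmult_index[OF m] by (subst sum.swap) (simp add: point_group_simps)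
  also have "\<dots> = (\<Sum>j<d. (\<Sum>i<d. \<epsilon> i * \<delta> m i j) * x $ j)"
    by (simp add: sum_distribs mult_ac)
  also have "\<dots> = (\<Sum>j<d. if m = j then x $ j else 0)"
    by (rule sum.cong) (auto simp: counit_comul m)
  also have "\<dots> = x $ m" using m by simp
  finally show "(\<one>\<^bsub>point_group A\<^esub> \<star> x) $ m = x $ m" .
qed (simp add: point_group_simps)

text \<open>Coassociativity, for arbitrary linear forms and not only for points:
  \<open>pmult_cancel\<close> multiplies by an inverse that is known only as a linear form.\<close>

lemma pmult_assoc: "(x \<star> y) \<star> z = x \<star> (y \<star> z)"
proof (rule eq_vecI)
  fix m assume "m < dim_vec (x \<star> (y \<star> z))"
  then have m: "m < d" by (simp add: point_group_simps)
  let ?f = "\<lambda>p r i j. \<delta> m p r * \<delta> p i j * (x $ i * y $ j * z $ r)"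
  have "((x \<star> y) \<star> z) $ m
      = (\<Sum>p<d. \<Sum>r<d. \<Sum>i<d. \<Sum>j<d. ?f p r i j)"
    unfolding pmult_index[OF m]
    by (intro sum.cong refl) (simp add: pmult_index sum_distrib_left sum_distrib_right mult_ac)
  also have "\<dots> = (\<Sum>p<d. \<Sum>i<d. \<Sum>j<d. \<Sum>r<d. ?f p r i j)"
    by (intro sum.cong refl sum_swap3)
  also have "\<dots> = (\<Sum>i<d. \<Sum>j<d. \<Sum>p<d. \<Sum>r<d. ?f p r i j)"
    by (rule sum_swap3)
  also have "\<dots> = (\<Sum>i<d. \<Sum>j<d. \<Sum>r<d. \<Sum>p<d. ?f p r i j)"
    by (intro sum.cong refl sum.swap)
  also have "\<dots> = (\<Sum>i<d. \<Sum>j<d. \<Sum>r<d. \<Sum>p<d. \<delta> m i p * \<delta> p j r * (x $ i * y $ j * z $ r))"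
    by (rule sum_cong3) (simp add: sum_distrib_right[symmetric] coassoc m)
  also have "\<dots> = (\<Sum>i<d. \<Sum>p<d. \<Sum>j<d. \<Sum>r<d. \<delta> m i p * \<delta> p j r * (x $ i * y $ j * z $ r))"
    by (intro sum.cong refl sum_swap3[symmetric])
  also have "\<dots> = (x \<star> (y \<star> z)) $ m"
    unfolding pmult_index[OF m]
    by (intro sum.cong refl) (simp add: pmult_index sum_distrib_left mult_ac)
  finally show "((x \<star> y) \<star> z) $ m = (x \<star> (y \<star> z)) $ m" .
qed (simp add: point_group_simps)

lemma points_mul:
  "x \<in> points A \<Longrightarrow> i < d \<Longrightarrow> j < d \<Longrightarrow> x $ i * x $ j = (\<Sum>m<d. c i j m * x $ m)"
  by (simp add: points_def)

lemma points_unt: "x \<in> points A \<Longrightarrow> (\<Sum>m<d. u m * x $ m) = 1"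
  by (simp add: points_def)

lemma one_points: "\<one>\<^bsub>point_group A\<^esub> \<in> points A"
  unfolding points_def using mul_counit unt_counit by (simp add: point_group_simps)

text \<open>\<open>(x \<otimes> y) \<circ> \<Delta>\<close> is multiplicative because
  \<open>\<Delta>\<close> is; in coordinates this is \<open>mul_comul\<close> inside a sixfold
  sum.\<close>

lemma pmult_points:
  assumes x: "x \<in> points A" and y: "y \<in> points A"
  shows "x \<star> y \<in> points A"
proof -
  have "(x \<star> y) $ i * (x \<star> y) $ j = (\<Sum>m<d. c i j m * (x \<star> y) $ m)" if ij: "i < d" "j < d" for i j
  proof -
    let ?g = "\<lambda>s t s' t' p r. \<delta> i s t * \<delta> j s' t' * c s s' p * c t t' r * (x $ p * y $ r)"
    have summand: "\<delta> i s t * (x $ s * y $ t) * (\<delta> j s' t' * (x $ s' * y $ t')) = (\<Sum>p<d. \<Sum>r<d. ?g s t s' t' p r)"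
      if "s < d" "t < d" "s' < d" "t' < d" for s t s' t'
    proof -
      have "\<delta> i s t * (x $ s * y $ t) * (\<delta> j s' t' * (x $ s' * y $ t'))
          = \<delta> i s t * \<delta> j s' t' * ((x $ s * x $ s') * (y $ t * y $ t'))" by (simp add: mult_ac)
      also have "(x $ s * x $ s') * (y $ t * y $ t') = (\<Sum>p<d. \<Sum>r<d. (c s s' p * x $ p) * (c t t' r * y $ r))"
        using that x y by (simp add: points_mul sum_product)
      finally show ?thesis by (simp add: sum_distrib_left mult_ac)
    qed
    have "(x \<star> y) $ i * (x \<star> y) $ j
        = (\<Sum>s<d. \<Sum>t<d. \<delta> i s t * (x $ s * y $ t) * (\<Sum>s'<d. \<Sum>t'<d. \<delta> j s' t' * (x $ s' * y $ t')))"
      unfolding pmult_index[OF ij(1)] pmult_index[OF ij(2)] by (simp only: sum_distrib_right)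
    also have "\<dots> = (\<Sum>s<d. \<Sum>t<d. \<Sum>s'<d. \<Sum>t'<d. \<Sum>p<d. \<Sum>r<d. ?g s t s' t' p r)"
      unfolding sum_distrib_left by (intro sum.cong refl) (simp add: summand)
    \<comment> \<open>Four rotations carry the sums over \<open>p\<close> and \<open>r\<close> to
      the front, leaving the right-hand side of \<open>mul_comul\<close> inside.\<close>
    also have "\<dots> = (\<Sum>s<d. \<Sum>t<d. \<Sum>s'<d. \<Sum>p<d. \<Sum>r<d. \<Sum>t'<d. ?g s t s' t' p r)"
      by (intro sum.cong refl sum_swap3)
    also have "\<dots> = (\<Sum>s<d. \<Sum>t<d. \<Sum>p<d. \<Sum>r<d. \<Sum>s'<d. \<Sum>t'<d. ?g s t s' t' p r)"
      by (intro sum.cong refl sum_swap3)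
    also have "\<dots> = (\<Sum>s<d. \<Sum>p<d. \<Sum>r<d. \<Sum>t<d. \<Sum>s'<d. \<Sum>t'<d. ?g s t s' t' p r)"
      by (intro sum.cong refl sum_swap3)
    also have "\<dots> = (\<Sum>p<d. \<Sum>r<d. \<Sum>s<d. \<Sum>t<d. \<Sum>s'<d. \<Sum>t'<d. ?g s t s' t' p r)"
      by (rule sum_swap3)
    also have "\<dots> = (\<Sum>p<d. \<Sum>r<d. (\<Sum>m<d. c i j m * \<delta> m p r) * (x $ p * y $ r))"
      by (intro sum.cong refl) (simp add: sum_distrib_right mul_comul ij)
    also have "\<dots> = (\<Sum>p<d. \<Sum>r<d. \<Sum>m<d. c i j m * (\<delta> m p r * (x $ p * y $ r)))"
      by (rule sum_cong2) (simp add: sum_distrib_right mult.assoc)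
    also have "\<dots> = (\<Sum>m<d. \<Sum>p<d. \<Sum>r<d. c i j m * (\<delta> m p r * (x $ p * y $ r)))"
      by (rule sum_swap3[symmetric])
    also have "\<dots> = (\<Sum>m<d. c i j m * (x \<star> y) $ m)"
      by (intro sum.cong refl) (simp add: pmult_index sum_distrib_left)
    finally show ?thesis .
  qed
  moreover have "(\<Sum>m<d. u m * (x \<star> y) $ m) = 1"
  proof -
    have "(\<Sum>m<d. u m * (x \<star> y) $ m) = (\<Sum>m<d. \<Sum>i<d. \<Sum>j<d. u m * \<delta> m i j * (x $ i * y $ j))"
      by (intro sum.cong refl) (simp add: pmult_index sum_distrib_left mult_ac)
    also have "\<dots> = (\<Sum>i<d. \<Sum>j<d. \<Sum>m<d. u m * \<delta> m i j * (x $ i * y $ j))" by (rule sum_swap3)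
    also have "\<dots> = (\<Sum>i<d. \<Sum>j<d. u i * u j * (x $ i * y $ j))"
      by (rule sum_cong2) (simp add: sum_distrib_right[symmetric] unt_comul)
    also have "\<dots> = (\<Sum>i<d. u i * x $ i) * (\<Sum>j<d. u j * y $ j)"
      by (simp add: sum_product mult_ac)
    also have "\<dots> = 1" using points_unt[OF x] points_unt[OF y] by simp
    finally show ?thesis .
  qed
  ultimately show ?thesis unfolding points_def using pmult_carrier by blast
qed

text \<open>The inverse \<open>x \<circ> S\<close> of a point is at first only a linear form.\<close>

lemma ambient_inverse:
  assumes x: "x \<in> points A"
  obtains y where "y \<in> carrier_vec d" "y \<star> x = \<one>\<^bsub>point_group A\<^esub>"
proof
  let ?S = "\<lambda>i p. to_ac (antipode A i p)"
  let ?y = "vec d (\<lambda>i. \<Sum>p<d. ?S i p * x $ p)"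
  show "?y \<in> carrier_vec d" by simp
  show "?y \<star> x = \<one>\<^bsub>point_group A\<^esub>"
  proof (rule eq_vecI)
    fix m assume "m < dim_vec (\<one>\<^bsub>point_group A\<^esub> :: 'k alg_closure vec)"
    then have m: "m < d" by (simp add: point_group_simps)
    let ?f = "\<lambda>i j p r. \<delta> m i j * ?S i p * c p j r * x $ r"
    have "(?y \<star> x) $ m = (\<Sum>i<d. \<Sum>j<d. \<Sum>p<d. \<delta> m i j * ?S i p * (x $ p * x $ j))"
      unfolding pmult_index[OF m]
      by (intro sum.cong refl) (simp add: sum_distrib_left sum_distrib_right mult_ac)
    also have "\<dots> = (\<Sum>i<d. \<Sum>j<d. \<Sum>p<d. \<Sum>r<d. ?f i j p r)"
      by (rule sum_cong3) (simp add: points_mul[OF x] sum_distrib_left mult.assoc)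
    also have "\<dots> = (\<Sum>i<d. \<Sum>j<d. \<Sum>r<d. \<Sum>p<d. ?f i j p r)"
      by (intro sum.cong refl sum.swap)
    also have "\<dots> = (\<Sum>i<d. \<Sum>r<d. \<Sum>j<d. \<Sum>p<d. ?f i j p r)"
      by (intro sum.cong refl sum.swap)
    also have "\<dots> = (\<Sum>r<d. \<Sum>i<d. \<Sum>j<d. \<Sum>p<d. ?f i j p r)"
      by (rule sum.swap)
    also have "\<dots> = (\<Sum>r<d. \<epsilon> m * (u r * x $ r))"
      by (intro sum.cong refl) (simp add: sum_distrib_right[symmetric] antipode m)
    also have "\<dots> = \<epsilon> m" using points_unt[OF x] by (simp add: sum_distrib_left[symmetric])
    finally show "(?y \<star> x) $ m = \<one>\<^bsub>point_group A\<^esub> $ m" using m by (simp add: point_group_simps)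
  qed (simp add: point_group_simps)
qed

text \<open>A linear form inverse to \<open>x\<close> suffices to cancel \<open>x\<close>.
  Translations are therefore injective, and finiteness will turn this into inverses that are
  points.\<close>

lemma pmult_cancel:
  assumes "x \<in> points A" "y \<in> carrier_vec d" "z \<in> carrier_vec d" "x \<star> y = x \<star> z"
  shows "y = z"
proof -
  obtain w where w: "w \<star> x = \<one>\<^bsub>point_group A\<^esub>" using ambient_inverse[OF assms(1)] by blast
  have "w \<star> x \<star> y = w \<star> x \<star> z" by (simp only: pmult_assoc assms(4))
  then show ?thesis unfolding w using assms(2,3) by (simp add: pmult_one)
qed

end

locale etale_hopf = commutative_hopf +
  assumes etale: "etale A"
begin

text \<open>The value of the linear form \<open>x\<close> at the element with coordinates
  \<open>a\<close> of the algebra over the closure.\<close>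

abbreviation lin :: "(nat \<Rightarrow> 'a alg_closure) \<Rightarrow> 'a alg_closure vec \<Rightarrow> 'a alg_closure" where
  "lin a x \<equiv> \<Sum>i<d. a i * x $ i"

text \<open>\<open>pt s\<close> are the rows of the etale matrix \<open>P\<close>, and
  \<open>e s\<close> the columns of its inverse: the primitive idempotents, once the algebra over
  the closure is identified with a power of the field.\<close>

lemma dual_basis:
  obtains pt e where "\<And>s. s < d \<Longrightarrow> pt s \<in> points A"
    "\<And>s t. s < d \<Longrightarrow> t < d \<Longrightarrow> lin (e t) (pt s) = (if s = t then 1 else 0)"
    "\<And>i j. i < d \<Longrightarrow> j < d \<Longrightarrow> (\<Sum>s<d. e s i * pt s $ j) = (if i = j then 1 else 0)"
proof -
  obtain P where P: "P \<in> carrier_mat d d" "invertible_mat P" "\<And>s. s < d \<Longrightarrow> row P s \<in> points A"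
    using etale by (auto simp: etale_def)
  then obtain Q where Q: "P * Q = 1\<^sub>m d" "Q * P = 1\<^sub>m (dim_row Q)"
    by (auto simp: invertible_mat_def inverts_mat_def)
  then have "dim_col Q = d" "dim_row Q = d"
    using P(1) by (metis index_mult_mat(3) index_one_mat(3), metis index_mult_mat(3) index_one_mat(3) carrier_matD(2))
  then have Qc: "Q \<in> carrier_mat d d" by auto
  show ?thesis
  proof (rule that[of "row P" "\<lambda>s i. Q $$ (i, s)"])
    show "(\<Sum>i<d. Q $$ (i, t) * row P s $ i) = (if s = t then 1 else 0)" if "s < d" "t < d" for s t
    proof -
      have "(\<Sum>i<d. Q $$ (i, t) * row P s $ i) = (P * Q) $$ (s, t)"
        using P(1) Qc that by (simp add: scalar_prod_def atLeast0LessThan mult.commute)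
      then show ?thesis using that by (simp add: Q)
    qed
    show "(\<Sum>s<d. Q $$ (i, s) * row P s $ j) = (if i = j then 1 else 0)" if "i < d" "j < d" for i j
    proof -
      have "(\<Sum>s<d. Q $$ (i, s) * row P s $ j) = (Q * P) $$ (i, j)"
        using P(1) Qc that by (simp add: scalar_prod_def atLeast0LessThan)
      then show ?thesis using that Qc by (simp add: Q(2))
    qed
  qed (rule P(3))
qed

text \<open>Elements of an etale algebra are functions on its points: \<open>v\<close> is the sum of
  the \<open>e s\<close> weighted by its values at \<open>pt s\<close>. Identities in the algebra
  can thus be tested on points.\<close>

lemma points_separate:
  assumes "\<And>x. x \<in> points A \<Longrightarrow> lin v x = 0" "i < d"
  shows "v i = 0"
proof -
  obtain pt e where pe: "\<And>s. s < d \<Longrightarrow> pt s \<in> points A"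
    "\<And>s t. s < d \<Longrightarrow> t < d \<Longrightarrow> lin (e t) (pt s) = (if s = t then 1 else 0)"
    "\<And>i j. i < d \<Longrightarrow> j < d \<Longrightarrow> (\<Sum>s<d. e s i * pt s $ j) = (if i = j then 1 else 0)"
    by (rule dual_basis) blast
  have "v i = (\<Sum>j<d. v j * (if i = j then 1 else 0))" using assms(2) by (simp add: mult_delta_right)
  also have "\<dots> = (\<Sum>j<d. \<Sum>s<d. v j * (e s i * pt s $ j))"
    by (intro sum.cong refl) (simp add: pe(3)[symmetric] assms(2) sum_distrib_left)
  also have "\<dots> = (\<Sum>s<d. \<Sum>j<d. v j * (e s i * pt s $ j))" by (rule sum.swap)
  also have "\<dots> = (\<Sum>s<d. e s i * lin v (pt s))" by (simp add: sum_distrib_left mult_ac)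
  also have "\<dots> = 0" by (rule sum.neutral) (simp add: assms(1) pe(1))
  finally show ?thesis .
qed

text \<open>An algebra homomorphism from a power of a field to the field is a projection: its values
  \<open>k s\<close> at the idempotents have pairwise products 0 and sum 1, so exactly one of them
  is nonzero, and it is 1.\<close>

lemma points_eq_dual_basis:
  assumes pt: "\<And>s. s < d \<Longrightarrow> pt s \<in> points A"
    and dual: "\<And>s t. s < d \<Longrightarrow> t < d \<Longrightarrow> lin (e t) (pt s) = (if s = t then 1 else 0)"
    and dual': "\<And>i j. i < d \<Longrightarrow> j < d \<Longrightarrow> (\<Sum>s<d. e s i * pt s $ j) = (if i = j then 1 else 0)"
    and x: "x \<in> points A"
  obtains s where "s < d" "x = pt s"
proof -
  define k where "k s = lin (e s) x" for s
  have x_eq: "x $ j = (\<Sum>s<d. k s * pt s $ j)" if j: "j < d" for j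
  proof -
    have "(\<Sum>s<d. k s * pt s $ j) = (\<Sum>s<d. \<Sum>i<d. x $ i * (e s i * pt s $ j))"
      by (simp add: k_def sum_distribs mult_ac)
    also have "\<dots> = (\<Sum>i<d. \<Sum>s<d. x $ i * (e s i * pt s $ j))" by (rule sum.swap)
    also have "\<dots> = (\<Sum>i<d. x $ i * (if i = j then 1 else 0))"
      by (intro sum.cong refl) (simp add: dual' j sum_distrib_left[symmetric])
    also have "\<dots> = x $ j" using j by (simp add: mult_delta_right)
    finally show ?thesis by simp
  qed
  have lin_x: "lin a x = (\<Sum>s<d. k s * lin a (pt s))" for a
  proof -
    have "lin a x = (\<Sum>j<d. \<Sum>s<d. a j * (k s * pt s $ j))"
      by (intro sum.cong refl) (simp add: x_eq sum_distrib_left)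
    also have "\<dots> = (\<Sum>s<d. \<Sum>j<d. a j * (k s * pt s $ j))" by (rule sum.swap)
    finally show ?thesis by (simp add: sum_distrib_left mult_ac)
  qed
  \<comment> \<open>\<open>ab a b\<close> holds the coordinates of the product of the elements with
    coordinates \<open>a\<close> and \<open>b\<close>.\<close>
  define ab where "ab a b m = (\<Sum>i<d. \<Sum>j<d. a i * b j * c i j m)" for a b :: "nat \<Rightarrow> 'a alg_closure" and m
  have lin_mult: "lin a y * lin b y = lin (ab a b) y" if y: "y \<in> points A" for a b y
  proof -
    have "lin a y * lin b y = (\<Sum>i<d. \<Sum>j<d. a i * b j * (y $ i * y $ j))"
      by (simp add: sum_product mult_ac)
    also have "\<dots> = (\<Sum>i<d. \<Sum>j<d. \<Sum>m<d. a i * b j * c i j m * y $ m)"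
      by (intro sum.cong refl) (simp add: points_mul[OF y] sum_distrib_left mult_ac)
    also have "\<dots> = (\<Sum>m<d. \<Sum>i<d. \<Sum>j<d. a i * b j * c i j m * y $ m)" by (rule sum_swap3[symmetric])
    also have "\<dots> = lin (ab a b) y" by (simp add: ab_def sum_distrib_right)
    finally show ?thesis .
  qed
  have k_mult: "k s * k t = 0" if "s < d" "t < d" "s \<noteq> t" for s t
  proof -
    have "k s * k t = lin (ab (e s) (e t)) x" unfolding k_def by (rule lin_mult[OF x])
    also have "\<dots> = (\<Sum>w<d. k w * (lin (e s) (pt w) * lin (e t) (pt w)))"
      unfolding lin_x[of "ab (e s) (e t)"] by (intro sum.cong refl) (simp add: lin_mult pt)
    also have "\<dots> = 0" by (rule sum.neutral) (use that in \<open>auto simp: dual\<close>)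
    finally show ?thesis .
  qed
  have sum_k: "(\<Sum>s<d. k s) = 1"
  proof -
    have "(\<Sum>s<d. k s) = (\<Sum>s<d. k s * lin u (pt s))"
      by (intro sum.cong refl) (simp add: points_unt pt)
    also have "\<dots> = 1" unfolding lin_x[symmetric] by (rule points_unt[OF x])
    finally show ?thesis .
  qed
  then obtain s where s: "s < d" "k s \<noteq> 0" by (metis lessThan_iff sum.neutral zero_neq_one)
  have k0: "k t = 0" if "t < d" "t \<noteq> s" for t using k_mult[OF s(1) that(1)] that s(2) by simp
  then have "k s = 1"
    using sum_k s(1) sum.mono_neutral_right[of "{..<d}" "{s}" k] by auto
  have "x = pt s"
  proof (rule eq_vecI)
    fix j assume "j < dim_vec (pt s)"
    then have j: "j < d" using points_carrier_vec[OF pt[OF s(1)]] by simp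
    have "x $ j = (\<Sum>t<d. if t = s then pt t $ j else 0)"
      unfolding x_eq[OF j] by (rule sum.cong) (auto simp: k0 \<open>k s = 1\<close>)
    then show "x $ j = pt s $ j" using s(1) by simp
  qed (use points_carrier_vec[OF pt[OF s(1)]] points_carrier_vec[OF x] in simp)
  with s(1) show ?thesis by (rule that)
qed

lemma finite_points: "finite (points A)" and card_points: "card (points A) = d"
proof -
  obtain pt e where pe: "\<And>s. s < d \<Longrightarrow> pt s \<in> points A"
    "\<And>s t. s < d \<Longrightarrow> t < d \<Longrightarrow> lin (e t) (pt s) = (if s = t then 1 else 0)"
    "\<And>i j. i < d \<Longrightarrow> j < d \<Longrightarrow> (\<Sum>s<d. e s i * pt s $ j) = (if i = j then 1 else 0)"
    by (rule dual_basis) blast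
  have im: "points A = pt ` {..<d}"
    using pe(1) points_eq_dual_basis[of pt e, OF pe] by blast
  moreover have "inj_on pt {..<d}"
    by (rule inj_onI) (metis lessThan_iff pe(2) zero_neq_one)
  ultimately show "finite (points A)" "card (points A) = d" by (simp_all add: card_image)
qed

lemma point_group_comm_group: "comm_group (point_group A)"
proof (rule comm_groupI)
  let ?G = "point_group A"
  show "x \<star> y \<in> carrier ?G" if "x \<in> carrier ?G" "y \<in> carrier ?G" for x y
    using that pmult_points by (simp add: point_group_simps(1))
  show "\<one>\<^bsub>?G\<^esub> \<in> carrier ?G" using one_points by (simp add: point_group_simps(1))
  show "x \<star> y \<star> z = x \<star> (y \<star> z)" for x y z by (rule pmult_assoc)
  show "x \<star> y = y \<star> x" for x y by (rule pmult_comm)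
  show "\<one>\<^bsub>?G\<^esub> \<star> x = x" if "x \<in> carrier ?G" for x
    using that by (intro pmult_one points_carrier_vec) (simp add: point_group_simps(1))
  show "\<exists>y\<in>carrier ?G. y \<star> x = \<one>\<^bsub>?G\<^esub>" if "x \<in> carrier ?G" for x
  proof -
    have x: "x \<in> points A" using that by (simp add: point_group_simps(1))
    \<comment> \<open>An injective translation of a finite set is onto, so it reaches the identity;
      this gives an inverse that is a point without examining \<open>x \<circ> S\<close>.\<close>
    have "inj_on (\<lambda>y. x \<star> y) (points A)"
      by (rule inj_onI) (metis pmult_cancel points_carrier_vec x)
    then have "(\<lambda>y. x \<star> y) ` points A = points A"
      using pmult_points[OF x] by (intro endo_inj_surj finite_points) auto
    then obtain y where "y \<in> points A" "x \<star> y = \<one>\<^bsub>?G\<^esub>"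
      using one_points by (metis imageE)
    then show ?thesis using pmult_comm by (auto simp: point_group_simps(1))
  qed
qed

end

lemma on_points_index:
  assumes "M \<in> carrier_mat n m" "x \<in> carrier_vec m" "i < n"
  shows "on_points M x $ i = (\<Sum>j<m. to_ac (M $$ (i, j)) * x $ j)"
  using assms by (simp add: on_points_def scalar_prod_def atLeast0LessThan)

lemma on_points_carrier: "M \<in> carrier_mat n m \<Longrightarrow> on_points M x \<in> carrier_vec n"
  by (rule carrier_vecI) (simp add: on_points_def)

lemma hopf_hom_on_points:
  assumes M: "hopf_hom A B M" and x: "x \<in> points B"
  shows "on_points M x \<in> points A"
proof -
  let ?M = "\<lambda>i j. to_ac (M $$ (i, j))"
  have Mc: "M \<in> carrier_mat (rk A) (rk B)" using M by (simp add: hopf_hom_def)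
  have xc: "x \<in> carrier_vec (rk B)" using x by (rule points_carrier_vec)
  note idx = on_points_index[OF Mc xc]
  have mul: "(\<Sum>m<rk A. to_ac (mul A i j m) * ?M m p)
      = (\<Sum>s<rk B. \<Sum>t<rk B. ?M i s * ?M j t * to_ac (mul B s t p))"
    if "i < rk A" "j < rk A" "p < rk B" for i j p
  proof -
    have "(\<Sum>m<rk A. mul A i j m * M $$ (m, p))
        = (\<Sum>s<rk B. \<Sum>t<rk B. M $$ (i, s) * M $$ (j, t) * mul B s t p)"
      using M that by (simp add: hopf_hom_def)
    from arg_cong[OF this, of to_ac] show ?thesis by (simp add: to_ac_sum)
  qed
  have unt: "(\<Sum>m<rk A. to_ac (unt A m) * ?M m p) = to_ac (unt B p)" if "p < rk B" for p
  proof -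
    have "(\<Sum>m<rk A. unt A m * M $$ (m, p)) = unt B p" using M that by (simp add: hopf_hom_def)
    from arg_cong[OF this, of to_ac] show ?thesis by (simp add: to_ac_sum)
  qed
  have "on_points M x $ i * on_points M x $ j = (\<Sum>m<rk A. to_ac (mul A i j m) * on_points M x $ m)"
    if ij: "i < rk A" "j < rk A" for i j
  proof -
    have "on_points M x $ i * on_points M x $ j
        = (\<Sum>s<rk B. \<Sum>t<rk B. ?M i s * ?M j t * (x $ s * x $ t))"
      by (simp add: idx ij sum_product mult_ac)
    also have "\<dots> = (\<Sum>s<rk B. \<Sum>t<rk B. \<Sum>p<rk B. ?M i s * ?M j t * to_ac (mul B s t p) * x $ p)"
      using x by (intro sum.cong refl) (simp add: points_def sum_distrib_left mult_ac)
    also have "\<dots> = (\<Sum>p<rk B. \<Sum>s<rk B. \<Sum>t<rk B. ?M i s * ?M j t * to_ac (mul B s t p) * x $ p)"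
      by (rule sum_swap3[symmetric])
    also have "\<dots> = (\<Sum>p<rk B. \<Sum>m<rk A. to_ac (mul A i j m) * ?M m p * x $ p)"
      by (rule sum.cong[OF refl]) (simp add: sum_distrib_right[symmetric] mul ij)
    also have "\<dots> = (\<Sum>m<rk A. \<Sum>p<rk B. to_ac (mul A i j m) * ?M m p * x $ p)" by (rule sum.swap)
    also have "\<dots> = (\<Sum>m<rk A. to_ac (mul A i j m) * on_points M x $ m)"
      by (intro sum.cong refl) (simp add: idx sum_distrib_left mult_ac)
    finally show ?thesis .
  qed
  moreover have "(\<Sum>m<rk A. to_ac (unt A m) * on_points M x $ m) = 1"
  proof -
    have "(\<Sum>m<rk A. to_ac (unt A m) * on_points M x $ m)
        = (\<Sum>m<rk A. \<Sum>p<rk B. to_ac (unt A m) * ?M m p * x $ p)"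
      by (intro sum.cong refl) (simp add: idx sum_distrib_left mult_ac)
    also have "\<dots> = (\<Sum>p<rk B. \<Sum>m<rk A. to_ac (unt A m) * ?M m p * x $ p)" by (rule sum.swap)
    also have "\<dots> = (\<Sum>p<rk B. to_ac (unt B p) * x $ p)"
      by (intro sum.cong refl) (simp add: sum_distrib_right[symmetric] unt)
    also have "\<dots> = 1" using x by (simp add: points_def)
    finally show ?thesis .
  qed
  ultimately show ?thesis unfolding points_def using on_points_carrier[OF Mc] by blast
qed

lemma hopf_hom_on_points_mult:
  assumes M: "hopf_hom A B M" and x: "x \<in> carrier_vec (rk B)" and y: "y \<in> carrier_vec (rk B)"
  shows "on_points M (x \<otimes>\<^bsub>point_group B\<^esub> y) = on_points M x \<otimes>\<^bsub>point_group A\<^esub> on_points M y"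
proof (rule eq_vecI)
  let ?M = "\<lambda>i j. to_ac (M $$ (i, j))"
  let ?xy = "x \<otimes>\<^bsub>point_group B\<^esub> y"
  have Mc: "M \<in> carrier_mat (rk A) (rk B)" using M by (simp add: hopf_hom_def)
  have xyc: "?xy \<in> carrier_vec (rk B)" by (simp add: point_group_simps)
  fix m assume "m < dim_vec (on_points M x \<otimes>\<^bsub>point_group A\<^esub> on_points M y)"
  then have m: "m < rk A" by (simp add: point_group_simps)
  have comul: "(\<Sum>p<rk B. ?M m p * to_ac (comul B p s t))
      = (\<Sum>i<rk A. \<Sum>j<rk A. to_ac (comul A m i j) * ?M i s * ?M j t)"
    if "s < rk B" "t < rk B" for s t
  proof -
    have "(\<Sum>p<rk B. M $$ (m, p) * comul B p s t) =
        (\<Sum>i<rk A. \<Sum>j<rk A. comul A m i j * M $$ (i, s) * M $$ (j, t))"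
      using M m that by (simp add: hopf_hom_def)
    from arg_cong[OF this, of to_ac] show ?thesis by (simp add: to_ac_sum)
  qed
  let ?f = "\<lambda>s t i j. to_ac (comul A m i j) * ?M i s * ?M j t * (x $ s * y $ t)"
  have "on_points M ?xy $ m = (\<Sum>p<rk B. \<Sum>s<rk B. \<Sum>t<rk B. ?M m p * to_ac (comul B p s t) * (x $ s * y $ t))"
    unfolding on_points_index[OF Mc xyc m]
    by (intro sum.cong refl) (simp add: point_group_simps sum_distrib_left mult_ac)
  also have "\<dots> = (\<Sum>s<rk B. \<Sum>t<rk B. \<Sum>p<rk B. ?M m p * to_ac (comul B p s t) * (x $ s * y $ t))"
    by (rule sum_swap3)
  also have "\<dots> = (\<Sum>s<rk B. \<Sum>t<rk B. \<Sum>i<rk A. \<Sum>j<rk A. ?f s t i j)"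
    by (rule sum_cong2) (simp add: sum_distrib_right[symmetric] comul)
  also have "\<dots> = (\<Sum>s<rk B. \<Sum>i<rk A. \<Sum>j<rk A. \<Sum>t<rk B. ?f s t i j)"
    by (intro sum.cong refl sum_swap3)
  also have "\<dots> = (\<Sum>i<rk A. \<Sum>j<rk A. \<Sum>s<rk B. \<Sum>t<rk B. ?f s t i j)"
    by (rule sum_swap3)
  also have "\<dots> = (\<Sum>i<rk A. \<Sum>j<rk A. to_ac (comul A m i j) * (on_points M x $ i * on_points M y $ j))"
    by (rule sum_cong2, simp only: on_points_index[OF Mc x] on_points_index[OF Mc y] sum_product,
        simp only: sum_distrib_left) (simp only: mult_ac)
  also have "\<dots> = (on_points M x \<otimes>\<^bsub>point_group A\<^esub> on_points M y) $ m"
    using m by (simp add: point_group_simps)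
  finally show "on_points M ?xy $ m = (on_points M x \<otimes>\<^bsub>point_group A\<^esub> on_points M y) $ m" .
qed (use M in \<open>auto simp: hopf_hom_def on_points_def point_group_simps\<close>)

lemma hopf_hom_hom:
  assumes "hopf_hom A B M"
  shows "on_points M \<in> hom (point_group B) (point_group A)"
  using assms by (auto simp: hom_def point_group_simps(1) hopf_hom_on_points hopf_hom_on_points_mult
      points_carrier_vec)

subsection \<open>Frobenius on points\<close>

definition frob_vec :: "nat \<Rightarrow> 'k::{finite,field} alg_closure vec \<Rightarrow> 'k alg_closure vec" where
  "frob_vec a x = map_vec (\<lambda>c. c ^ (CARD('k) ^ a)) x"

lemma frob_vec_index: "i < dim_vec x \<Longrightarrow> frob_vec a x $ i = (x :: 'k::{finite,field} alg_closure vec) $ i ^ (CARD('k) ^ a)"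
  by (simp add: frob_vec_def)

lemma dim_frob_vec [simp]: "dim_vec (frob_vec a x) = dim_vec x"
  by (simp add: frob_vec_def)

lemma frob_vec_inject: "frob_vec a x = frob_vec a y \<Longrightarrow> x = y"
  by (metis ac_power_inject dim_frob_vec eq_vecI frob_vec_index)

text \<open>The structure constants lie in \<open>k\<close>, so they are fixed by the power map,
  which is additive; hence it preserves the equations that define the points.\<close>

lemma frob_vec_points:
  fixes x :: "'k::{finite,field} alg_closure vec"
  assumes x: "x \<in> points A"
  shows "frob_vec a x \<in> points A"
proof -
  let ?q = "CARD('k) ^ a"
  have dim: "dim_vec x = rk A" using x by (simp add: points_def)
  have idx: "frob_vec a x $ i = x $ i ^ ?q" if "i < rk A" for i using that dim by (simp add: frob_vec_index)
  have "frob_vec a x $ i * frob_vec a x $ j = (\<Sum>m<rk A. to_ac (mul A i j m) * frob_vec a x $ m)"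
    if "i < rk A" "j < rk A" for i j
  proof -
    have "(x $ i * x $ j) ^ ?q = (\<Sum>m<rk A. to_ac (mul A i j m) * x $ m) ^ ?q"
      using x that by (simp add: points_def)
    then show ?thesis using that by (simp add: idx ac_power_sum power_mult_distrib to_ac_power_card)
  qed
  moreover have "(\<Sum>m<rk A. to_ac (unt A m) * frob_vec a x $ m) = 1"
  proof -
    have "(\<Sum>m<rk A. to_ac (unt A m) * x $ m) ^ ?q = 1" using x by (simp add: points_def)
    then show ?thesis by (simp add: idx ac_power_sum power_mult_distrib to_ac_power_card)
  qed
  moreover have "frob_vec a x \<in> carrier_vec (rk A)" using dim by (intro carrier_vecI) simp
  ultimately show ?thesis unfolding points_def by blast
qed

lemma frob_vec_pmult:
  assumes "x \<in> carrier_vec (rk A)" "y \<in> carrier_vec (rk A)"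
  shows "frob_vec a (x \<otimes>\<^bsub>point_group A\<^esub> y) = frob_vec a x \<otimes>\<^bsub>point_group A\<^esub> frob_vec a y"
  using assms
  by (intro eq_vecI)
    (simp_all add: point_group_simps frob_vec_index ac_power_sum power_mult_distrib to_ac_power_card)

lemma frob_vec_on_points:
  assumes "M \<in> carrier_mat n m" "x \<in> carrier_vec m"
  shows "frob_vec a (on_points M x) = on_points M (frob_vec a x)"
proof (rule eq_vecI)
  have fx: "frob_vec a x \<in> carrier_vec m" using assms by (simp add: frob_vec_def)
  fix i assume "i < dim_vec (on_points M (frob_vec a x))"
  then have i: "i < n" using assms by (simp add: on_points_def)
  show "frob_vec a (on_points M x) $ i = on_points M (frob_vec a x) $ i"
    using assms i fx
    by (simp add: on_points_index[OF assms(1)] frob_vec_index ac_power_sum power_mult_distrib to_ac_power_card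
        carrier_vecD[OF on_points_carrier[OF assms(1)]])
qed (simp add: on_points_def)

lemma frob_vec_add: "frob_vec a (frob_vec b x) = frob_vec (a + b) x"
  by (rule eq_vecI) (simp_all add: frob_vec_index power_add power_mult[symmetric] mult.commute)

lemma frob_vec_0 [simp]: "frob_vec 0 x = x"
  by (rule eq_vecI) (simp_all add: frob_vec_index)

text \<open>
  Over a finite field, a homomorphism on geometric points is defined over the base field as soon as
  it commutes with Frobenius: its matrix with respect to the dual basis is then fixed by Frobenius.
\<close>

lemma hopf_hom_of_frob_equivariant:
  fixes A B :: "'k::{finite,field} hopf"
  assumes A: "comm_hopf_algebra A" "etale A" and B: "comm_hopf_algebra B" "etale B"
    and f: "f \<in> hom (point_group B) (point_group A)"
    and F: "\<And>x. x \<in> points B \<Longrightarrow> f (frob_vec 1 x) = frob_vec 1 (f x)"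
  obtains M where "hopf_hom A B M" "\<And>x. x \<in> points B \<Longrightarrow> f x = on_points M x"
proof -
  interpret A: etale_hopf A using A by unfold_locales
  interpret B: etale_hopf B using B by unfold_locales
  have fp: "f x \<in> points A" if "x \<in> points B" for x
    using f that by (auto simp: hom_def point_group_simps(1))
  obtain pt e where pe: "\<And>s. s < rk B \<Longrightarrow> pt s \<in> points B"
    "\<And>s t. s < rk B \<Longrightarrow> t < rk B \<Longrightarrow> B.lin (e t) (pt s) = (if s = t then 1 else 0)"
    "\<And>i j. i < rk B \<Longrightarrow> j < rk B \<Longrightarrow> (\<Sum>s<rk B. e s i * pt s $ j) = (if i = j then 1 else 0)"
    by (rule B.dual_basis) blast
  \<comment> \<open>The matrix over the closure that sends each \<open>pt s\<close> to
    \<open>f (pt s)\<close>, because the \<open>e s\<close> are dual to the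
    \<open>pt s\<close>.\<close>
  define N where "N i j = (\<Sum>s<rk B. f (pt s) $ i * e s j)" for i j
  have Nx: "f x $ i = (\<Sum>j<rk B. N i j * x $ j)" if x: "x \<in> points B" for x i
  proof -
    obtain t where t: "t < rk B" "x = pt t" by (rule B.points_eq_dual_basis[of pt e, OF pe x])
    have "(\<Sum>j<rk B. N i j * x $ j) = (\<Sum>j<rk B. \<Sum>s<rk B. f (pt s) $ i * (e s j * pt t $ j))"
      unfolding N_def t(2) by (simp add: sum_distribs mult_ac)
    also have "\<dots> = (\<Sum>s<rk B. \<Sum>j<rk B. f (pt s) $ i * (e s j * pt t $ j))" by (rule sum.swap)
    also have "\<dots> = (\<Sum>s<rk B. f (pt s) $ i * (if t = s then 1 else 0))"
      by (intro sum.cong refl) (simp add: sum_distrib_left[symmetric] pe(2) t(1))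
    also have "\<dots> = f x $ i" using t by (simp add: mult_delta_right)
    finally show ?thesis by simp
  qed
  have surj: "frob_vec 1 ` points B = points B"
    by (rule endo_inj_surj[OF B.finite_points]) (auto intro: frob_vec_points inj_onI frob_vec_inject)
  have "N i j ^ CARD('k) = N i j" if ij: "i < rk A" "j < rk B" for i j
  proof -
    have "N i j ^ CARD('k) - N i j = 0"
    \<comment> \<open>Row \<open>i\<close> of \<open>N\<close> and its entrywise power agree at
      every point, because every point is the Frobenius image of a point and \<open>f\<close>
      commutes with Frobenius.\<close>
    proof (rule B.points_separate[where v = "\<lambda>j. N i j ^ CARD('k) - N i j", OF _ ij(2)])
      fix y assume "y \<in> points B"
      then obtain x where x: "x \<in> points B" "y = frob_vec 1 x" using surj by (metis imageE)
      have yj: "y $ j = x $ j ^ CARD('k)" if "j < rk B" for j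
        using that points_carrier_vec[OF x(1)] by (simp add: x(2) frob_vec_index)
      have "(\<Sum>j<rk B. N i j * y $ j) = f (frob_vec 1 x) $ i"
        using Nx[OF frob_vec_points[OF x(1)]] by (simp add: x(2))
      also have "\<dots> = (f x $ i) ^ (CARD('k) ^ 1)"
        unfolding F[OF x(1)]
        by (rule frob_vec_index) (use ij(1) points_carrier_vec[OF fp[OF x(1)]] in simp)
      also have "\<dots> = (\<Sum>j<rk B. N i j ^ CARD('k) * y $ j)"
        unfolding Nx[OF x(1)] ac_power_sum by (simp add: power_mult_distrib yj)
      finally show "(\<Sum>j<rk B. (N i j ^ CARD('k) - N i j) * y $ j) = 0"
        by (simp add: left_diff_distrib sum_subtractf)
    qed
    then show ?thesis by simp
  qed
  then have "\<forall>i j. \<exists>z. i < rk A \<longrightarrow> j < rk B \<longrightarrow> N i j = to_ac z"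
    by (metis power_card_eq_self_iff rangeE)
  then obtain z where z: "\<And>i j. i < rk A \<Longrightarrow> j < rk B \<Longrightarrow> N i j = to_ac (z i j)" by metis
  define M where "M = mat (rk A) (rk B) (\<lambda>(i, j). z i j)"
  have Mc: "M \<in> carrier_mat (rk A) (rk B)" by (simp add: M_def)
  have MN: "to_ac (M $$ (i, j)) = N i j" if "i < rk A" "j < rk B" for i j
    using that by (simp add: M_def z)
  have fM: "f x = on_points M x" if x: "x \<in> points B" for x
  proof (rule eq_vecI)
    show "dim_vec (f x) = dim_vec (on_points M x)"
      using points_carrier_vec[OF fp[OF x]] Mc by (simp add: on_points_def)
    fix i assume "i < dim_vec (on_points M x)"
    then have i: "i < rk A" using Mc by (simp add: on_points_def)
    show "f x $ i = on_points M x $ i"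
      unfolding on_points_index[OF Mc points_carrier_vec[OF x] i] Nx[OF x] by (simp add: MN i)
  qed
  have idx: "(\<Sum>j<rk B. N i j * x $ j) = f x $ i" if "x \<in> points B" for i x
    using Nx that by simp
  have "(\<Sum>m<rk A. mul A i j m * M $$ (m, p)) = (\<Sum>s<rk B. \<Sum>t<rk B. M $$ (i, s) * M $$ (j, t) * mul B s t p)"
    if ij: "i < rk A" "j < rk A" and p: "p < rk B" for i j p
  proof -
    \<comment> \<open>The difference of both sides, as an element of the algebra of \<open>B\<close>
      over the closure, vanishes at all points because \<open>f x\<close> is a point of
      \<open>A\<close>.\<close>
    let ?v = "\<lambda>p. (\<Sum>m<rk A. A.c i j m * N m p) - (\<Sum>s<rk B. \<Sum>t<rk B. N i s * N j t * B.c s t p)"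
    have "?v p = 0"
    proof (rule B.points_separate[where v = ?v, OF _ p])
      fix x assume x: "x \<in> points B"
      have "(\<Sum>p<rk B. (\<Sum>m<rk A. A.c i j m * N m p) * x $ p)
          = (\<Sum>p<rk B. \<Sum>m<rk A. A.c i j m * (N m p * x $ p))"
        by (simp add: sum_distribs mult_ac)
      also have "\<dots> = (\<Sum>m<rk A. \<Sum>p<rk B. A.c i j m * (N m p * x $ p))" by (rule sum.swap)
      also have "\<dots> = (\<Sum>m<rk A. A.c i j m * f x $ m)" by (simp add: sum_distrib_left[symmetric] idx x)
      also have "\<dots> = f x $ i * f x $ j" using A.points_mul[OF fp[OF x] ij] by simp
      also have "\<dots> = (\<Sum>s<rk B. \<Sum>t<rk B. N i s * N j t * (x $ s * x $ t))"
        unfolding Nx[OF x] by (simp add: sum_product mult_ac)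
      also have "\<dots> = (\<Sum>s<rk B. \<Sum>t<rk B. \<Sum>p<rk B. N i s * N j t * B.c s t p * x $ p)"
        by (intro sum.cong refl) (simp add: B.points_mul[OF x] sum_distrib_left mult_ac)
      also have "\<dots> = (\<Sum>p<rk B. \<Sum>s<rk B. \<Sum>t<rk B. N i s * N j t * B.c s t p * x $ p)"
        by (rule sum_swap3[symmetric])
      also have "\<dots> = (\<Sum>p<rk B. (\<Sum>s<rk B. \<Sum>t<rk B. N i s * N j t * B.c s t p) * x $ p)"
        by (simp add: sum_distrib_right)
      finally show "B.lin ?v x = 0" by (simp add: left_diff_distrib sum_subtractf)
    qed
    then have "to_ac (\<Sum>m<rk A. mul A i j m * M $$ (m, p))
        = to_ac (\<Sum>s<rk B. \<Sum>t<rk B. M $$ (i, s) * M $$ (j, t) * mul B s t p)"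
      using ij p by (simp add: to_ac_sum MN)
    then show ?thesis by simp
  qed
  moreover have "(\<Sum>m<rk A. unt A m * M $$ (m, p)) = unt B p" if p: "p < rk B" for p
  proof -
    let ?v = "\<lambda>p. (\<Sum>m<rk A. A.u m * N m p) - B.u p"
    have "?v p = 0"
    proof (rule B.points_separate[where v = ?v, OF _ p])
      fix x assume x: "x \<in> points B"
      have "(\<Sum>p<rk B. (\<Sum>m<rk A. A.u m * N m p) * x $ p)
          = (\<Sum>p<rk B. \<Sum>m<rk A. A.u m * (N m p * x $ p))"
        by (simp add: sum_distribs mult_ac)
      also have "\<dots> = (\<Sum>m<rk A. \<Sum>p<rk B. A.u m * (N m p * x $ p))" by (rule sum.swap)
      also have "\<dots> = (\<Sum>m<rk A. A.u m * f x $ m)" by (simp add: sum_distrib_left[symmetric] idx x)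
      also have "\<dots> = (\<Sum>p<rk B. B.u p * x $ p)"
        by (simp add: A.points_unt[OF fp[OF x]] B.points_unt[OF x])
      finally show "B.lin ?v x = 0" by (simp add: left_diff_distrib sum_subtractf)
    qed
    then have "to_ac (\<Sum>m<rk A. unt A m * M $$ (m, p)) = to_ac (unt B p)"
      using p by (simp add: to_ac_sum MN)
    then show ?thesis by simp
  qed
  moreover have "(\<Sum>p<rk B. M $$ (m, p) * comul B p s t) =
      (\<Sum>i<rk A. \<Sum>j<rk A. comul A m i j * M $$ (i, s) * M $$ (j, t))"
    if m: "m < rk A" and s: "s < rk B" and t: "t < rk B" for m s t
  proof -
    \<comment> \<open>Compatibility with comultiplication is an identity in a tensor square, so
      points are separated twice, once for each index. On a pair of points it is the
      multiplicativity of \<open>f\<close>.\<close>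
    let ?w = "\<lambda>s t. (\<Sum>p<rk B. N m p * B.\<delta> p s t) - (\<Sum>i<rk A. \<Sum>j<rk A. A.\<delta> m i j * N i s * N j t)"
    have "B.lin (\<lambda>t. B.lin (\<lambda>s. ?w s t) x) y = 0" if x: "x \<in> points B" and y: "y \<in> points B" for x y
    proof -
      let ?f = "\<lambda>s t i j. A.\<delta> m i j * N i s * N j t * (x $ s * y $ t)"
        and ?g = "\<lambda>s t p. N m p * (B.\<delta> p s t * (x $ s * y $ t))"
      have "(\<Sum>t<rk B. (\<Sum>s<rk B. (\<Sum>p<rk B. N m p * B.\<delta> p s t) * x $ s) * y $ t)
          = (\<Sum>t<rk B. \<Sum>s<rk B. \<Sum>p<rk B. ?g s t p)"
        by (simp add: sum_distribs mult_ac)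
      also have "\<dots> = (\<Sum>s<rk B. \<Sum>t<rk B. \<Sum>p<rk B. ?g s t p)"
        by (rule sum.swap)
      also have "\<dots> = (\<Sum>p<rk B. \<Sum>s<rk B. \<Sum>t<rk B. ?g s t p)"
        by (rule sum_swap3[symmetric])
      also have "\<dots> = f (x \<otimes>\<^bsub>point_group B\<^esub> y) $ m"
        unfolding Nx[OF B.pmult_points[OF x y]]
        by (intro sum.cong refl) (simp add: B.pmult_index sum_distrib_left)
      also have "\<dots> = (f x \<otimes>\<^bsub>point_group A\<^esub> f y) $ m"
        using hom_mult[OF f] x y by (simp add: point_group_simps(1))
      also have "\<dots> = (\<Sum>i<rk A. \<Sum>j<rk A. \<Sum>s<rk B. \<Sum>t<rk B. ?f s t i j)"
        unfolding A.pmult_index[OF m] Nx[OF x] Nx[OF y]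
        by (rule sum_cong2, simp only: sum_product, simp only: sum_distrib_left) (simp only: mult_ac)
      also have "\<dots> = (\<Sum>s<rk B. \<Sum>i<rk A. \<Sum>j<rk A. \<Sum>t<rk B. ?f s t i j)"
        by (rule sum_swap3[symmetric])
      also have "\<dots> = (\<Sum>s<rk B. \<Sum>t<rk B. \<Sum>i<rk A. \<Sum>j<rk A. ?f s t i j)"
        by (intro sum.cong refl sum_swap3[symmetric])
      also have "\<dots> = (\<Sum>t<rk B. \<Sum>s<rk B. \<Sum>i<rk A. \<Sum>j<rk A. ?f s t i j)"
        by (rule sum.swap)
      also have "\<dots> = (\<Sum>t<rk B. (\<Sum>s<rk B. (\<Sum>i<rk A. \<Sum>j<rk A. A.\<delta> m i j * N i s * N j t) * x $ s) * y $ t)"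
        by (simp add: sum_distribs mult_ac)
      finally show ?thesis by (simp add: left_diff_distrib sum_subtractf)
    qed
    then have "B.lin (\<lambda>s. ?w s t) x = 0" if "x \<in> points B" for x
      using B.points_separate[where v = "\<lambda>t. B.lin (\<lambda>s. ?w s t) x", OF _ t] that by blast
    then have "?w s t = 0" using B.points_separate[where v = "\<lambda>s. ?w s t", OF _ s] by blast
    then have "to_ac (\<Sum>p<rk B. M $$ (m, p) * comul B p s t) =
        to_ac (\<Sum>i<rk A. \<Sum>j<rk A. comul A m i j * M $$ (i, s) * M $$ (j, t))"
      using m s t by (simp add: to_ac_sum MN)
    then show ?thesis by simp
  qed
  ultimately have "hopf_hom A B M" unfolding hopf_hom_def using Mc by blast
  then show ?thesis using fM by (rule that)
qed

section \<open>Geometric points of an etale l-divisible group\<close>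

locale etale_l_divisible_group =
  fixes G :: "'k::{finite,field} ind_group" and L :: "'l::prime_card itself"
  assumes etale_l_divisible: "etale_l_divisible CARD('l) G"
begin

abbreviation "P n \<equiv> points (level G n)"
abbreviation "pg n \<equiv> point_group (level G n)"
abbreviation "tr \<equiv> transition G"

lemma level:
  shows level_hopf: "comm_hopf_algebra (level G n)" and level_etale: "etale (level G n)"
    and level_rk: "rk (level G n) = CARD('l) ^ (n * height G)"
    and inc_hom: "hopf_hom (level G (Suc n)) (level G n) (inc G n)"
    and inc_inj: "inj_on (on_points (inc G n)) (P n)"
    and inc_image: "on_points (inc G n) ` P n =
       {x \<in> P (Suc n). x [^]\<^bsub>pg (Suc n)\<^esub> (CARD('l) ^ n) = \<one>\<^bsub>pg (Suc n)\<^esub>}"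
  using etale_l_divisible unfolding etale_l_divisible_def by blast+

sublocale lv: etale_hopf "level G n" for n
  by unfold_locales (rule level_hopf level_etale)+

lemma pg_comm_group: "comm_group (pg n)" by (rule lv.point_group_comm_group)

lemma pg_group: "group (pg n)" using pg_comm_group by (rule comm_group.axioms(2))

lemma carrier_pg: "carrier (pg n) = P n" by (simp add: point_group_simps)

lemma tr_points: "x \<in> P n \<Longrightarrow> tr n e x \<in> P (n + e)"
  by (induction e) (auto intro: hopf_hom_on_points[OF inc_hom])

lemma tr_hom: "tr n e \<in> hom (pg n) (pg (n + e))"
proof (induction e)
  case (Suc e)
  have "on_points (inc G (n + e)) \<circ> tr n e \<in> hom (pg n) (pg (Suc (n + e)))"
    using Suc hopf_hom_hom[OF inc_hom] by (rule hom_compose)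
  then show ?case by (simp add: comp_def)
qed (simp add: hom_def)

lemma tr_mult:
  "x \<in> P n \<Longrightarrow> y \<in> P n \<Longrightarrow> tr n e (x \<otimes>\<^bsub>pg n\<^esub> y) = tr n e x \<otimes>\<^bsub>pg (n + e)\<^esub> tr n e y"
  using hom_mult[OF tr_hom] by (simp add: carrier_pg)

lemma tr_inj: "x \<in> P n \<Longrightarrow> y \<in> P n \<Longrightarrow> tr n e x = tr n e y \<Longrightarrow> x = y"
proof (induction e)
  case (Suc e)
  then show ?case using inj_onD[OF inc_inj] tr_points by (metis transition.simps(2))
qed simp

lemma tr_add: "tr (n + e) e' (tr n e x) = tr n (e + e') x"
  by (induction e') (simp_all add: add.assoc)

lemma tr_frob_vec: "x \<in> P n \<Longrightarrow> tr n e (frob_vec a x) = frob_vec a (tr n e x)"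
proof (induction e)
  case (Suc e)
  have "tr n e x \<in> carrier_vec (rk (level G (n + e)))"
    using tr_points[OF Suc.prems] by (rule points_carrier_vec)
  moreover have "inc G (n + e) \<in> carrier_mat (rk (level G (Suc (n + e)))) (rk (level G (n + e)))"
    using inc_hom by (simp add: hopf_hom_def)
  ultimately show ?case using Suc by (simp add: frob_vec_on_points)
qed simp

section \<open>The colimit group of germs\<close>

lemma mem_germ: "(m, y) \<in> germ G n x \<longleftrightarrow> y \<in> P m \<and> (\<exists>e e'. n + e = m + e' \<and> tr n e x = tr m e' y)"
  by (simp add: germ_def)

text \<open>Membership in a germ provides one common level only; injectivity of the transition maps
  yields the equality at every common level.\<close>

lemma mem_germD:
  assumes y: "(m, y) \<in> germ G n x" and x: "x \<in> P n" and e: "n + e = m + e'"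
  shows "tr n e x = tr m e' y"
proof -
  obtain e0 e0' where e0: "n + e0 = m + e0'" "tr n e0 x = tr m e0' y" and yP: "y \<in> P m"
    using y by (auto simp: mem_germ)
  show ?thesis
  proof (cases "e0 \<le> e")
    case True
    then have "e = e0 + (e - e0)" "e' = e0' + (e - e0)" using e e0(1) by linarith+
    then obtain k where k: "e = e0 + k" "e' = e0' + k" by blast
    have "tr n e x = tr (m + e0') k (tr n e0 x)" unfolding e0(1)[symmetric] tr_add k(1) ..
    then show ?thesis unfolding e0(2) tr_add k(2) .
  next
    case False
    then have "e0 = e + (e0 - e)" "e0' = e' + (e0 - e)" using e e0(1) by linarith+
    then obtain k where k: "e0 = e + k" "e0' = e' + k" by blast
    have "tr (n + e) k (tr n e x) = tr (n + e) k (tr m e' y)"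
      using e0(2) unfolding k tr_add unfolding e tr_add .
    moreover have "tr n e x \<in> P (n + e)" "tr m e' y \<in> P (n + e)"
      using tr_points[OF x, of e] tr_points[OF yP, of e'] e by simp_all
    ultimately show ?thesis by (metis tr_inj)
  qed
qed

lemma germ_eqI:
  assumes x: "x \<in> P n" and y: "y \<in> P m" and e: "n + e = m + e'" "tr n e x = tr m e' y"
  shows "germ G n x = germ G m y"
proof -
  have sub: "germ G n x \<subseteq> germ G m y"
    if x: "x \<in> P n" and y: "y \<in> P m" and e: "n + e = m + e'" "tr n e x = tr m e' y"
    for n m e e' x y
  proof (rule subsetI, clarify)
    fix \<kappa> z assume z: "(\<kappa>, z) \<in> germ G n x"
    have "tr n (e + \<kappa>) x = tr \<kappa> (n + e) z"
      by (rule mem_germD[OF z x]) simp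
    moreover have "tr n (e + \<kappa>) x = tr m (e' + \<kappa>) y"
      unfolding tr_add[symmetric] e(2) unfolding e(1) ..
    ultimately show "(\<kappa>, z) \<in> germ G m y"
      using z e(1) unfolding mem_germ
      by (intro conjI exI[of _ "e' + \<kappa>"] exI[of _ "n + e"]) auto
  qed
  show ?thesis using sub[OF x y e] sub[OF y x e(1)[symmetric] e(2)[symmetric]] by blast
qed

lemma germ_self: "x \<in> P n \<Longrightarrow> (n, x) \<in> germ G n x"
  by (auto simp: mem_germ)

lemma germ_inj: "x \<in> P n \<Longrightarrow> y \<in> P n \<Longrightarrow> germ G n x = germ G n y \<Longrightarrow> x = y"
  using mem_germD[of n y n x 0 0] germ_self[of y n] by simp

lemma germ_tr: "x \<in> P n \<Longrightarrow> germ G (n + e) (tr n e x) = germ G n x"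
  by (rule germ_eqI[of _ _ _ _ 0 e]) (auto intro: tr_points)

lemma carrier_geom: "carrier (geom G) = pts G UNIV" by (simp add: pt_group_def)

abbreviation "A \<equiv> carrier (geom G)"
abbreviation "F \<equiv> frob G CARD('k)"
abbreviation gmult (infixl "\<odot>" 70) where "\<xi> \<odot> \<eta> \<equiv> \<xi> \<otimes>\<^bsub>geom G\<^esub> \<eta>"

lemma germ_memI: "x \<in> P n \<Longrightarrow> germ G n x \<in> A"
  by (auto simp: pt_group_def pts_def)

lemma geom_cases:
  assumes "\<xi> \<in> A"
  obtains n x where "x \<in> P n" "\<xi> = germ G n x"
  using assms by (auto simp: pt_group_def pts_def)

lemma geom_cases_ge:
  assumes "\<xi> \<in> A"
  obtains e x where "x \<in> P (n + e)" "\<xi> = germ G (n + e) x"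
proof -
  obtain m x where x: "x \<in> P m" "\<xi> = germ G m x" by (rule geom_cases[OF assms])
  have "tr m n x \<in> P (n + m)" "\<xi> = germ G (n + m) (tr m n x)"
    using tr_points[OF x(1), of n] germ_tr[OF x(1), of n] x(2) by (simp_all add: add.commute)
  then show ?thesis by (rule that)
qed

lemma geom_cases2:
  assumes "\<xi> \<in> A" "\<eta> \<in> A"
  obtains n x y where "x \<in> P n" "\<xi> = germ G n x" "y \<in> P n" "\<eta> = germ G n y"
proof -
  obtain m x where x: "x \<in> P m" "\<xi> = germ G m x" by (rule geom_cases[OF assms(1)])
  obtain e y where y: "y \<in> P (m + e)" "\<eta> = germ G (m + e) y" by (rule geom_cases_ge[OF assms(2)])
  show ?thesis by (rule that[of "tr m e x" "m + e" y]) (simp_all add: x y tr_points germ_tr)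
qed

lemma Union_singleton_eq: "S \<noteq> {} \<Longrightarrow> (\<And>s. s \<in> S \<Longrightarrow> s = c) \<Longrightarrow> \<Union> S = c"
  by blast

text \<open>All pairs of representatives on a common level have products with the same germ, so the
  union in \<open>pt_group\<close> is over a single set. The field \<open>K\<close> affects only the
  carrier.\<close>

lemma germ_mult:
  assumes x: "x \<in> P n" and y: "y \<in> P n"
  shows "germ G n x \<otimes>\<^bsub>pt_group G K\<^esub> germ G n y = germ G n (x \<otimes>\<^bsub>pg n\<^esub> y)"
proof -
  have "germ G m (x' \<otimes>\<^bsub>pg m\<^esub> y') = germ G n (x \<otimes>\<^bsub>pg n\<^esub> y)"
    if x': "(m, x') \<in> germ G n x" and y': "(m, y') \<in> germ G n y" for m x' y'
  proof (rule germ_eqI[of _ _ _ _ n m])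
    have P': "x' \<in> P m" "y' \<in> P m" using x' y' by (auto simp: mem_germ)
    show "x' \<otimes>\<^bsub>pg m\<^esub> y' \<in> P m" "x \<otimes>\<^bsub>pg n\<^esub> y \<in> P n" using P' x y by (auto intro: lv.pmult_points)
    have "tr n m x = tr m n x'" "tr n m y = tr m n y'"
      using mem_germD[OF x' x] mem_germD[OF y' y] by simp_all
    then show "tr m n (x' \<otimes>\<^bsub>pg m\<^esub> y') = tr n m (x \<otimes>\<^bsub>pg n\<^esub> y)"
      using x y P' by (simp add: tr_mult add.commute)
  qed simp
  then have "s = germ G n (x \<otimes>\<^bsub>pg n\<^esub> y)"
    if "s \<in> {germ G m (x' \<otimes>\<^bsub>pg m\<^esub> y') | m x' y'. (m, x') \<in> germ G n x \<and> (m, y') \<in> germ G n y}" for s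
    using that by blast
  moreover have "{germ G m (x' \<otimes>\<^bsub>pg m\<^esub> y') | m x' y'. (m, x') \<in> germ G n x \<and> (m, y') \<in> germ G n y} \<noteq> {}"
    using germ_self[OF x] germ_self[OF y] by blast
  ultimately have "\<Union> {germ G m (x' \<otimes>\<^bsub>pg m\<^esub> y') | m x' y'. (m, x') \<in> germ G n x \<and> (m, y') \<in> germ G n y}
      = germ G n (x \<otimes>\<^bsub>pg n\<^esub> y)" by (rule Union_singleton_eq[rotated])
  then show ?thesis by (simp add: pt_group_def)
qed

lemma germ_one: "germ G n \<one>\<^bsub>pg n\<^esub> = \<one>\<^bsub>pt_group G K\<^esub>"
proof -
  have "tr 0 n \<one>\<^bsub>pg 0\<^esub> = \<one>\<^bsub>pg (0 + n)\<^esub>" by (rule hom_one[OF tr_hom pg_group pg_group])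
  then show ?thesis using germ_tr[OF lv.one_points, of 0 n] by (simp add: pt_group_def)
qed

lemma geom_comm_group: "comm_group (geom G)"
proof (rule comm_groupI)
  fix \<xi> \<eta> \<zeta> assume \<xi>: "\<xi> \<in> A" and \<eta>: "\<eta> \<in> A"
  obtain n x y where *: "x \<in> P n" "\<xi> = germ G n x" "y \<in> P n" "\<eta> = germ G n y"
    by (rule geom_cases2[OF \<xi> \<eta>])
  then show "\<xi> \<odot> \<eta> \<in> A"
    by (simp add: germ_mult germ_memI lv.pmult_points)
  show "\<xi> \<odot> \<eta> = \<eta> \<odot> \<xi>"
    using * by (simp add: germ_mult lv.pmult_comm[of _ x y])
  show "\<one>\<^bsub>geom G\<^esub> \<odot> \<xi> = \<xi>"
    using * by (simp add: germ_one[of n, symmetric] germ_mult lv.one_points lv.pmult_one points_carrier_vec)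
  show "\<exists>\<eta>\<in>A. \<eta> \<odot> \<xi> = \<one>\<^bsub>geom G\<^esub>"
  proof
    have i: "inv\<^bsub>pg n\<^esub> x \<in> P n" "inv\<^bsub>pg n\<^esub> x \<otimes>\<^bsub>pg n\<^esub> x = \<one>\<^bsub>pg n\<^esub>"
      using *(1) group.inv_closed[OF pg_group] group.l_inv[OF pg_group] by (simp_all add: carrier_pg)
    then show "germ G n (inv\<^bsub>pg n\<^esub> x) \<odot> \<xi> = \<one>\<^bsub>geom G\<^esub>"
      using * by (simp add: germ_mult germ_one)
    show "germ G n (inv\<^bsub>pg n\<^esub> x) \<in> A" using i by (rule_tac germ_memI)
  qed
  assume "\<zeta> \<in> A"
  then obtain e z where z: "z \<in> P (n + e)" "\<zeta> = germ G (n + e) z" by (rule geom_cases_ge)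
  have **: "\<xi> = germ G (n + e) (tr n e x)" "\<eta> = germ G (n + e) (tr n e y)"
    "tr n e x \<in> P (n + e)" "tr n e y \<in> P (n + e)" using * by (simp_all add: germ_tr tr_points)
  show "\<xi> \<odot> \<eta> \<odot> \<zeta> = \<xi> \<odot> (\<eta> \<odot> \<zeta>)"
    unfolding z(2) **(1,2) using z(1) **(3,4)
    by (simp add: germ_mult lv.pmult_points lv.pmult_assoc)
next
  show "\<one>\<^bsub>geom G\<^esub> \<in> A" 
    by (subst germ_one[of 0, symmetric]) (rule germ_memI[OF lv.one_points])
qed

lemma germ_hom: "germ G n \<in> hom (pg n) (geom G)"
  by (auto simp: hom_def carrier_pg germ_memI germ_mult)

lemma geom_group: "group (geom G)" using geom_comm_group by (rule comm_group.axioms(2))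

lemma germ_pow: "x \<in> P n \<Longrightarrow> germ G n x [^]\<^bsub>geom G\<^esub> (j::nat) = germ G n (x [^]\<^bsub>pg n\<^esub> j)"
  using hom_nat_pow[OF germ_hom _ pg_group geom_group] by (simp add: carrier_pg)

lemma pg_pow_closed: "x \<in> P n \<Longrightarrow> x [^]\<^bsub>pg n\<^esub> (j::nat) \<in> P n"
  using monoid.nat_pow_closed[OF group.is_monoid[OF pg_group]] by (simp add: carrier_pg)

lemma tr_pow: "x \<in> P n \<Longrightarrow> tr n e (x [^]\<^bsub>pg n\<^esub> (j::nat)) = tr n e x [^]\<^bsub>pg (n + e)\<^esub> j"
  using hom_nat_pow[OF tr_hom _ pg_group pg_group] by (simp add: carrier_pg)

lemma tr_one: "tr n e \<one>\<^bsub>pg n\<^esub> = \<one>\<^bsub>pg (n + e)\<^esub>"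
  by (rule hom_one[OF tr_hom pg_group pg_group])

text \<open>By exactness the image in the next level is killed by \<open>l ^ n\<close>, and the
  inclusion is injective.\<close>

lemma level_pow_eq_one: "x \<in> P n \<Longrightarrow> x [^]\<^bsub>pg n\<^esub> (CARD('l) ^ n) = \<one>\<^bsub>pg n\<^esub>"
proof (rule tr_inj[of _ n _ 1])
  assume x: "x \<in> P n"
  then have "on_points (inc G n) x [^]\<^bsub>pg (Suc n)\<^esub> (CARD('l) ^ n) = \<one>\<^bsub>pg (Suc n)\<^esub>"
    using inc_image by blast
  then show "tr n 1 (x [^]\<^bsub>pg n\<^esub> (CARD('l) ^ n)) = tr n 1 \<one>\<^bsub>pg n\<^esub>"
    using tr_pow[OF x, of 1] tr_one[of n 1] by simp
qed (auto intro: pg_pow_closed lv.one_points)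

text \<open>Descent by one level at a time: what is killed by \<open>l ^ n\<close> is killed by
  \<open>l ^ (n + e)\<close>, so exactness brings it from level \<open>n + e\<close>, and by
  injectivity its preimage is again killed by \<open>l ^ n\<close>.\<close>

lemma tr_image:
  "x \<in> P (n + e) \<Longrightarrow> x [^]\<^bsub>pg (n + e)\<^esub> (CARD('l) ^ n) = \<one>\<^bsub>pg (n + e)\<^esub> \<Longrightarrow> x \<in> tr n e ` P n"
proof (induction e arbitrary: x)
  case (Suc e)
  have x: "x \<in> P (Suc (n + e))" "x [^]\<^bsub>pg (Suc (n + e))\<^esub> (CARD('l) ^ n) = \<one>\<^bsub>pg (Suc (n + e))\<^esub>"
    using Suc.prems by simp_all
  interpret pgS: group "pg (Suc (n + e))" by (rule pg_group)
  have "x [^]\<^bsub>pg (Suc (n + e))\<^esub> (CARD('l) ^ n * CARD('l) ^ e) = \<one>\<^bsub>pg (Suc (n + e))\<^esub>"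
    using pgS.nat_pow_pow[of x "CARD('l) ^ n" "CARD('l) ^ e"] x by (simp add: carrier_pg)
  then obtain y where y: "y \<in> P (n + e)" "x = on_points (inc G (n + e)) y"
    using inc_image[of "n + e"] x(1) by (auto simp: power_add)
  have "y [^]\<^bsub>pg (n + e)\<^esub> (CARD('l) ^ n) = \<one>\<^bsub>pg (n + e)\<^esub>"
  proof (rule tr_inj[of _ "n + e" _ 1])
    show "tr (n + e) 1 (y [^]\<^bsub>pg (n + e)\<^esub> (CARD('l) ^ n)) = tr (n + e) 1 \<one>\<^bsub>pg (n + e)\<^esub>"
      using x(2) y tr_pow[OF y(1), of 1] tr_one[of "n + e" 1] by simp
  qed (auto intro: pg_pow_closed lv.one_points y)
  then have "y \<in> tr n e ` P n" using Suc.IH y(1) by blast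
  then show ?case using y(2) by auto
qed simp

lemma torsion_eq: "torsion G (CARD('l) ^ n) UNIV = germ G n ` P n"
proof
  show "germ G n ` P n \<subseteq> torsion G (CARD('l) ^ n) UNIV"
  proof (rule image_subsetI)
    fix x assume x: "x \<in> P n"
    then show "germ G n x \<in> torsion G (CARD('l) ^ n) UNIV"
      using germ_memI[OF x]
      by (simp add: torsion_def carrier_geom germ_pow level_pow_eq_one germ_one[where K = UNIV])
  qed
  show "torsion G (CARD('l) ^ n) UNIV \<subseteq> germ G n ` P n"
  proof
    fix \<xi> assume "\<xi> \<in> torsion G (CARD('l) ^ n) UNIV"
    then have \<xi>: "\<xi> \<in> A" "\<xi> [^]\<^bsub>geom G\<^esub> (CARD('l) ^ n) = \<one>\<^bsub>geom G\<^esub>"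
      by (auto simp: torsion_def pt_group_def)
    obtain e x where x: "x \<in> P (n + e)" "\<xi> = germ G (n + e) x" by (rule geom_cases_ge[OF \<xi>(1)])
    have "germ G (n + e) (x [^]\<^bsub>pg (n + e)\<^esub> (CARD('l) ^ n)) = germ G (n + e) \<one>\<^bsub>pg (n + e)\<^esub>"
      using \<xi>(2) x by (simp add: germ_pow germ_one[where K = UNIV])
    then have "x [^]\<^bsub>pg (n + e)\<^esub> (CARD('l) ^ n) = \<one>\<^bsub>pg (n + e)\<^esub>"
      using germ_inj x(1) pg_pow_closed lv.one_points by blast
    then have "x \<in> tr n e ` P n" using tr_image x(1) by blast
    then show "\<xi> \<in> germ G n ` P n" using x(2) germ_tr by auto
  qed
qed

lemma card_torsion: "card (torsion G (CARD('l) ^ n) UNIV) = CARD('l) ^ (n * height G)"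
proof -
  have "inj_on (germ G n) (P n)" by (rule inj_onI) (rule germ_inj)
  then show ?thesis by (simp add: torsion_eq card_image lv.card_points level_rk)
qed

lemma frob_germ:
  assumes x: "x \<in> P n"
  shows "frob G (CARD('k) ^ a) (germ G n x) = germ G n (frob_vec a x)"
proof -
  have "germ G m (frob_vec a y) = germ G n (frob_vec a x)" if y: "(m, y) \<in> germ G n x" for m y
  proof (rule germ_eqI[of _ _ _ _ n m])
    have yP: "y \<in> P m" using y by (simp add: mem_germ)
    then show "frob_vec a y \<in> P m" "frob_vec a x \<in> P n" using x by (auto intro: frob_vec_points)
    have "tr n m x = tr m n y" using mem_germD[OF y x] by simp
    then show "tr m n (frob_vec a y) = tr n m (frob_vec a x)" using x yP by (simp add: tr_frob_vec)
  qed simp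
  then have "s = germ G n (frob_vec a x)"
    if "s \<in> {germ G m (frob_vec a y) | m y. (m, y) \<in> germ G n x}" for s
    using that by blast
  moreover have "{germ G m (frob_vec a y) | m y. (m, y) \<in> germ G n x} \<noteq> {}"
    using germ_self[OF x] by blast
  ultimately have "\<Union> {germ G m (frob_vec a y) | m y. (m, y) \<in> germ G n x} = germ G n (frob_vec a x)"
    by (rule Union_singleton_eq[rotated])
  then show ?thesis
    unfolding frob_def frob_vec_def using germ_memI[OF x] by simp
qed

lemma frob_extensional: "frob G m \<in> extensional (A)"
  by (simp add: frob_def)

lemma frob_hom: "frob G (CARD('k) ^ a) \<in> hom (geom G) (geom G)"
proof (rule homI)
  fix \<xi> \<eta> assume \<xi>: "\<xi> \<in> A" and \<eta>: "\<eta> \<in> A"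
  obtain n x y where *: "x \<in> P n" "\<xi> = germ G n x" "y \<in> P n" "\<eta> = germ G n y"
    by (rule geom_cases2[OF \<xi> \<eta>])
  then show "frob G (CARD('k) ^ a) \<xi> \<in> A"
    by (simp add: frob_germ germ_memI frob_vec_points)
  show "frob G (CARD('k) ^ a) (\<xi> \<odot> \<eta>)
      = frob G (CARD('k) ^ a) \<xi> \<odot> frob G (CARD('k) ^ a) \<eta>"
    using * by (simp add: germ_mult frob_germ lv.pmult_points frob_vec_points frob_vec_pmult points_carrier_vec)
qed

lemma frob_vec_surj: "frob_vec a ` P n = P n"
  by (rule endo_inj_surj[OF lv.finite_points]) (auto intro: frob_vec_points inj_onI frob_vec_inject)

lemma frob_bij: "bij_betw (frob G (CARD('k) ^ a)) (A) (A)"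
proof (rule bij_betwI')
  fix \<xi> \<eta> assume \<xi>: "\<xi> \<in> A" and \<eta>: "\<eta> \<in> A"
  obtain n x y where *: "x \<in> P n" "\<xi> = germ G n x" "y \<in> P n" "\<eta> = germ G n y"
    by (rule geom_cases2[OF \<xi> \<eta>])
  have "germ G n (frob_vec a x) = germ G n (frob_vec a y) \<longleftrightarrow> x = y"
    using * germ_inj frob_vec_points frob_vec_inject by metis
  moreover have "germ G n x = germ G n y \<longleftrightarrow> x = y" using * germ_inj by blast
  ultimately show "frob G (CARD('k) ^ a) \<xi> = frob G (CARD('k) ^ a) \<eta> \<longleftrightarrow> \<xi> = \<eta>"
    using * by (simp add: frob_germ)
next
  show "frob G (CARD('k) ^ a) \<xi> \<in> A" if "\<xi> \<in> A" for \<xi>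
    using frob_hom that by (auto simp: hom_def)
next
  fix \<eta> assume "\<eta> \<in> A"
  then obtain n y where y: "y \<in> P n" "\<eta> = germ G n y" by (rule geom_cases)
  then obtain x where "x \<in> P n" "y = frob_vec a x" using frob_vec_surj by (metis imageE)
  then show "\<exists>\<xi>\<in>A. \<eta> = frob G (CARD('k) ^ a) \<xi>"
    using y by (intro bexI[of _ "germ G n x"]) (simp_all add: frob_germ germ_memI)
qed

lemma frob_frob:
  assumes "\<xi> \<in> A"
  shows "frob G (CARD('k) ^ a) (frob G (CARD('k) ^ b) \<xi>) = frob G (CARD('k) ^ (a + b)) \<xi>"
proof -
  obtain n x where "x \<in> P n" "\<xi> = germ G n x" by (rule geom_cases[OF assms])
  then show ?thesis by (simp add: frob_germ frob_vec_points frob_vec_add)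
qed

lemma frob_0: "\<xi> \<in> A \<Longrightarrow> frob G 1 \<xi> = \<xi>"
  by (erule geom_cases) (use frob_germ[where a = 0] in simp)

text \<open>By \<open>germ_inj\<close>, a fixed germ has a fixed coordinate vector, whichever
  representative is taken; and a coordinate is fixed by the power map iff it lies in
  \<open>K\<close>.\<close>

lemma pts_eq_fixed:
  assumes "K = {c. c ^ (CARD('k) ^ a) = c}"
  shows "pts G K = {\<xi> \<in> A. frob G (CARD('k) ^ a) \<xi> = \<xi>}"
proof -
  have fixed: "frob_vec a x = x \<longleftrightarrow> (\<forall>i<rk (level G n). x $ i \<in> K)" if "x \<in> P n" for x n
  proof -
    have dim: "dim_vec x = rk (level G n)" using points_carrier_vec[OF that] by simp
    have "frob_vec a x = x \<longleftrightarrow> (\<forall>i<dim_vec x. frob_vec a x $ i = x $ i)"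
      by (auto intro: eq_vecI)
    then show ?thesis using dim by (auto simp: frob_vec_index assms)
  qed
  show ?thesis
  proof (intro equalityI subsetI)
    fix \<xi> assume "\<xi> \<in> pts G K"
    then obtain n x where "x \<in> P n" "\<xi> = germ G n x" "\<forall>i<rk (level G n). x $ i \<in> K"
      by (auto simp: pts_def)
    then show "\<xi> \<in> {\<xi> \<in> A. frob G (CARD('k) ^ a) \<xi> = \<xi>}"
      using fixed[of x n] by (simp add: frob_germ germ_memI)
  next
    fix \<xi> assume "\<xi> \<in> {\<xi> \<in> A. frob G (CARD('k) ^ a) \<xi> = \<xi>}"
    then have \<xi>: "\<xi> \<in> A" "frob G (CARD('k) ^ a) \<xi> = \<xi>" by auto
    obtain n x where x: "x \<in> P n" "\<xi> = germ G n x" by (rule geom_cases[OF \<xi>(1)])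
    then have "frob_vec a x = x" using \<xi>(2) germ_inj frob_vec_points by (metis frob_germ)
    then show "\<xi> \<in> pts G K" using x fixed[OF x(1)] unfolding pts_def by blast
  qed
qed

sublocale geom: l_divisible_aut "geom G" L "height G" "F"
proof -
  interpret comm_group "geom G" by (rule geom_comm_group)
  have car: "A = pts G UNIV" by (simp add: pt_group_def)
  interpret l_torsion_group "geom G" L
  proof
    fix \<xi> assume "\<xi> \<in> A"
    then obtain n x where "x \<in> P n" "\<xi> = germ G n x" by (rule geom_cases)
    then have "\<xi> \<in> torsion G (CARD('l) ^ n) UNIV" by (simp add: torsion_eq)
    then show "\<exists>n. \<xi> [^]\<^bsub>geom G\<^esub> (CARD('l) ^ n) = \<one>\<^bsub>geom G\<^esub>" by (auto simp: torsion_def)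
  qed
  show "l_divisible_aut TYPE('l) (geom G) (height G) (F)"
  proof
    show "card (tors n) = CARD('l) ^ (n * height G)" for n
      using card_torsion[of n] by (simp add: tors_def torsion_def car)
    show "F \<in> hom (geom G) (geom G)" using frob_hom[of 1] by simp
    show "bij_betw (F) (A) (A)" using frob_bij[of 1] by simp
  qed
qed

lemma torsion_tors: "torsion G (CARD('l) ^ n) UNIV = geom.tors n"
  by (simp add: torsion_def geom.tors_def carrier_geom)

section \<open>The endomorphism ring\<close>

text \<open>A matrix over \<open>k\<close> commutes with Frobenius. Conversely \<open>f\<close>
  preserves \<open>A[l ^ n]\<close>, which consists of the germs of points of level
  \<open>n\<close>, so it induces an equivariant homomorphism on that level, and this one has a
  matrix over \<open>k\<close>.\<close>

lemma End_carrier_iff: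
  "f \<in> carrier (End G) \<longleftrightarrow> f \<in> hom (geom G) (geom G) \<and> f \<in> extensional (A) \<and>
     (\<forall>\<xi>\<in>A. f (F \<xi>) = F (f \<xi>))"
proof (intro iffI conjI ballI)
  assume f: "f \<in> carrier (End G)"
  then show "f \<in> hom (geom G) (geom G)" "f \<in> extensional (A)" by (auto simp: End_def)
  fix \<xi> assume "\<xi> \<in> A"
  then obtain n x where x: "x \<in> P n" "\<xi> = germ G n x" by (rule geom_cases)
  obtain M where M: "hopf_hom (level G n) (level G n) M"
    "\<And>x. x \<in> P n \<Longrightarrow> f (germ G n x) = germ G n (on_points M x)"
    using f unfolding End_def by fastforce
  have Mc: "M \<in> carrier_mat (rk (level G n)) (rk (level G n))" using M(1) by (simp add: hopf_hom_def)
  note fg = frob_germ[where a = 1, simplified]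
  show "f (F \<xi>) = F (f \<xi>)"
    using x(1) frob_vec_on_points[OF Mc points_carrier_vec[OF x(1)], of 1]
    by (simp add: x(2) fg M(2) frob_vec_points hopf_hom_on_points[OF M(1)])
next
  assume "f \<in> hom (geom G) (geom G) \<and> f \<in> extensional (A) \<and>
     (\<forall>\<xi>\<in>A. f (F \<xi>) = F (f \<xi>))"
  then have f: "f \<in> hom (geom G) (geom G)" "f \<in> extensional (A)"
    and comm: "\<And>\<xi>. \<xi> \<in> A \<Longrightarrow> f (F \<xi>) = F (f \<xi>)" by auto
  note fg = frob_germ[where a = 1, simplified]
  have "\<exists>M. hopf_hom (level G n) (level G n) M \<and> (\<forall>x\<in>P n. f (germ G n x) = germ G n (on_points M x))" for n
  proof -
    have "\<exists>y. y \<in> P n \<and> f (germ G n x) = germ G n y" if "x \<in> P n" for x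
    proof -
      have "germ G n x \<in> geom.tors n" using that torsion_tors torsion_eq by blast
      then have "f (germ G n x) \<in> germ G n ` P n"
        using geom.hom_tors[OF f(1)] torsion_tors torsion_eq by blast
      then show ?thesis by blast
    qed
    then obtain g where g: "\<And>x. x \<in> P n \<Longrightarrow> g x \<in> P n" "\<And>x. x \<in> P n \<Longrightarrow> f (germ G n x) = germ G n (g x)"
      by metis
    have "g \<in> hom (pg n) (pg n)"
    proof (rule homI)
      fix x y assume xy: "x \<in> carrier (pg n)" "y \<in> carrier (pg n)"
      then show "g x \<in> carrier (pg n)" using g by (simp add: carrier_pg)
      show "g (x \<otimes>\<^bsub>pg n\<^esub> y) = g x \<otimes>\<^bsub>pg n\<^esub> g y"
      proof (rule germ_inj[of _ n])
        have xP: "x \<in> P n" "y \<in> P n" "x \<otimes>\<^bsub>pg n\<^esub> y \<in> P n" using xy by (auto simp: carrier_pg lv.pmult_points)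
        then have "germ G n (g (x \<otimes>\<^bsub>pg n\<^esub> y)) = f (germ G n x \<odot> germ G n y)"
          by (simp add: g germ_mult)
        also have "\<dots> = f (germ G n x) \<odot> f (germ G n y)"
          using xP by (intro hom_mult[OF f(1)]) (auto intro: germ_memI)
        also have "\<dots> = germ G n (g x \<otimes>\<^bsub>pg n\<^esub> g y)" using xP g by (simp add: germ_mult)
        finally show "germ G n (g (x \<otimes>\<^bsub>pg n\<^esub> y)) = germ G n (g x \<otimes>\<^bsub>pg n\<^esub> g y)" .
        show "g (x \<otimes>\<^bsub>pg n\<^esub> y) \<in> P n" "g x \<otimes>\<^bsub>pg n\<^esub> g y \<in> P n" using xP g lv.pmult_points by auto
      qed
    qed
    moreover have "g (frob_vec 1 x) = frob_vec 1 (g x)" if x: "x \<in> P n" for x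
    proof (rule germ_inj[of _ n])
      have fx: "frob_vec 1 x \<in> P n" by (rule frob_vec_points[OF x])
      have "germ G n (g (frob_vec 1 x)) = f (F (germ G n x))"
        using fg[OF x] g(2)[OF fx] by simp
      also have "\<dots> = germ G n (frob_vec 1 (g x))"
        using comm[OF germ_memI[OF x]] g(2)[OF x] fg[OF g(1)[OF x]] by simp
      finally show "germ G n (g (frob_vec 1 x)) = germ G n (frob_vec 1 (g x))" .
      show "g (frob_vec 1 x) \<in> P n" "frob_vec 1 (g x) \<in> P n"
        using g(1) x fx frob_vec_points by auto
    qed
    ultimately obtain M where "hopf_hom (level G n) (level G n) M" "\<And>x. x \<in> P n \<Longrightarrow> g x = on_points M x"
      using hopf_hom_of_frob_equivariant[of "level G n" "level G n" g,
          OF level_hopf level_etale level_hopf level_etale] by blast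
    then show ?thesis using g(2) by auto
  qed
  then show "f \<in> carrier (End G)" using f by (auto simp: End_def)
qed

lemma End_simps:
  "f \<otimes>\<^bsub>End G\<^esub> g = compose (A) f g"
  "\<one>\<^bsub>End G\<^esub> = (\<lambda>\<xi>\<in>A. \<xi>)"
  "\<zero>\<^bsub>End G\<^esub> = (\<lambda>\<xi>\<in>A. \<one>\<^bsub>geom G\<^esub>)"
  "f \<oplus>\<^bsub>End G\<^esub> g = (\<lambda>\<xi>\<in>A. f \<xi> \<odot> g \<xi>)"
  by (simp_all add: End_def)

lemma EndI:
  assumes "\<And>\<xi>. \<xi> \<in> A \<Longrightarrow> f \<xi> \<in> A"
    and "\<And>\<xi> \<eta>. \<xi> \<in> A \<Longrightarrow> \<eta> \<in> A \<Longrightarrow>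
      f (\<xi> \<odot> \<eta>) = f \<xi> \<odot> f \<eta>"
    and "\<And>\<xi>. \<xi> \<in> A \<Longrightarrow> f (F \<xi>) = F (f \<xi>)"
  shows "(\<lambda>\<xi>\<in>A. f \<xi>) \<in> carrier (End G)"
  unfolding End_carrier_iff using assms geom.F_closed by (auto simp: hom_def)

lemma EndD:
  assumes "f \<in> carrier (End G)"
  shows "\<xi> \<in> A \<Longrightarrow> f \<xi> \<in> A"
    and "\<xi> \<in> A \<Longrightarrow> \<eta> \<in> A \<Longrightarrow>
      f (\<xi> \<odot> \<eta>) = f \<xi> \<odot> f \<eta>"
    and "\<xi> \<in> A \<Longrightarrow> f (F \<xi>) = F (f \<xi>)"
    and "f \<in> extensional (A)"
    and "f \<in> hom (geom G) (geom G)"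
  using assms unfolding End_carrier_iff by (auto simp: hom_def)

lemma End_eqI:
  assumes "f \<in> carrier (End G)" "g \<in> carrier (End G)"
    and "\<And>\<xi>. \<xi> \<in> A \<Longrightarrow> f \<xi> = g \<xi>"
  shows "f = g"
  using assms EndD(4) extensionalityI by metis

lemma End_ring: "ring (End G)"
proof (rule ringI)
  note [simp] = End_simps geom.F_closed geom.F_mult
  have add: "f \<oplus>\<^bsub>End G\<^esub> g \<in> carrier (End G)" if fg: "f \<in> carrier (End G)" "g \<in> carrier (End G)" for f g
    unfolding End_simps
    by (rule EndI) (simp_all add: EndD(1-3)[OF fg(1)] EndD(1-3)[OF fg(2)] geom.m_ac)
  have mult: "f \<otimes>\<^bsub>End G\<^esub> g \<in> carrier (End G)" if fg: "f \<in> carrier (End G)" "g \<in> carrier (End G)" for f g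
    unfolding End_simps compose_def
    by (rule EndI) (simp_all add: EndD(1-3)[OF fg(1)] EndD(1-3)[OF fg(2)])
  have one: "\<one>\<^bsub>End G\<^esub> \<in> carrier (End G)" unfolding End_simps by (rule EndI) simp_all
  have zero: "\<zero>\<^bsub>End G\<^esub> \<in> carrier (End G)" unfolding End_simps by (rule EndI) (simp_all add: geom.F_one)
  have neg: "(\<lambda>\<xi>\<in>A. inv\<^bsub>geom G\<^esub> (f \<xi>)) \<in> carrier (End G)" if f: "f \<in> carrier (End G)" for f
  proof (rule EndI)
    fix \<xi> assume \<xi>: "\<xi> \<in> A"
    interpret F: group_hom "geom G" "geom G" F by unfold_locales (rule geom.F_hom)
    show "inv\<^bsub>geom G\<^esub> (f (F \<xi>)) = F (inv\<^bsub>geom G\<^esub> (f \<xi>))"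
      using EndD[OF f] \<xi> by simp
  qed (simp_all add: EndD(1,2)[OF f] geom.inv_mult)
  show "abelian_group (End G)"
  proof (rule abelian_groupI)
    show "\<exists>g\<in>carrier (End G). g \<oplus>\<^bsub>End G\<^esub> f = \<zero>\<^bsub>End G\<^esub>" if f: "f \<in> carrier (End G)" for f
      by (rule bexI[OF _ neg[OF f]], rule End_eqI[OF add[OF neg[OF f] f] zero]) (simp add: EndD(1)[OF f])
    show "f \<oplus>\<^bsub>End G\<^esub> g \<oplus>\<^bsub>End G\<^esub> k = f \<oplus>\<^bsub>End G\<^esub> (g \<oplus>\<^bsub>End G\<^esub> k)"
      if "f \<in> carrier (End G)" "g \<in> carrier (End G)" "k \<in> carrier (End G)" for f g k
      by (rule End_eqI[OF add[OF add[OF that(1,2)] that(3)] add[OF that(1) add[OF that(2,3)]]])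
        (use that in \<open>simp add: EndD(1) geom.m_assoc\<close>)
    show "f \<oplus>\<^bsub>End G\<^esub> g = g \<oplus>\<^bsub>End G\<^esub> f" if "f \<in> carrier (End G)" "g \<in> carrier (End G)" for f g
      by (rule End_eqI[OF add[OF that] add[OF that(2,1)]]) (use that in \<open>simp add: EndD(1) geom.m_comm\<close>)
    show "\<zero>\<^bsub>End G\<^esub> \<oplus>\<^bsub>End G\<^esub> f = f" if "f \<in> carrier (End G)" for f
      by (rule End_eqI[OF add[OF zero that] that]) (use that in \<open>simp add: EndD(1)\<close>)
  qed (rule add zero; assumption)+
  show "Group.monoid (End G)"
  proof (rule monoidI)
    show "f \<otimes>\<^bsub>End G\<^esub> g \<otimes>\<^bsub>End G\<^esub> k = f \<otimes>\<^bsub>End G\<^esub> (g \<otimes>\<^bsub>End G\<^esub> k)"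
      if "f \<in> carrier (End G)" "g \<in> carrier (End G)" "k \<in> carrier (End G)" for f g k
      by (rule End_eqI[OF mult[OF mult[OF that(1,2)] that(3)] mult[OF that(1) mult[OF that(2,3)]]])
        (use that in \<open>simp add: EndD(1) compose_def\<close>)
    show "\<one>\<^bsub>End G\<^esub> \<otimes>\<^bsub>End G\<^esub> f = f" if "f \<in> carrier (End G)" for f
      by (rule End_eqI[OF mult[OF one that] that]) (use that in \<open>simp add: EndD(1) compose_def\<close>)
    show "f \<otimes>\<^bsub>End G\<^esub> \<one>\<^bsub>End G\<^esub> = f" if "f \<in> carrier (End G)" for f
      by (rule End_eqI[OF mult[OF that one] that]) (use that in \<open>simp add: EndD(1) compose_def\<close>)
  qed (rule mult one; assumption)+
  show "(f \<oplus>\<^bsub>End G\<^esub> g) \<otimes>\<^bsub>End G\<^esub> k = f \<otimes>\<^bsub>End G\<^esub> k \<oplus>\<^bsub>End G\<^esub> g \<otimes>\<^bsub>End G\<^esub> k"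
    if "f \<in> carrier (End G)" "g \<in> carrier (End G)" "k \<in> carrier (End G)" for f g k
    by (rule End_eqI[OF mult[OF add[OF that(1,2)] that(3)] add[OF mult[OF that(1,3)] mult[OF that(2,3)]]])
      (use that in \<open>simp add: EndD(1) compose_def\<close>)
  show "k \<otimes>\<^bsub>End G\<^esub> (f \<oplus>\<^bsub>End G\<^esub> g) = k \<otimes>\<^bsub>End G\<^esub> f \<oplus>\<^bsub>End G\<^esub> k \<otimes>\<^bsub>End G\<^esub> g"
    if "f \<in> carrier (End G)" "g \<in> carrier (End G)" "k \<in> carrier (End G)" for f g k
    by (rule End_eqI[OF mult[OF that(3) add[OF that(1,2)]] add[OF mult[OF that(3,1)] mult[OF that(3,2)]]])
      (use that in \<open>simp add: EndD compose_def\<close>)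
qed

end

section \<open>Quotients of polynomial rings\<close>

lemma (in ring_hom_ring) hom_nat_pow_ring: "x \<in> carrier R \<Longrightarrow> h (x [^] (n::nat)) = h x [^]\<^bsub>S\<^esub> n"
  by (induction n) simp_all

lemma (in ring_hom_ring) hom_add_pow_ring: "x \<in> carrier R \<Longrightarrow> h (add_pow R (n::nat) x) = add_pow S n (h x)"
  by (induction n) (simp_all add: R.add.nat_pow_Suc S.add.nat_pow_Suc)

lemma (in ring_hom_ring) hom_a_minus: "x \<in> carrier R \<Longrightarrow> y \<in> carrier R \<Longrightarrow> h (x \<ominus> y) = h x \<ominus>\<^bsub>S\<^esub> h y"
  by (simp add: a_minus_def)

lemma type_ring_simps:
  "carrier (ring_of_type_algebra :: 'a::comm_ring_1 ring) = UNIV"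
  "x \<otimes>\<^bsub>ring_of_type_algebra\<^esub> y = (x * y :: 'a)"
  "x \<oplus>\<^bsub>ring_of_type_algebra\<^esub> y = (x + y :: 'a)"
  "\<one>\<^bsub>ring_of_type_algebra\<^esub> = (1 :: 'a)"
  "\<zero>\<^bsub>ring_of_type_algebra\<^esub> = (0 :: 'a)"
  by (simp_all add: ring_of_type_algebra_def)

lemma type_ring_minus: "x \<ominus>\<^bsub>ring_of_type_algebra\<^esub> y = (x - y :: 'a::comm_ring_1)"
proof -
  interpret cring "ring_of_type_algebra :: 'a ring" by (rule cring_from_type_algebra)
  have "\<ominus>\<^bsub>ring_of_type_algebra\<^esub> y = - y"
    by (rule minus_equality) (simp_all add: type_ring_simps)
  then show ?thesis by (simp add: a_minus_def type_ring_simps)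
qed

lemma type_ring_pow: "x [^]\<^bsub>ring_of_type_algebra\<^esub> n = (x ^ n :: 'a::comm_ring_1)" for n :: nat
  by (induction n) (simp_all add: type_ring_simps mult.commute)

lemma type_ring_add_pow: "add_pow ring_of_type_algebra n x = (of_nat n * x :: 'a::comm_ring_1)" for n :: nat
proof -
  interpret cring "ring_of_type_algebra :: 'a ring" by (rule cring_from_type_algebra)
  show ?thesis
    by (induction n) (simp_all add: add.nat_pow_Suc type_ring_simps algebra_simps)
qed

lemma type_ring_PIdl: "x \<in> PIdl\<^bsub>ring_of_type_algebra\<^esub> y \<longleftrightarrow> y dvd (x :: 'a::comm_ring_1)"
  by (auto simp: cgenideal_def type_ring_simps dvd_def mult.commute)

text \<open>The sums \<open>y * v + z * w\<close> form an ideal containing both generators, so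
  minimality of the generated ideal applies.\<close>

lemma type_ring_Idl2:
  fixes x y z :: "'a::comm_ring_1"
  assumes "x \<in> Idl\<^bsub>ring_of_type_algebra\<^esub> {y, z}"
  obtains v w where "x = y * v + z * w"
proof -
  let ?R = "ring_of_type_algebra :: 'a ring"
  let ?J = "{y * v + z * w | v w. True}"
  interpret cring ?R by (rule cring_from_type_algebra)
  have "ideal ?J ?R"
  proof (rule idealI)
    show "ring ?R" by (rule ring_axioms)
    have inv: "\<ominus>\<^bsub>?R\<^esub> v = - v" for v
      using type_ring_minus[of 0 v] by (simp add: a_minus_def type_ring_simps)
    show "subgroup ?J (add_monoid ?R)"
    proof (rule add.subgroupI)
      show "?J \<subseteq> carrier ?R" by (simp add: type_ring_simps)
      show "?J \<noteq> {}" by blast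
      show "\<ominus>\<^bsub>?R\<^esub> s \<in> ?J" if s: "s \<in> ?J" for s
      proof -
        obtain v w where "s = y * v + z * w" using s by blast
        then have "- s = y * (- v) + z * (- w)" by simp
        then show ?thesis unfolding inv by blast
      qed
      show "s \<oplus>\<^bsub>?R\<^esub> s' \<in> ?J" if s: "s \<in> ?J" "s' \<in> ?J" for s s'
      proof -
        obtain v w v' w' where "s = y * v + z * w" "s' = y * v' + z * w'" using s by blast
        then have "s + s' = y * (v + v') + z * (w + w')" by (simp add: algebra_simps)
        then show ?thesis by (auto simp: type_ring_simps)
      qed
    qed
    have "s * r \<in> ?J" if s: "s \<in> ?J" for s r
    proof -
      obtain v w where "s = y * v + z * w" using s by blast
      then have "s * r = y * (v * r) + z * (w * r)" by (simp add: algebra_simps)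
      then show ?thesis by blast
    qed
    then show "r \<otimes>\<^bsub>?R\<^esub> s \<in> ?J" "s \<otimes>\<^bsub>?R\<^esub> r \<in> ?J" if "s \<in> ?J" for s r
      using that by (simp_all add: type_ring_simps mult.commute[of r])
  qed
  moreover have "{y, z} \<subseteq> ?J"
  proof -
    have "y = y * 1 + z * 0" "z = y * 0 + z * 1" by simp_all
    then show ?thesis by blast
  qed
  ultimately have "x \<in> ?J" using genideal_minimal assms by blast
  then show ?thesis using that by blast
qed

context
  fixes I :: "'a::comm_ring_1 set" and R :: "'a ring"
  defines "R \<equiv> ring_of_type_algebra"
  assumes ideal: "ideal I R"
begin

lemma quot_hom: "ring_hom_ring R (R Quot I) (a_r_coset R I)"
  by (rule ideal.rcos_ring_hom_ring[OF ideal])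

lemma quot_eq_iff: "I +>\<^bsub>R\<^esub> x = I +>\<^bsub>R\<^esub> y \<longleftrightarrow> x - y \<in> I"
proof -
  interpret cring R unfolding R_def by (rule cring_from_type_algebra)
  show ?thesis
    using quotient_eq_iff_same_a_r_cos[OF ideal, of x y] by (simp add: R_def type_ring_simps type_ring_minus)
qed

lemma quot_surj:
  assumes "C \<in> carrier (R Quot I)"
  obtains x where "C = I +>\<^bsub>R\<^esub> x"
  using assms by (auto simp: FactRing_def A_RCOSETS_def')

lemma quot_closed: "I +>\<^bsub>R\<^esub> x \<in> carrier (R Quot I)"
  using ring_hom_closed[OF ring_hom_ring.homh[OF quot_hom]] by (simp add: R_def type_ring_simps)

lemma quot_simps:
  fixes n :: nat
  shows "(I +>\<^bsub>R\<^esub> x) \<otimes>\<^bsub>R Quot I\<^esub> (I +>\<^bsub>R\<^esub> y) = I +>\<^bsub>R\<^esub> (x * y)"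
    and "(I +>\<^bsub>R\<^esub> x) \<oplus>\<^bsub>R Quot I\<^esub> (I +>\<^bsub>R\<^esub> y) = I +>\<^bsub>R\<^esub> (x + y)"
    and "\<one>\<^bsub>R Quot I\<^esub> = I +>\<^bsub>R\<^esub> 1"
    and "(I +>\<^bsub>R\<^esub> x) [^]\<^bsub>R Quot I\<^esub> n = I +>\<^bsub>R\<^esub> (x ^ n)"
    and "add_pow (R Quot I) n (I +>\<^bsub>R\<^esub> x) = I +>\<^bsub>R\<^esub> (of_nat n * x)"
    and "(I +>\<^bsub>R\<^esub> x) \<ominus>\<^bsub>R Quot I\<^esub> (I +>\<^bsub>R\<^esub> y) = I +>\<^bsub>R\<^esub> (x - y)"
proof -
  interpret \<pi>: ring_hom_ring R "R Quot I" "a_r_coset R I" by (rule quot_hom)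
  have UN: "x \<in> carrier R" for x by (simp add: R_def type_ring_simps)
  show "(I +>\<^bsub>R\<^esub> x) \<otimes>\<^bsub>R Quot I\<^esub> (I +>\<^bsub>R\<^esub> y) = I +>\<^bsub>R\<^esub> (x * y)"
    using \<pi>.hom_mult[OF UN UN, of x y] by (simp add: R_def type_ring_simps)
  show "(I +>\<^bsub>R\<^esub> x) \<oplus>\<^bsub>R Quot I\<^esub> (I +>\<^bsub>R\<^esub> y) = I +>\<^bsub>R\<^esub> (x + y)"
    using \<pi>.hom_add[OF UN UN, of x y] by (simp add: R_def type_ring_simps)
  show "\<one>\<^bsub>R Quot I\<^esub> = I +>\<^bsub>R\<^esub> 1"
    using \<pi>.hom_one by (simp add: R_def type_ring_simps)
  show "(I +>\<^bsub>R\<^esub> x) [^]\<^bsub>R Quot I\<^esub> n = I +>\<^bsub>R\<^esub> (x ^ n)"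
    using \<pi>.hom_nat_pow_ring[OF UN, of x n] by (simp add: R_def type_ring_pow)
  show "add_pow (R Quot I) n (I +>\<^bsub>R\<^esub> x) = I +>\<^bsub>R\<^esub> (of_nat n * x)"
    using \<pi>.hom_add_pow_ring[OF UN, of n x] by (simp add: R_def type_ring_add_pow)
  show "(I +>\<^bsub>R\<^esub> x) \<ominus>\<^bsub>R Quot I\<^esub> (I +>\<^bsub>R\<^esub> y) = I +>\<^bsub>R\<^esub> (x - y)"
    using \<pi>.hom_a_minus[OF UN UN, of x y] by (simp add: R_def type_ring_minus)
qed

end

section \<open>The characteristic polynomial of Frobenius\<close>

context etale_l_divisible_group
begin

lemma tate_eq: "tate CARD('l) G = geom.T"
  by (auto simp: tate_def geom.T_def torsion_tors)

lemma tate_lincomb_eq: "tate_lincomb G B c = geom.lincomb B c"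
  by (simp add: tate_lincomb_def geom.lincomb_def)

lemma tate_basis_eq: "tate_basis TYPE('l) G B \<longleftrightarrow> geom.basis B"
  by (simp add: tate_basis_def geom.basis_def tate_eq tate_lincomb_eq)

text \<open>The definite description is legitimate: a Tate basis exists, and different bases give
  the same polynomial.\<close>

lemma frob_char_poly_eq:
  obtains B M where "geom.basis B" "geom.represents (F) B M"
    "(frob_char_poly G :: 'l padic poly) = char_poly M"
proof -
  let ?Q = "\<lambda>\<chi> :: 'l padic poly. \<exists>B M. tate_basis TYPE('l) G B \<and>
     M \<in> carrier_mat (height G) (height G) \<and>
     (\<forall>j<height G. (\<lambda>\<nu>. F (B j \<nu>)) = tate_lincomb G B (col M j)) \<and>
     \<chi> = char_poly M"
  have Q: "?Q \<chi> \<longleftrightarrow> (\<exists>B M. geom.basis B \<and> geom.represents (F) B M \<and> \<chi> = char_poly M)" for \<chi>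
    unfolding tate_basis_eq tate_lincomb_eq geom.represents_def by blast
  obtain B M where "geom.basis B" "geom.represents (F) B M"
    using geom.basis_exists geom.represents_exists[OF geom.F_hom] by metis
  then have "\<exists>!\<chi>. ?Q \<chi>" unfolding Q using geom.char_poly_unique[OF geom.F_hom] by blast
  then have "?Q (THE \<chi>. ?Q \<chi>)" by (rule theI')
  then have "?Q (frob_char_poly G)" unfolding frob_char_poly_def .
  then show ?thesis unfolding Q using that by blast
qed

lemma frob_char_poly_monic: "lead_coeff (frob_char_poly G :: 'l padic poly) = 1"
  by (rule frob_char_poly_eq) (metis degree_monic_char_poly geom.represents_def)

lemma frob_char_poly_kills: "\<xi> \<in> A \<Longrightarrow> geom.pact (frob_char_poly G) \<xi> = \<one>\<^bsub>geom G\<^esub>"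
  by (rule frob_char_poly_eq) (simp add: geom.pact_char_poly)

text \<open>With \<open>\<chi> = c + X p\<close> and \<open>c w = 1\<close>, the choice
  \<open>u = - w p\<close> gives \<open>X u - 1 = - w \<chi>\<close>.\<close>

lemma frob_char_poly_X_unit:
  obtains u where "(frob_char_poly G :: 'l padic poly) dvd [:0, 1:] * u - 1"
proof -
  let ?\<chi> = "frob_char_poly G :: 'l padic poly"
  obtain w where w: "coeff ?\<chi> 0 * w = 1"
    by (rule frob_char_poly_eq) (metis geom.char_poly_const_unit)
  obtain c p where cp: "?\<chi> = pCons c p" by (rule pCons_cases)
  then have "?\<chi> * [:- w:] = [:0, 1:] * (p * [:- w:]) - 1"
    using w by (simp add: one_pCons mult.commute)
  then show ?thesis using that by (metis dvd_triv_left)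
qed

text \<open>Restricted to the carrier, since \<open>End G\<close> admits extensional functions
  only.\<close>

definition poly_endo :: "'l padic poly \<Rightarrow> 'k gpoint \<Rightarrow> 'k gpoint" where
  "poly_endo p = (\<lambda>\<xi>\<in>A. geom.pact p \<xi>)"

lemma poly_endo_End: "poly_endo p \<in> carrier (End G)"
  unfolding poly_endo_def
  by (rule EndI)
    (simp_all add: geom.pact_closed geom.pact_distrib geom.pact_commute_hom[OF geom.F_hom refl, symmetric])

lemma poly_endo_eq_of_dvd:
  assumes "(frob_char_poly G :: 'l padic poly) dvd p - p'"
  shows "poly_endo p = poly_endo p'"
proof -
  have "geom.pact p \<xi> = geom.pact p' \<xi>" if \<xi>: "\<xi> \<in> A" for \<xi>
  proof -
    have "geom.pact p \<xi> = geom.pact ((p - p') + p') \<xi>" by simp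
    also have "\<dots> = geom.pact (p - p') \<xi> \<odot> geom.pact p' \<xi>" by (rule geom.pact_add[OF \<xi>])
    also have "geom.pact (p - p') \<xi> = \<one>\<^bsub>geom G\<^esub>"
      using frob_char_poly_kills assms \<xi> by (rule geom.pact_kernel_dvd)
    finally show ?thesis using \<xi> by (simp add: geom.pact_closed)
  qed
  then show ?thesis unfolding poly_endo_def by (rule restrict_ext)
qed

lemma poly_endo_hom:
  assumes "I = PIdl\<^bsub>Zl_poly\<^esub> (frob_char_poly G :: 'l padic poly)"
  obtains \<rho> where "\<rho> \<in> Ring.ring_hom (Zl_poly Quot I) (End G)" "\<And>p. \<rho> (I +>\<^bsub>Zl_poly\<^esub> p) = poly_endo p"
proof -
  interpret R: cring "Zl_poly :: 'l padic poly ring" by (rule cring_from_type_algebra)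
  have I: "ideal I Zl_poly" unfolding assms by (rule R.cgenideal_ideal) (simp add: type_ring_simps)
  note quot = quot_simps[OF I] and surj = quot_surj[OF I]
  \<comment> \<open>Any representative of the coset may be taken: \<open>\<chi>\<close> acts
    trivially, so \<open>poly_endo_eq_of_dvd\<close> makes the choice immaterial.\<close>
  define \<rho> where "\<rho> C = poly_endo (SOME p. C = I +>\<^bsub>Zl_poly\<^esub> p)" for C
  have \<rho>: "\<rho> (I +>\<^bsub>Zl_poly\<^esub> p) = poly_endo p" for p
  proof -
    have "I +>\<^bsub>Zl_poly\<^esub> p = I +>\<^bsub>Zl_poly\<^esub> (SOME p'. I +>\<^bsub>Zl_poly\<^esub> p = I +>\<^bsub>Zl_poly\<^esub> p')"
      by (rule someI[of _ p]) simp
    then have "frob_char_poly G dvd p - (SOME p'. I +>\<^bsub>Zl_poly\<^esub> p = I +>\<^bsub>Zl_poly\<^esub> p')"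
      unfolding quot_eq_iff[OF I] by (simp only: assms type_ring_PIdl)
    then show ?thesis unfolding \<rho>_def by (rule poly_endo_eq_of_dvd[symmetric])
  qed
  have "\<rho> \<in> Ring.ring_hom (Zl_poly Quot I) (End G)"
  proof (rule ring_hom_memI)
    show "\<rho> C \<in> carrier (End G)" for C unfolding \<rho>_def by (rule poly_endo_End)
    show "\<rho> \<one>\<^bsub>Zl_poly Quot I\<^esub> = \<one>\<^bsub>End G\<^esub>"
      unfolding quot(3) \<rho> End_simps poly_endo_def by (rule restrict_ext) (rule geom.pact_one)
    fix C D assume "C \<in> carrier (Zl_poly Quot I)" "D \<in> carrier (Zl_poly Quot I)"
    then obtain p p' where CD: "C = I +>\<^bsub>Zl_poly\<^esub> p" "D = I +>\<^bsub>Zl_poly\<^esub> p'"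
      using surj by metis
    show "\<rho> (C \<otimes>\<^bsub>Zl_poly Quot I\<^esub> D) = \<rho> C \<otimes>\<^bsub>End G\<^esub> \<rho> D"
      unfolding CD quot(1) \<rho> End_simps compose_def poly_endo_def
      by (rule restrict_ext) (simp add: geom.pact_mult geom.pact_closed)
    show "\<rho> (C \<oplus>\<^bsub>Zl_poly Quot I\<^esub> D) = \<rho> C \<oplus>\<^bsub>End G\<^esub> \<rho> D"
      unfolding CD quot(2) \<rho> End_simps poly_endo_def
      by (rule restrict_ext) (simp add: geom.pact_add)
  qed
  then show ?thesis using \<rho> by (rule that)
qed

lemma poly_endo_X: "poly_endo [:0, 1:] = F"
  unfolding poly_endo_def
  by (rule extensionalityI[OF restrict_extensional frob_extensional]) (simp add: geom.pact_X)

lemma frob_End: "F \<in> carrier (End G)"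
  using poly_endo_End[of "[:0, 1:]"] by (simp only: poly_endo_X)

lemma End_pow_frob:
  fixes a :: nat
  assumes "\<xi> \<in> A"
  shows "(F [^]\<^bsub>End G\<^esub> a) \<xi> = frob G (CARD('k) ^ a) \<xi>"
  using assms
proof (induction a arbitrary: \<xi>)
  case 0
  then show ?case using frob_0 by (simp add: End_simps)
next
  case (Suc a)
  then show ?case using frob_frob[of \<xi> a 1]
    by (simp add: End_simps compose_def geom.F_closed)
qed

text \<open>The additive inverse in \<open>End G\<close> is given abstractly by the ring structure;
  the law \<open>l_neg\<close>, evaluated at \<open>\<xi>\<close>, identifies it pointwise.\<close>

lemma End_minus_apply:
  assumes f: "f \<in> carrier (End G)" and g: "g \<in> carrier (End G)" and \<xi>: "\<xi> \<in> A"
  shows "(f \<ominus>\<^bsub>End G\<^esub> g) \<xi> = f \<xi> \<odot> inv\<^bsub>geom G\<^esub> (g \<xi>)"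
proof -
  interpret E: ring "End G" by (rule End_ring)
  have "(\<ominus>\<^bsub>End G\<^esub> g) \<xi> \<in> A" "g \<xi> \<in> A"
    using EndD(1) g \<xi> by auto
  moreover have "(\<ominus>\<^bsub>End G\<^esub> g \<oplus>\<^bsub>End G\<^esub> g) \<xi> = \<one>\<^bsub>geom G\<^esub>"
    using \<xi> unfolding E.l_neg[OF g] by (simp add: End_simps)
  ultimately have "(\<ominus>\<^bsub>End G\<^esub> g) \<xi> = inv\<^bsub>geom G\<^esub> (g \<xi>)"
    using \<xi> by (simp add: End_simps geom.inv_equality)
  then show ?thesis using \<xi> by (simp add: a_minus_def End_simps)
qed

lemma End_add_pow_apply:
  fixes m :: nat
  assumes f: "f \<in> carrier (End G)" and \<xi>: "\<xi> \<in> A"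
  shows "(add_pow (End G) m f) \<xi> = f \<xi> [^]\<^bsub>geom G\<^esub> m"
proof -
  interpret E: ring "End G" by (rule End_ring)
  show ?thesis
    by (induction m) (use \<xi> in \<open>simp_all add: E.add.nat_pow_Suc End_simps\<close>)
qed

section \<open>The Kummer map\<close>

text \<open>Two readings of \<open>F^a - 1 = m r\<close>. With \<open>m\<close> applied before
  \<open>r\<close> it yields rationality and the Kummer values; with \<open>m\<close> applied after
  \<open>r\<close> it shows that \<open>r\<close> sends rational points to
  \<open>m\<close>-torsion.\<close>

lemma frob_pow_minus_one:
  fixes a m :: nat
  assumes r: "r \<in> carrier (End G)"
    and eq: "F [^]\<^bsub>End G\<^esub> a \<ominus>\<^bsub>End G\<^esub> \<one>\<^bsub>End G\<^esub> = add_pow (End G) m r"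
    and x: "x \<in> A"
  shows "frob G (CARD('k) ^ a) x \<odot> inv\<^bsub>geom G\<^esub> x = r (x [^]\<^bsub>geom G\<^esub> m)"
    and "frob G (CARD('k) ^ a) x \<odot> inv\<^bsub>geom G\<^esub> x = r x [^]\<^bsub>geom G\<^esub> m"
proof -
  interpret E: ring "End G" by (rule End_ring)
  have "frob G (CARD('k) ^ a) x \<odot> inv\<^bsub>geom G\<^esub> x
      = (F [^]\<^bsub>End G\<^esub> a \<ominus>\<^bsub>End G\<^esub> \<one>\<^bsub>End G\<^esub>) x"
    using x End_minus_apply[OF E.nat_pow_closed[OF frob_End] E.one_closed x, of a]
    by (simp add: End_pow_frob End_simps)
  also have "\<dots> = r x [^]\<^bsub>geom G\<^esub> m" unfolding eq by (rule End_add_pow_apply[OF r x])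
  finally show 1: "frob G (CARD('k) ^ a) x \<odot> inv\<^bsub>geom G\<^esub> x = r x [^]\<^bsub>geom G\<^esub> m" .
  also have "\<dots> = r (x [^]\<^bsub>geom G\<^esub> m)"
    by (rule hom_nat_pow[OF EndD(5)[OF r] x geom_group geom_group, symmetric])
  finally show "frob G (CARD('k) ^ a) x \<odot> inv\<^bsub>geom G\<^esub> x = r (x [^]\<^bsub>geom G\<^esub> m)" .
qed

text \<open>\<open>r\<close> stands for the image of \<open>h_a\<close> under an action on
  \<open>G\<close>; it enters only as an endomorphism over \<open>k\<close> satisfying
  \<open>eq\<close>.\<close>

context
  fixes a n m :: nat and K :: "'k alg_closure set" and r :: "'k gpoint \<Rightarrow> 'k gpoint"
  assumes m: "m = CARD('l) ^ n"
    and card_K: "card K = CARD('k) ^ a" and K: "K = {c. c ^ (CARD('k) ^ a) = c}"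
    and r: "r \<in> carrier (End G)"
    and eq: "F [^]\<^bsub>End G\<^esub> a \<ominus>\<^bsub>End G\<^esub> \<one>\<^bsub>End G\<^esub> = add_pow (End G) m r"
begin

abbreviation "GK \<equiv> pt_group G K"
abbreviation "N \<equiv> multiples G m K"
abbreviation "kum \<equiv> kummer_map G m K"
abbreviation "Fa \<equiv> frob G (CARD('k) ^ a)"

lemma r_closed: "x \<in> A \<Longrightarrow> r x \<in> A"
  by (rule EndD(1)[OF r])

lemma Fa_closed: "x \<in> A \<Longrightarrow> Fa x \<in> A"
  using frob_hom by (auto simp: hom_def)

lemma pts_iff: "x \<in> pts G K \<longleftrightarrow> x \<in> A \<and> Fa x = x"
  unfolding pts_eq_fixed[OF K] by simp

text \<open>Both sides say that \<open>F^a x - x\<close> is trivial. The criterion serves three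
  times: for the rationality of torsion, for the independence of the Kummer map from the coset
  representative, and for its injectivity.\<close>

lemma pts_iff_r:
  assumes x: "x \<in> A"
  shows "x \<in> pts G K \<longleftrightarrow> r (x [^]\<^bsub>geom G\<^esub> m) = \<one>\<^bsub>geom G\<^esub>"
proof -
  have "Fa x = x \<longleftrightarrow> Fa x \<odot> inv\<^bsub>geom G\<^esub> x = \<one>\<^bsub>geom G\<^esub>"
    using x Fa_closed[OF x] by (metis geom.inv_equality geom.inv_inv geom.inv_closed geom.r_inv)
  then show ?thesis using frob_pow_minus_one(1)[OF r eq x] pts_iff x by simp
qed

lemma r_one: "r \<one>\<^bsub>geom G\<^esub> = \<one>\<^bsub>geom G\<^esub>"
  by (rule hom_one[OF EndD(5)[OF r] geom_group geom_group])

lemma torsion_subset_pts: "torsion G m UNIV \<subseteq> pts G K"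
  using pts_iff_r r_one by (auto simp: torsion_def carrier_geom)

lemma torsion_iff: "x \<in> torsion G m K \<longleftrightarrow> x \<in> A \<and> x [^]\<^bsub>geom G\<^esub> m = \<one>\<^bsub>geom G\<^esub>"
  using torsion_subset_pts pts_iff by (auto simp: torsion_def carrier_geom)

lemma r_torsion: "x \<in> pts G K \<Longrightarrow> r x \<in> torsion G m K"
  using frob_pow_minus_one(2)[OF r eq, of x] r_closed by (simp add: torsion_iff pts_iff)

lemma pts_subgroup: "subgroup (pts G K) (geom G)"
proof -
  interpret Fa: group_hom "geom G" "geom G" Fa by unfold_locales (rule frob_hom)
  show ?thesis
  proof (rule geom.subgroupI)
    show "pts G K \<subseteq> A" using pts_iff by blast
    have "\<one>\<^bsub>geom G\<^esub> \<in> pts G K" by (simp add: pts_iff)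
    then show "pts G K \<noteq> {}" by blast
  qed (simp_all add: pts_iff)
qed

lemma GK_eq: "GK = (geom G)\<lparr>carrier := pts G K\<rparr>"
  by (simp add: pt_group_def)

lemma GK_simps:
  "carrier GK = pts G K" "x \<otimes>\<^bsub>GK\<^esub> y = x \<odot> y" "\<one>\<^bsub>GK\<^esub> = \<one>\<^bsub>geom G\<^esub>"
  by (simp_all add: pt_group_def)

lemma GK_comm_group: "comm_group GK"
proof -
  interpret group GK unfolding GK_eq by (rule subgroup.subgroup_is_group[OF pts_subgroup geom_group])
  show ?thesis by (rule group_comm_groupI) (simp add: GK_simps pts_iff geom.m_comm)
qed

lemma N_subgroup: "subgroup N GK"
proof -
  interpret GK: comm_group GK by (rule GK_comm_group)
  have pow: "x [^]\<^bsub>GK\<^esub> k = x [^]\<^bsub>geom G\<^esub> k" for x and k :: nat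
    by (induction k) (simp_all add: GK_simps)
  have "group_hom GK GK (\<lambda>x. x [^]\<^bsub>GK\<^esub> m)"
    by unfold_locales (rule GK.nat_pow_hom)
  then have "subgroup ((\<lambda>x. x [^]\<^bsub>GK\<^esub> m) ` carrier GK) GK"
    by (rule group_hom.img_is_subgroup)
  then show ?thesis by (simp add: multiples_def pow GK_simps)
qed

lemma N_normal: "N \<lhd> GK"
  using comm_group.normal_iff_subgroup[OF GK_comm_group] N_subgroup by blast

text \<open>Divisibility supplies some \<open>y\<close> with \<open>m y = x\<close>. If instead
  \<open>m y = m w + x\<close> with \<open>w\<close> rational, then
  \<open>F^a y - y = r (m w) + r x\<close>, and \<open>r (m w)\<close> is trivial by rationality of
  \<open>w\<close>; so the value depends neither on the representative nor on
  \<open>y\<close>.\<close>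

lemma kum_coset:
  assumes x: "x \<in> pts G K"
  shows "kum (N #>\<^bsub>GK\<^esub> x) = r x"
  unfolding kummer_map_def
proof (rule the_equality)
  have xc: "x \<in> A" using x pts_iff by blast
  have "\<one>\<^bsub>GK\<^esub> \<otimes>\<^bsub>GK\<^esub> x \<in> N #>\<^bsub>GK\<^esub> x"
    using subgroup.one_closed[OF N_subgroup] unfolding r_coset_def by blast
  then have self: "x \<in> N #>\<^bsub>GK\<^esub> x" using xc by (simp add: GK_simps)
  obtain y where y: "y \<in> A" "y [^]\<^bsub>geom G\<^esub> m = x"
    using geom.l_power_divisible[OF xc, of n] unfolding m by blast
  have "r x = Fa y \<odot> inv\<^bsub>geom G\<^esub> y"
    using frob_pow_minus_one(1)[OF r eq y(1)] y(2) by simp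
  then show "\<exists>x'\<in>N #>\<^bsub>GK\<^esub> x. \<exists>y\<in>A. y [^]\<^bsub>geom G\<^esub> m = x' \<and>
      r x = frob G (card K) y \<odot> inv\<^bsub>geom G\<^esub> y"
    using self y unfolding card_K by blast
next
  have xc: "x \<in> A" using x pts_iff by blast
  fix z assume "\<exists>x'\<in>N #>\<^bsub>GK\<^esub> x. \<exists>y\<in>A. y [^]\<^bsub>geom G\<^esub> m = x' \<and>
      z = frob G (card K) y \<odot> inv\<^bsub>geom G\<^esub> y"
  then obtain y where y: "y \<in> A" "y [^]\<^bsub>geom G\<^esub> m \<in> N #>\<^bsub>GK\<^esub> x"
    "z = Fa y \<odot> inv\<^bsub>geom G\<^esub> y" unfolding card_K by blast
  obtain w where w: "w \<in> pts G K" "y [^]\<^bsub>geom G\<^esub> m = w [^]\<^bsub>geom G\<^esub> m \<odot> x"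
    using y(2) by (auto simp: r_coset_def multiples_def GK_simps)
  have wc: "w \<in> A" using w pts_iff by blast
  have "z = r (w [^]\<^bsub>geom G\<^esub> m \<odot> x)"
    unfolding y(3) frob_pow_minus_one(1)[OF r eq y(1)] w(2) ..
  also have "\<dots> = r (w [^]\<^bsub>geom G\<^esub> m) \<odot> r x"
    using wc xc by (intro EndD(2)[OF r]) auto
  also have "r (w [^]\<^bsub>geom G\<^esub> m) = \<one>\<^bsub>geom G\<^esub>" using pts_iff_r[OF wc] w(1) by simp
  finally show "z = r x" using r_closed[OF xc] by simp
qed

lemma D_cases:
  assumes "C \<in> carrier (GK Mod N)"
  obtains x where "x \<in> pts G K" "C = N #>\<^bsub>GK\<^esub> x"
  using assms by (auto simp: FactGroup_def RCOSETS_def GK_simps)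

lemma kum_hom: "kum \<in> hom (GK Mod N) (GK\<lparr>carrier := torsion G m K\<rparr>)"
proof (rule homI)
  fix C assume "C \<in> carrier (GK Mod N)"
  then obtain x where x: "x \<in> pts G K" "C = N #>\<^bsub>GK\<^esub> x" by (rule D_cases)
  then show "kum C \<in> carrier (GK\<lparr>carrier := torsion G m K\<rparr>)" by (simp add: kum_coset r_torsion)
  fix C' assume "C' \<in> carrier (GK Mod N)"
  then obtain x' where x': "x' \<in> pts G K" "C' = N #>\<^bsub>GK\<^esub> x'" by (rule D_cases)
  have "C \<otimes>\<^bsub>GK Mod N\<^esub> C' = N #>\<^bsub>GK\<^esub> (x \<odot> x')"
    using normal.rcos_sum[OF N_normal, of x x'] x x' by (simp add: FactGroup_def GK_simps)
  then have "kum (C \<otimes>\<^bsub>GK Mod N\<^esub> C') = r (x \<odot> x')"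
    using x x' subgroup.m_closed[OF pts_subgroup] by (simp add: kum_coset)
  also have "\<dots> = r x \<odot> r x'" using x x' pts_iff by (intro EndD(2)[OF r]) auto
  finally show "kum (C \<otimes>\<^bsub>GK Mod N\<^esub> C') = kum C \<otimes>\<^bsub>GK\<lparr>carrier := torsion G m K\<rparr>\<^esub> kum C'"
    using x x' by (simp add: kum_coset GK_simps)
qed

text \<open>If \<open>r z\<close> is trivial, write \<open>z = m y\<close>; triviality of
  \<open>r (m y)\<close> makes \<open>y\<close> rational, so \<open>z\<close> lies in
  \<open>m G(K)\<close>.\<close>

lemma kum_inj: "inj_on kum (carrier (GK Mod N))"
proof (rule inj_onI)
  fix C C' assume "C \<in> carrier (GK Mod N)" "C' \<in> carrier (GK Mod N)" and e: "kum C = kum C'"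
  then obtain x x' where x: "x \<in> pts G K" "C = N #>\<^bsub>GK\<^esub> x" and x': "x' \<in> pts G K" "C' = N #>\<^bsub>GK\<^esub> x'"
    by (metis D_cases)
  interpret GK: comm_group GK by (rule GK_comm_group)
  have c: "x \<in> A" "x' \<in> A" using x x' pts_iff by auto
  define z where "z = x \<odot> inv\<^bsub>geom G\<^esub> x'"
  have z: "z \<in> pts G K" unfolding z_def
    using x x' subgroup.m_closed[OF pts_subgroup] subgroup.m_inv_closed[OF pts_subgroup] by blast
  then have zc: "z \<in> A" using pts_iff by blast
  have x_eq: "x = z \<odot> x'" using c by (simp add: z_def geom.m_assoc)
  have "r z \<odot> r x' = r x'"
    using e x x' EndD(2)[OF r zc c(2)] by (simp add: kum_coset x_eq[symmetric])
  then have "r z = \<one>\<^bsub>geom G\<^esub>" using r_closed[OF zc] r_closed[OF c(2)] by simp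
  obtain y where y: "y \<in> A" "y [^]\<^bsub>geom G\<^esub> m = z"
    using geom.l_power_divisible[OF zc, of n] unfolding m by blast
  then have "y \<in> pts G K" using pts_iff_r[OF y(1)] \<open>r z = \<one>\<^bsub>geom G\<^esub>\<close> by simp
  then have "z \<in> N" using y(2) by (auto simp: multiples_def)
  then have "x \<in> N #>\<^bsub>GK\<^esub> x'" unfolding x_eq by (auto simp: r_coset_def GK_simps)
  then show "C = C'"
    using GK.repr_independence[of x N x'] N_subgroup x x' by (simp add: GK_simps)
qed

text \<open>For finite \<open>G(K)\<close> the quotient by \<open>m G(K)\<close> has as many
  elements as \<open>G[m](K)\<close>, the kernel of multiplication by \<open>m\<close>, so
  injectivity implies surjectivity. For \<open>n = 0\<close> the target is trivial.\<close>

lemma kum_iso: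
  assumes "n = 0 \<or> finite (pts G K)"
  shows "kum \<in> iso (GK Mod N) (GK\<lparr>carrier := torsion G m K\<rparr>)"
proof -
  interpret GK: comm_group GK by (rule GK_comm_group)
  have sub: "kum ` carrier (GK Mod N) \<subseteq> torsion G m K"
    using kum_hom by (auto simp: hom_def)
  have "kum ` carrier (GK Mod N) = torsion G m K"
  proof (cases "n = 0")
    case True
    have "N #>\<^bsub>GK\<^esub> \<one>\<^bsub>GK\<^esub> \<in> carrier (GK Mod N)"
      by (auto simp: FactGroup_def RCOSETS_def)
    then have "kum ` carrier (GK Mod N) \<noteq> {}" by blast
    moreover have "torsion G m K \<subseteq> {\<one>\<^bsub>geom G\<^esub>}"
    proof
      fix x assume "x \<in> torsion G m K"
      then have "x \<in> A" "x [^]\<^bsub>geom G\<^esub> m = \<one>\<^bsub>geom G\<^esub>" by (simp_all add: torsion_iff)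
      moreover have "m = 1" using True m by simp
      ultimately show "x \<in> {\<one>\<^bsub>geom G\<^esub>}" by simp
    qed
    ultimately show ?thesis using sub by blast
  next
    case False
    then have fin: "finite (pts G K)" using assms by blast
    have "card (pts G K) = card (torsion G m K) * card N"
      using geom.card_eq_card_kernel_times_card_image[OF pts_subgroup fin geom.nat_pow_hom, of m]
      by (simp add: torsion_def multiples_def)
    moreover have "card (carrier (GK Mod N)) * card N = card (pts G K)"
      using GK.lagrange[OF N_subgroup] by (simp add: FactGroup_def Coset.order_def GK_simps)
    moreover have "card N > 0"
      using fin subgroup.one_closed[OF N_subgroup] by (auto simp: multiples_def card_gt_0_iff)
    ultimately have "card (kum ` carrier (GK Mod N)) = card (torsion G m K)"
      using card_image[OF kum_inj] by simp
    moreover have "finite (torsion G m K)" using fin by (rule rev_finite_subset) (auto simp: torsion_def)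
    ultimately show ?thesis using sub card_subset_eq by blast
  qed
  then show ?thesis using kum_hom kum_inj by (simp add: iso_def bij_betw_def)
qed

end

end

text \<open>An action of \<open>Q\<close> in which \<open>t\<close> is Frobenius is a ring
  homomorphism to \<open>End G\<close>. One is constructed; the identities are then claimed for
  every such \<open>\<rho>\<close>, since the proof just applies \<open>\<rho>\<close> to the
  relation defining \<open>h\<close>. Surjectivity carries the finiteness condition because a
  constant group of positive height has no nontrivial Kummer values.\<close>

theorem mainTheorem11:
  fixes G :: "'k::{finite,field} ind_group"
    and \<chi> t :: "'l::prime_card padic poly"
    and q l :: nat
  assumes "q = CARD('k)" and "l = CARD('l)"
    and "etale_l_divisible l G"
    and "\<chi> = frob_char_poly G" and "t = [:0, 1:]"
    and "I = PIdl\<^bsub>Zl_poly\<^esub> \<chi>" and "Q = Zl_poly Quot I" and "\<tau> = I +>\<^bsub>Zl_poly\<^esub> t"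
  shows "\<tau> \<in> Units Q \<and>
    (\<exists>\<rho> \<in> Ring.ring_hom Q (End G). \<rho> \<tau> = frob G q) \<and>
    (\<forall>n a J K. a > 0 \<longrightarrow> J = Idl\<^bsub>Zl_poly\<^esub> {of_nat (l ^ n), \<chi>} \<longrightarrow>
      (J +>\<^bsub>Zl_poly\<^esub> t) [^]\<^bsub>Zl_poly Quot J\<^esub> a = \<one>\<^bsub>Zl_poly Quot J\<^esub> \<longrightarrow>
      extension_of_degree a K \<longrightarrow>
      (\<exists>!h. h \<in> carrier Q \<and> \<tau> [^]\<^bsub>Q\<^esub> a \<ominus>\<^bsub>Q\<^esub> \<one>\<^bsub>Q\<^esub> = add_pow Q (l ^ n) h) \<and>
      torsion G (l ^ n) UNIV \<subseteq> pts G K \<and>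
      (\<forall>h \<rho>. h \<in> carrier Q \<longrightarrow> \<tau> [^]\<^bsub>Q\<^esub> a \<ominus>\<^bsub>Q\<^esub> \<one>\<^bsub>Q\<^esub> = add_pow Q (l ^ n) h \<longrightarrow>
         \<rho> \<in> Ring.ring_hom Q (End G) \<longrightarrow> \<rho> \<tau> = frob G q \<longrightarrow>
         frob G q [^]\<^bsub>End G\<^esub> a \<ominus>\<^bsub>End G\<^esub> \<one>\<^bsub>End G\<^esub> = add_pow (End G) (l ^ n) (\<rho> h) \<and>
         (let D = pt_group G K Mod multiples G (l ^ n) K;
              T = (pt_group G K)\<lparr>carrier := torsion G (l ^ n) K\<rparr>;
              kum = kummer_map G (l ^ n) K in
            kum \<in> hom D T \<and> inj_on kum (carrier D) \<and>
            (n = 0 \<or> finite (pts G K) \<longrightarrow> kum \<in> iso D T) \<and>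
            (\<forall>\<xi> \<in> pts G K. kum (multiples G (l ^ n) K #>\<^bsub>pt_group G K\<^esub> \<xi>) = \<rho> h \<xi>))))"
proof -
  interpret etale_l_divisible_group G "TYPE('l)"
    using assms(2,3) by unfold_locales simp
  note q = assms(1) and l = assms(2) and \<chi> = assms(4) and t = assms(5) and I_def = assms(6)
    and Q = assms(7) and \<tau> = assms(8)
  interpret R: cring "Zl_poly :: 'l padic poly ring" by (rule cring_from_type_algebra)
  have I: "ideal I Zl_poly" unfolding I_def by (rule R.cgenideal_ideal) (simp add: type_ring_simps)
  interpret Q: cring Q unfolding Q by (rule ideal.quotient_is_cring[OF I R.is_cring])
  interpret E: ring "End G" by (rule End_ring)
  note quot = quot_simps[OF I, folded Q] and closed = quot_closed[OF I, folded Q]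
  have quot_eq: "I +>\<^bsub>Zl_poly\<^esub> x = I +>\<^bsub>Zl_poly\<^esub> y \<longleftrightarrow> \<chi> dvd x - y" for x y
    by (subst quot_eq_iff[OF I]) (simp only: I_def type_ring_PIdl)
  have units: "\<tau> \<in> Units Q"
  proof -
    obtain u where u: "\<chi> dvd t * u - 1" unfolding t \<chi> by (rule frob_char_poly_X_unit)
    have "\<tau> \<otimes>\<^bsub>Q\<^esub> (I +>\<^bsub>Zl_poly\<^esub> u) = \<one>\<^bsub>Q\<^esub>"
      unfolding \<tau> quot quot_eq by (rule u)
    then show ?thesis
      using closed[of t] closed[of u] Q.m_comm[of \<tau> "I +>\<^bsub>Zl_poly\<^esub> u"]
      unfolding Units_def \<tau>[symmetric] by auto
  qed
  obtain \<rho>0 where \<rho>0: "\<rho>0 \<in> Ring.ring_hom Q (End G)" "\<rho>0 \<tau> = frob G q"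
  proof -
    obtain \<rho> where "\<rho> \<in> Ring.ring_hom (Zl_poly Quot I) (End G)" "\<And>p. \<rho> (I +>\<^bsub>Zl_poly\<^esub> p) = poly_endo p"
      by (rule poly_endo_hom[OF I_def[unfolded \<chi>]]) blast
    then show ?thesis using that[of \<rho>] by (simp add: Q \<tau> t q poly_endo_X)
  qed
  then have "\<exists>\<rho> \<in> Ring.ring_hom Q (End G). \<rho> \<tau> = frob G q" by blast
  note units_and_hom = conjI[OF units conjI[OF this]]
  show ?thesis
  proof (rule units_and_hom, intro allI impI, goal_cases)
    case (1 n a J K)
    note J = 1(2) and ta = 1(3) and K = 1(4)
    have m: "l ^ n = CARD('l) ^ n" by (simp add: l)
    note cK = extension_card[OF K]
    have idJ: "ideal J Zl_poly" unfolding J by (rule R.genideal_ideal) (simp add: type_ring_simps)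
    \<comment> \<open>Once \<open>t ^ a - 1\<close> is split along the two generators of
      \<open>J\<close>, the cofactor \<open>p\<close> of \<open>l ^ n\<close> represents
      \<open>h_a\<close>.\<close>
    have "t ^ a - 1 \<in> J" using ta by (simp only: quot_simps[OF idJ] quot_eq_iff[OF idJ])
    then obtain p g where pg: "t ^ a - 1 = of_nat (l ^ n) * p + \<chi> * g"
      unfolding J by (rule type_ring_Idl2)
    have \<tau>a: "\<tau> [^]\<^bsub>Q\<^esub> a \<ominus>\<^bsub>Q\<^esub> \<one>\<^bsub>Q\<^esub> = I +>\<^bsub>Zl_poly\<^esub> (t ^ a - 1)"
      by (simp only: \<tau> quot)
    have \<tau>a_iff: "\<tau> [^]\<^bsub>Q\<^esub> a \<ominus>\<^bsub>Q\<^esub> \<one>\<^bsub>Q\<^esub> = add_pow Q (l ^ n) (I +>\<^bsub>Zl_poly\<^esub> p') \<longleftrightarrow>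
        \<chi> dvd t ^ a - 1 - of_nat (l ^ n) * p'" for p'
      unfolding \<tau>a quot(5) quot_eq ..
    have ex: "\<tau> [^]\<^bsub>Q\<^esub> a \<ominus>\<^bsub>Q\<^esub> \<one>\<^bsub>Q\<^esub> = add_pow Q (l ^ n) (I +>\<^bsub>Zl_poly\<^esub> p)"
      unfolding \<tau>a_iff pg by simp
    have unique: "h = I +>\<^bsub>Zl_poly\<^esub> p" if h_in: "h \<in> carrier Q"
      and h_eq: "\<tau> [^]\<^bsub>Q\<^esub> a \<ominus>\<^bsub>Q\<^esub> \<one>\<^bsub>Q\<^esub> = add_pow Q (l ^ n) h" for h
    proof -
      obtain p' where h: "h = I +>\<^bsub>Zl_poly\<^esub> p'" by (rule quot_surj[OF I, folded Q, OF h_in])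
      \<comment> \<open>Subtraction leaves \<open>l ^ n (p' - p)\<close>, and \<open>l ^ n\<close>
        can be cancelled because \<open>\<chi>\<close> is monic and \<open>Z_l\<close> is
        torsion-free.\<close>
      have "\<chi> dvd (t ^ a - 1 - of_nat (l ^ n) * p) - (t ^ a - 1 - of_nat (l ^ n) * p')"
        using ex h_eq unfolding h \<tau>a_iff by (rule dvd_diff)
      then have "\<chi> dvd [:of_nat (l ^ n):] * (p' - p)"
        by (simp only: of_nat_poly[symmetric]) (simp add: algebra_simps)
      then have "\<chi> dvd p' - p"
        by (rule monic_dvd_of_dvd_const_mult[rotated 2])
          (use frob_char_poly_monic padic_torsion_free in \<open>auto simp: \<chi> l\<close>)
      then show ?thesis unfolding h quot_eq .
    qed
    have key: "frob G q [^]\<^bsub>End G\<^esub> a \<ominus>\<^bsub>End G\<^esub> \<one>\<^bsub>End G\<^esub> = add_pow (End G) (l ^ n) (\<rho> h)"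
      "\<rho> h \<in> carrier (End G)"
      if h: "h \<in> carrier Q" "\<tau> [^]\<^bsub>Q\<^esub> a \<ominus>\<^bsub>Q\<^esub> \<one>\<^bsub>Q\<^esub> = add_pow Q (l ^ n) h"
        and \<rho>: "\<rho> \<in> Ring.ring_hom Q (End G)" "\<rho> \<tau> = frob G q" for h \<rho>
    proof -
      interpret \<rho>: ring_hom_ring Q "End G" \<rho>
        by (rule ring_hom_ringI2[OF Q.ring_axioms E.ring_axioms \<rho>(1)])
      have "\<tau> \<in> carrier Q" unfolding \<tau> by (rule closed)
      then show "frob G q [^]\<^bsub>End G\<^esub> a \<ominus>\<^bsub>End G\<^esub> \<one>\<^bsub>End G\<^esub> = add_pow (End G) (l ^ n) (\<rho> h)"
        using arg_cong[OF h(2), of \<rho>] h(1)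
        by (simp add: \<rho>.hom_a_minus \<rho>.hom_nat_pow_ring \<rho>.hom_add_pow_ring \<rho>(2))
      show "\<rho> h \<in> carrier (End G)" using h(1) by simp
    qed
    \<comment> \<open>Rationality of torsion mentions neither \<open>h\<close> nor
      \<open>\<rho>\<close>, so it is derived from the class of \<open>p\<close> and the action
      \<open>\<rho>0\<close> constructed above.\<close>
    note key0 = key[OF closed ex \<rho>0]
    have tors: "torsion G (l ^ n) UNIV \<subseteq> pts G K"
      by (rule torsion_subset_pts[OF m cK(1) cK(2)[symmetric] key0(2) key0(1)[unfolded q]])
    let ?D = "pt_group G K Mod multiples G (l ^ n) K"
      and ?T = "(pt_group G K)\<lparr>carrier := torsion G (l ^ n) K\<rparr>" and ?kum = "kummer_map G (l ^ n) K"
    have kummer: "?kum \<in> hom ?D ?T" "inj_on ?kum (carrier ?D)"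
      "n = 0 \<or> finite (pts G K) \<Longrightarrow> ?kum \<in> iso ?D ?T"
      "\<xi> \<in> pts G K \<Longrightarrow> ?kum (multiples G (l ^ n) K #>\<^bsub>pt_group G K\<^esub> \<xi>) = \<rho> h \<xi>"
      if h: "h \<in> carrier Q" "\<tau> [^]\<^bsub>Q\<^esub> a \<ominus>\<^bsub>Q\<^esub> \<one>\<^bsub>Q\<^esub> = add_pow Q (l ^ n) h"
        and \<rho>: "\<rho> \<in> Ring.ring_hom Q (End G)" "\<rho> \<tau> = frob G q" for h \<rho> \<xi>
    proof -
      note hyps = m cK(1) cK(2)[symmetric] key(2)[OF h \<rho>] key(1)[OF h \<rho>, unfolded q]
      show "?kum \<in> hom ?D ?T" by (rule kum_hom[OF hyps])
      show "inj_on ?kum (carrier ?D)" by (rule kum_inj[OF hyps])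
      show "n = 0 \<or> finite (pts G K) \<Longrightarrow> ?kum \<in> iso ?D ?T" by (rule kum_iso[OF hyps])
      show "\<xi> \<in> pts G K \<Longrightarrow> ?kum (multiples G (l ^ n) K #>\<^bsub>pt_group G K\<^esub> \<xi>) = \<rho> h \<xi>"
        by (rule kum_coset[OF hyps])
    qed
    have ex1: "\<exists>!h. h \<in> carrier Q \<and> \<tau> [^]\<^bsub>Q\<^esub> a \<ominus>\<^bsub>Q\<^esub> \<one>\<^bsub>Q\<^esub> = add_pow Q (l ^ n) h"
      by (rule ex1I[of _ "I +>\<^bsub>Zl_poly\<^esub> p"]) (use closed ex unique in blast)+
    show ?case
      unfolding Let_def
      by (intro conjI allI impI ballI ex1 tors) (rule key(1) kummer; assumption)+
  qed
qed

end
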